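(* Let $X$ be a Cantor space, let $\mathcal{H}(X)$ be its group of self-homeomorphisms with the topology of uniform convergence, and let $\mathcal{S}_X\subset\mathcal{H}(X)$ be the set of Special Homeomorphisms on $X$. Then $\mathcal{S}_X$ is a single conjugacy class (a single orbit of the conjugation action of $\mathcal{H}(X)$ on itself), and it is a dense $G_\delta$ subset of $\mathcal{H}(X)$. In particular, every Special Homeomorphism is of dense type, i.e. $\mathcal{S}_X\subset\mathcal{T}_X$. The union of the remaining conjugacy classes is the complement $\mathcal{H}(X)\setminus\mathcal{S}_X$, and so it is of first category in $\mathcal{H}(X)$.
   Context: A Cantor space is a space homeomorphic to the Cantor set. A dynamical system $(X,T)$ is a nonempty compact metrizable space $X$ with a homeomorphism $T:X\to X$; $(X_1,T_1)$ and $(X,T)$ are isomorphic if there is a homeomorphism $F:X_1\to X$ with $F\circ T_1=T\circ F$. $\mathcal{H}(X)$, with the topology of uniform convergence, is a Polish group. For $T\in\mathcal{H}(X)$ put $\mathcal{O}(T)=\{H\circ T\circ H^{-1}:H\in\mathcal{H}(X)\}$. $T$ is of dense type if $\mathcal{O}(T)$ is dense in $\mathcal{H}(X)$, and $\mathcal{T}_X=\{T\in\mathcal{H}(X):\overline{\mathcal{O}(T)}=\mathcal{H}(X)\}$. The universal adding machine. $\Theta=\varprojlim \mathbb{Z}/m\mathbb{Z}$ (inverse limit over positive integers $m$ directed by divisibility), a compact topological ring; $\Pi:\mathbb{Z}\to\Theta$ is the canonical injective ring homomorphism. The sets $C$ and $D$. Let $I=[0,1]$ and let $C\subset I$ be the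 classical middle-thirds Cantor set. $D\subset I$ is the union of $C$ with all those components of $I\setminus C$ (open middle thirds) which have length $3^{-(2k+1)}$, $k=0,1,2,\dots$ (so the removed middle thirds of length $1/3$, $1/27$, $\dots$ are retained in $D$, and those of length $1/9$, $1/81$, $\dots$ are not). Let $\mathcal{J}$ be the countable set of components $j=(j_-,j_+)$ of the open set $D\setminus C$. The system $(X(D,C),T(D,C))$. For each $j\in\mathcal{J}$ choose a strictly increasing bi-infinite sequence $(q_j(x))_{x\in\mathbb{Z}}$ in $j$ with $q_j(x)\to j_\pm$ as $x\to\pm\infty$. Let $$Z(D,C)=(C\times\Theta)\ \cup\ \{(q_j(x),\Pi(x)):j\in\mathcal{J},\ x\in\mathbb{Z}\}\subset I\times\Theta$$ with the subspace topology; it is compact and zero-dimensional. Let $\tau_{(D,C)}:Z(D,C)\to Z(D,C)$ be the homeomorphism $(a,t)\mapsto(a,t+1)$ for $(a,t)\in C\times\Theta$, and $(q_j(x),\Pi(x))\mapsto(q_j(x+1),\Pi(x+1))$ for $j\in\mathcal{J}$, $x\in\mathbb{Z}$. (Up to isomorphism this does not depend on the choice of the sequences $q_j$.) Put $X(D,C)=Z(D,C)\times C$, which is a Cantor space, and $T(D,C)=\tau_{(D,C)}\times 1_C$. A homeomorphism $T$ of a Cantor space $X$ is a Special Homeomorphism on $X$ if $(X,T)$ is isomorphic to $(X(D,C),T(D,C))$. *)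

theory Defs
  imports "HOL-Analysis.Analysis" "HOL-Real_Asymp.Real_Asymp"
begin

primrec cantor_stage :: "nat \<Rightarrow> real set" where
  "cantor_stage 0 = {0..1}"
| "cantor_stage (Suc n) =
     (\<lambda>x. x / 3) ` cantor_stage n \<union> (\<lambda>x. (x + 2) / 3) ` cantor_stage n"

definition cantor_set :: "real set" where
  "cantor_set = (\<Inter>n. cantor_stage n)"

definition cantor_space :: "'a topology \<Rightarrow> bool" where
  "cantor_space X \<longleftrightarrow> X homeomorphic_space top_of_set cantor_set"

text \<open>The elements of \<open>\<H>(X)\<close> are extensional on the carrier of \<open>X\<close>, so that equality of functions
  is equality of homeomorphisms.\<close>

definition homeos :: "'a topology \<Rightarrow> ('a \<Rightarrow> 'a) set" where
  "homeos X = {f. homeomorphic_map X X f \<and> f \<in> extensional (topspace X)}"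

text \<open>For a compact metrizable space the topology of uniform convergence is that of the
  supremum metric, for any metric \<open>m\<close> inducing the topology. The value \<open>0\<close> off \<open>\<H>(X)\<close> is
  irrelevant to the topology; it serves the locale \<^locale>\<open>Metric_space\<close>, which requires metrics
  to be nonnegative everywhere.\<close>

definition sup_dist :: "'a metric \<Rightarrow> ('a \<Rightarrow> 'a) \<Rightarrow> ('a \<Rightarrow> 'a) \<Rightarrow> real" where
  "sup_dist m f g =
     (if f \<in> homeos (mtopology_of m) \<and> g \<in> homeos (mtopology_of m)
      then SUP x\<in>mspace m. mdist m (f x) (g x) else 0)"

definition homeo_topology :: "'a metric \<Rightarrow> ('a \<Rightarrow> 'a) topology" where
  "homeo_topology m = Metric_space.mtopology (homeos (mtopology_of m)) (sup_dist m)"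

definition conj_class :: "'a topology \<Rightarrow> ('a \<Rightarrow> 'a) \<Rightarrow> ('a \<Rightarrow> 'a) set" where
  "conj_class X T =
     {restrict (H \<circ> T \<circ> inv_into (topspace X) H) (topspace X) | H. H \<in> homeos X}"

definition dense_type_homeos :: "'a metric \<Rightarrow> ('a \<Rightarrow> 'a) set" where
  "dense_type_homeos m =
     {T \<in> homeos (mtopology_of m).
        homeo_topology m closure_of conj_class (mtopology_of m) T = homeos (mtopology_of m)}"

definition isomorphic_systems ::
    "'a topology \<Rightarrow> ('a \<Rightarrow> 'a) \<Rightarrow> 'b topology \<Rightarrow> ('b \<Rightarrow> 'b) \<Rightarrow> bool" where
  "isomorphic_systems X1 T1 X T \<longleftrightarrow>
     (\<exists>F. homeomorphic_map X1 X F \<and> (\<forall>x\<in>topspace X1. F (T1 x) = T (F x)))"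

definition nowhere_dense_in :: "'a topology \<Rightarrow> 'a set \<Rightarrow> bool" where
  "nowhere_dense_in X S \<longleftrightarrow> S \<subseteq> topspace X \<and> X interior_of (X closure_of S) = {}"

definition first_category_in :: "'a topology \<Rightarrow> 'a set \<Rightarrow> bool" where
  "first_category_in X S \<longleftrightarrow>
     (\<exists>\<N>. countable \<N> \<and> (\<forall>N\<in>\<N>. nowhere_dense_in X N) \<and> S = \<Union>\<N>)"

text \<open>\<open>\<int>/m\<int>\<close> is represented by the residues \<open>{0..<m}\<close>; an element of the inverse limit is a
  compatible family indexed by the positive integers.\<close>

definition theta_topology :: "(nat \<Rightarrow> int) topology" where
  "theta_topology =
     subtopology (product_topology (\<lambda>m. discrete_topology {0..<int m}) {1..})
       {t. \<forall>m\<ge>1. \<forall>n\<ge>1. m dvd n \<longrightarrow> t n mod int m = t m}"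

definition theta_of_int :: "int \<Rightarrow> nat \<Rightarrow> int" where
  "theta_of_int x = (\<lambda>m\<in>{1..}. x mod int m)"

definition theta_add :: "(nat \<Rightarrow> int) \<Rightarrow> (nat \<Rightarrow> int) \<Rightarrow> nat \<Rightarrow> int" where
  "theta_add s t = (\<lambda>m\<in>{1..}. (s m + t m) mod int m)"

text \<open>The components of \<open>{0..1} - cantor_set\<close> and of \<open>D_set - cantor_set\<close> are bounded open
  intervals \<open>j\<close>, with end points \<open>Inf j\<close> and \<open>Sup j\<close>.\<close>

definition D_set :: "real set" where
  "D_set = cantor_set \<union>
     \<Union>{j \<in> components ({0..1} - cantor_set). \<exists>k::nat. Sup j - Inf j = 1 / 3 ^ (2 * k + 1)}"

definition D_gaps :: "real set set" where
  "D_gaps = components (D_set - cantor_set)"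

definition gap_sequences :: "(real set \<Rightarrow> int \<Rightarrow> real) \<Rightarrow> bool" where
  "gap_sequences q \<longleftrightarrow>
     (\<forall>j\<in>D_gaps. strict_mono (q j) \<and> range (q j) \<subseteq> j \<and>
        (q j \<longlongrightarrow> Sup j) at_top \<and> (q j \<longlongrightarrow> Inf j) at_bot)"

definition Z_set :: "(real set \<Rightarrow> int \<Rightarrow> real) \<Rightarrow> (real \<times> (nat \<Rightarrow> int)) set" where
  "Z_set q = cantor_set \<times> topspace theta_topology \<union>
     {(q j x, theta_of_int x) | j x. j \<in> D_gaps}"

definition Z_topology :: "(real set \<Rightarrow> int \<Rightarrow> real) \<Rightarrow> (real \<times> (nat \<Rightarrow> int)) topology" where
  "Z_topology q = subtopology (prod_topology (top_of_set {0..1}) theta_topology) (Z_set q)"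

text \<open>Off \<open>cantor_set\<close>, the first coordinate \<open>a\<close> of a point of \<open>Z_set q\<close> determines the pair
  \<open>(j, x)\<close> with \<open>a = q j x\<close>, because the gaps are disjoint and the \<open>q j\<close> are injective.\<close>

definition tau_DC ::
    "(real set \<Rightarrow> int \<Rightarrow> real) \<Rightarrow> real \<times> (nat \<Rightarrow> int) \<Rightarrow> real \<times> (nat \<Rightarrow> int)" where
  "tau_DC q = (\<lambda>(a, t).
     if a \<in> cantor_set then (a, theta_add t (theta_of_int 1))
     else (THE p. \<exists>j\<in>D_gaps. \<exists>x. a = q j x \<and> p = (q j (x + 1), theta_of_int (x + 1))))"

definition X_DC :: "(real set \<Rightarrow> int \<Rightarrow> real) \<Rightarrow> ((real \<times> (nat \<Rightarrow> int)) \<times> real) topology" where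
  "X_DC q = prod_topology (Z_topology q) (top_of_set cantor_set)"

definition T_DC ::
    "(real set \<Rightarrow> int \<Rightarrow> real) \<Rightarrow> (real \<times> (nat \<Rightarrow> int)) \<times> real \<Rightarrow> (real \<times> (nat \<Rightarrow> int)) \<times> real" where
  "T_DC q = map_prod (tau_DC q) id"

definition special_homeos ::
    "(real set \<Rightarrow> int \<Rightarrow> real) \<Rightarrow> 'a topology \<Rightarrow> ('a \<Rightarrow> 'a) set" where
  "special_homeos q X = {T \<in> homeos X. isomorphic_systems X T (X_DC q) (T_DC q)}"

lemma Metric_space_sup_dist:
  assumes "compact_space (mtopology_of m)" and ne: "mspace m \<noteq> {}"
  shows "Metric_space (homeos (mtopology_of m)) (sup_dist m)"
proof -
  let ?H = "homeos (mtopology_of m)"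
  have M: "Metric_space (mspace m) (mdist m)" by simp
  have "compactin (Metric_space.mtopology (mspace m) (mdist m)) (mspace m)"
    using assms(1) by (simp add: compact_space_def) (simp add: mtopology_of_def)
  then have "Metric_space.mbounded (mspace m) (mdist m) (mspace m)"
    by (rule Metric_space.compactin_imp_mbounded[OF M])
  then obtain B where B: "\<And>x y. x \<in> mspace m \<Longrightarrow> y \<in> mspace m \<Longrightarrow> mdist m x y \<le> B"
    by (auto simp: Metric_space.mbounded_alt[OF M])
  have mapsto: "f x \<in> mspace m" if "f \<in> ?H" "x \<in> mspace m" for f x
  proof -
    have "f ` mspace m = mspace m"
      using that(1) homeomorphic_imp_surjective_map[of "mtopology_of m" "mtopology_of m" f]
      by (simp add: homeos_def)
    then show ?thesis using that(2) by (metis imageI)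
  qed
  have bdd: "bdd_above ((\<lambda>x. mdist m (f x) (g x)) ` mspace m)" if "f \<in> ?H" "g \<in> ?H" for f g
    by (intro bdd_aboveI2[where M=B] B mapsto[OF that(1)] mapsto[OF that(2)])
  have upper: "mdist m (f x) (g x) \<le> sup_dist m f g" if "f \<in> ?H" "g \<in> ?H" "x \<in> mspace m" for f g x
    using cSUP_upper[OF that(3) bdd[OF that(1,2)]] that by (simp add: sup_dist_def)
  have least: "sup_dist m f g \<le> c"
    if "f \<in> ?H" "g \<in> ?H" "\<And>x. x \<in> mspace m \<Longrightarrow> mdist m (f x) (g x) \<le> c" for f g c
    using cSUP_least[OF ne that(3)] that by (simp add: sup_dist_def)
  obtain x0 where x0: "x0 \<in> mspace m" using ne by blast
  have nonneg: "0 \<le> sup_dist m f g" for f g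
  proof (cases "f \<in> ?H \<and> g \<in> ?H")
    case True
    then show ?thesis using order_trans[OF mdist_nonneg upper] x0 by blast
  next
    case False
    then show ?thesis by (auto simp: sup_dist_def)
  qed
  show ?thesis
  proof
    fix f g
    show "0 \<le> sup_dist m f g" by (rule nonneg)
    show "sup_dist m f g = sup_dist m g f"
      by (auto simp: sup_dist_def mdist_commute)
  next
    fix f g assume fg: "f \<in> ?H" "g \<in> ?H"
    show "sup_dist m f g = 0 \<longleftrightarrow> f = g"
    proof
      assume eq: "sup_dist m f g = 0"
      have "f x = g x" if x: "x \<in> mspace m" for x
      proof -
        have "mdist m (f x) (g x) = 0"
          using upper[OF fg x] eq mdist_nonneg[of m "f x" "g x"] by linarith
        then show ?thesis using mapsto[OF fg(1) x] mapsto[OF fg(2) x] by simp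
      qed
      moreover have "f \<in> extensional (mspace m)" "g \<in> extensional (mspace m)"
        using fg by (simp_all add: homeos_def)
      ultimately show "f = g" by (intro extensionalityI[of f "mspace m" g])
    next
      assume "f = g"
      then have "mdist m (f x) (g x) \<le> 0" if "x \<in> mspace m" for x
        using mdist_zero[OF mapsto[OF fg(2) that] mapsto[OF fg(2) that]] by simp
      then have "sup_dist m f g \<le> 0" by (rule least[OF fg])
      then show "sup_dist m f g = 0" using nonneg[of f g] by linarith
    qed
  next
    fix f g h assume fgh: "f \<in> ?H" "g \<in> ?H" "h \<in> ?H"
    show "sup_dist m f h \<le> sup_dist m f g + sup_dist m g h"
    proof (rule least[OF fgh(1,3)])
      fix x assume x: "x \<in> mspace m"
      have "mdist m (f x) (h x) \<le> mdist m (f x) (g x) + mdist m (g x) (h x)"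
        by (rule mdist_triangle[OF mapsto[OF fgh(1) x] mapsto[OF fgh(2) x] mapsto[OF fgh(3) x]])
      then show "mdist m (f x) (h x) \<le> sup_dist m f g + sup_dist m g h"
        using upper[OF fgh(1,2) x] upper[OF fgh(2,3) x] by linarith
    qed
  qed
qed

lemma cantor_stage_props: "closed (cantor_stage n)" "cantor_stage n \<subseteq> {0..1}"
  "0 \<in> cantor_stage n" "1 \<in> cantor_stage n"
proof (induction n)
  case (Suc n)
  have "compact (cantor_stage n)"
    using Suc(1,2) by (meson bounded_closed_interval bounded_subset compact_eq_bounded_closed)
  then have "compact (cantor_stage (Suc n))"
    unfolding cantor_stage.simps
    by (intro compact_Un compact_continuous_image continuous_intros) auto
  then show "closed (cantor_stage (Suc n))" by (rule compact_imp_closed)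
  show "cantor_stage (Suc n) \<subseteq> {0..1}" using Suc(2) by (auto simp: subset_iff)
  show "0 \<in> cantor_stage (Suc n)" using Suc(3) by (auto intro: image_eqI[of _ _ 0])
  show "1 \<in> cantor_stage (Suc n)" using Suc(4) by (auto intro: image_eqI[of _ _ 1])
qed auto

lemma open_D_set_minus: "open (D_set - cantor_set)"
proof -
  have C: "closed cantor_set" "0 \<in> cantor_set" "1 \<in> cantor_set"
    unfolding cantor_set_def using cantor_stage_props by (simp_all add: closed_INT)
  then have "{0..1} - cantor_set = {0<..<1} - cantor_set"
    by (auto simp: less_le)
  then have op: "open ({0..1} - cantor_set)" using C by (simp add: open_Diff)
  define J where "J =
     {j \<in> components ({0..1} - cantor_set). \<exists>k::nat. Sup j - Inf j = 1 / 3 ^ (2 * k + 1)}"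
  have J: "open j" "j \<inter> cantor_set = {}" if "j \<in> J" for j
    using that op in_components_subset[of j "{0..1} - cantor_set"]
    by (auto simp: J_def open_components)
  have "D_set - cantor_set = \<Union>J"
    using J(2) unfolding D_set_def J_def[symmetric] by auto
  also have "open (\<Union>J)" using J(1) by (rule open_Union[rule_format])
  finally show ?thesis .
qed

lemma gap_interval:
  assumes "j \<in> D_gaps"
  shows "Inf j < Sup j" "j = {Inf j<..<Sup j}"
proof -
  have "D_set \<subseteq> {0..1}"
  proof -
    have "cantor_set \<subseteq> {0..1}" using cantor_stage_props(2)[of 0] unfolding cantor_set_def by blast
    moreover have "j \<subseteq> {0..1}" if "j \<in> components ({0..1} - cantor_set)" for j
      using in_components_subset[OF that] by blast
    ultimately show ?thesis unfolding D_set_def by (simp add: Sup_le_iff)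
  qed
  then have sub: "j \<subseteq> {0..1}" 
    using assms in_components_subset[of j "D_set - cantor_set"] unfolding D_gaps_def by blast
  have j: "open j" "connected j" "j \<noteq> {}"
    using assms open_D_set_minus
    by (auto simp: D_gaps_def open_components in_components_connected in_components_nonempty)
  have bd: "bdd_above j" "bdd_below j" using sub bdd_above_mono[of "{0..1}" j] bdd_below_mono[of "{0..1}" j] by simp_all
  show eq: "j = {Inf j<..<Sup j}"
  proof (intro equalityI subsetI)
    fix x assume x: "x \<in> j"
    then obtain e where e: "e > 0" "cball x e \<subseteq> j" using j(1) open_contains_cball by blast
    then have "x - e \<in> j" "x + e \<in> j" by (auto simp: subset_iff dist_real_def)
    then have "Inf j \<le> x - e" "x + e \<le> Sup j" using bd by (auto intro: cInf_lower cSup_upper)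
    then show "x \<in> {Inf j<..<Sup j}" using e by auto
  next
    fix x assume "x \<in> {Inf j<..<Sup j}"
    then obtain a b where "a \<in> j" "a < x" "b \<in> j" "x < b"
      using j(3) bd by (auto simp: cInf_less_iff less_cSup_iff)
    then show "x \<in> j" using j(2) by (meson connected_iff_interval less_imp_le)
  qed
  show "Inf j < Sup j" using eq j(3) by (metis greaterThanLessThan_empty_iff not_le)
qed

lemma gap_sequences_exist: "\<exists>q. gap_sequences q"
proof -
  define s :: "int \<Rightarrow> real" where "s x = real_of_int x / (1 + \<bar>real_of_int x\<bar>)" for x
  define q where "q j x = (Inf j + Sup j) / 2 + (Sup j - Inf j) / 2 * s x" for j :: "real set" and x
  have s_mono: "s x < s y" if "x < y" for x y
  proof -
    have xy: "real_of_int x < real_of_int y" using that by simp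
    consider "0 \<le> x" | "y \<le> 0" | "x < 0" "0 < y" by linarith
    then show ?thesis
    proof cases
      case 1
      then have "s x = 1 - 1 / (1 + real_of_int x)" "s y = 1 - 1 / (1 + real_of_int y)"
        using that by (auto simp: s_def field_simps)
      moreover have "1 / (1 + real_of_int y) < 1 / (1 + real_of_int x)"
        using 1 xy by (intro divide_strict_left_mono mult_pos_pos) auto
      ultimately show ?thesis by linarith
    next
      case 2
      then have "s x = 1 / (1 - real_of_int x) - 1" "s y = 1 / (1 - real_of_int y) - 1"
        using that by (auto simp: s_def divide_simps)
      moreover have "1 / (1 - real_of_int x) < 1 / (1 - real_of_int y)"
        using 2 xy that by (intro divide_strict_left_mono mult_pos_pos) auto
      ultimately show ?thesis by linarith
    next
      case 3
      then have "s x < 0" "0 < s y" by (auto simp: s_def divide_less_0_iff)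
      then show ?thesis by linarith
    qed
  qed
  have s_bd: "-1 < s x" "s x < 1" for x
    by (auto simp: s_def divide_simps abs_if)
  have lim: "((\<lambda>x::real. x / (1 + \<bar>x\<bar>)) \<longlongrightarrow> 1) at_top" "((\<lambda>x::real. x / (1 + \<bar>x\<bar>)) \<longlongrightarrow> -1) at_bot"
    by real_asymp+
  have s_top: "(s \<longlongrightarrow> 1) at_top"
    unfolding s_def by (rule filterlim_compose[OF lim(1) filterlim_real_of_int_at_top])
  have ab: "filterlim real_of_int at_bot at_bot"
    by (auto simp: filterlim_at_bot eventually_at_bot_linorder) (meson le_floor_iff)
  have s_bot: "(s \<longlongrightarrow> -1) at_bot"
    unfolding s_def by (rule filterlim_compose[OF lim(2) ab])
  have "(q j \<longlongrightarrow> (Inf j + Sup j) / 2 + (Sup j - Inf j) / 2 * 1) at_top"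
      "(q j \<longlongrightarrow> (Inf j + Sup j) / 2 + (Sup j - Inf j) / 2 * -1) at_bot" for j
    unfolding q_def by (rule tendsto_add[OF tendsto_const tendsto_mult[OF tendsto_const]], fact)+
  then have "(q j \<longlongrightarrow> Sup j) at_top" "(q j \<longlongrightarrow> Inf j) at_bot" for j
    by (simp_all add: field_simps)
  moreover have "strict_mono (q j) \<and> range (q j) \<subseteq> j" if "j \<in> D_gaps" for j
  proof
    note I = gap_interval[OF that]
    show "strict_mono (q j)"
      using s_mono I(1) by (auto simp: strict_mono_def q_def)
    have "q j x \<in> {Inf j<..<Sup j}" for x
    proof -
      have "(Sup j - Inf j) * s x < (Sup j - Inf j) * 1" "(Sup j - Inf j) * -1 < (Sup j - Inf j) * s x"
        using I(1) s_bd[of x] by (intro mult_strict_left_mono; simp)+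
      then show ?thesis by (simp add: q_def field_simps)
    qed
    then show "range (q j) \<subseteq> j" using I(2) by blast
  qed
  ultimately have "gap_sequences q" by (auto simp: gap_sequences_def)
  then show ?thesis by blast
qed

end

theory Submission
  imports Defs
begin

text \<open>A finite clopen partition of a system turns orbits into walks. Call a system universal if every
  finite clopen partition is refined by one whose transition graph is a disjoint union of dumbbells
  (a loop of length \<open>L\<close>, a bar, a second loop of length \<open>L\<close>), with \<open>L\<close> divisible by any prescribed
  number and with every dumbbell occurring as often as desired, such that for the given partition each
  loop is also traversed along some dumbbell. For such a refinement every orbit codes as a walk
  traversing a dumbbell, so the set of bi-infinite words coded by a partition determines which
  refinements exist; a back-and-forth argument shows that any two universal systems are isomorphic.
  For each partition the existence of the refinement is an open condition on the homeomorphism,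
  which gives a \<open>G\<^sub>\<delta>\<close> set, and a universal system realizes every finite relation without
  dead ends, which gives density. Finally, \<open>X(D,C)\<close> is universal: the bar of a dumbbell is the orbit
  in a retained gap, the loops come from the adding machines near its ends, and the removed gaps cut
  the system into such pieces.\<close>


section \<open>Locally constant maps and zero-dimensional compacta\<close>


text \<open>Matching the cells of two partitions is enough for Brouwer's theorem but loses the
  dynamics; the invariant of the back-and-forth is therefore equality of the sets
  \<open>walks\<close> of bi-infinite words. Dumbbells are chosen because a single orbit crossing
  the bar contains, up to a shift of time, every finite walk in its dumbbell, so finitely many
  traversals describe the whole set of words. An orbit circling one loop for ever is only a limit of
  traversals; requiring that every loop be spelled along some dumbbell spares a separate treatment
  of such orbits. Divisibility of \<open>L\<close> allows \<open>cw\<close> to fold a finer dumbbell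
  onto a coarser one while respecting edges, and the copies give enough freedom to make the
  resulting assignment of dumbbells surjective. In the model the copies come from the factor C, on
  which the map is the identity, and the loops of arbitrary divisibility from the adding machine,
  whose residues are locally constant. A homeomorphism satisfies the condition by following the
  edges of a fixed clopen partition, which small perturbations do not disturb.\<close>

definition lconst :: "'a topology \<Rightarrow> ('a \<Rightarrow> 'b) \<Rightarrow> bool" where
  "lconst X f \<longleftrightarrow> (\<forall>v. openin X {x \<in> topspace X. f x = v})"

lemma lconstD: "lconst X f \<Longrightarrow> openin X {x \<in> topspace X. f x = v}"
  by (simp add: lconst_def)

lemma lconst_open_vimage:
  assumes "lconst X f"
  shows "openin X {x \<in> topspace X. P (f x)}"
proof -
  have "{x \<in> topspace X. P (f x)} = \<Union>((\<lambda>v. {x \<in> topspace X. f x = v}) ` {v. P v})" by auto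
  also have "openin X \<dots>" using assms by (auto simp: lconst_def)
  finally show ?thesis .
qed

lemma lconst_closed_vimage:
  assumes "lconst X f"
  shows "closedin X {x \<in> topspace X. P (f x)}"
proof -
  have "topspace X - {x \<in> topspace X. P (f x)} = {x \<in> topspace X. \<not> P (f x)}" by auto
  then show ?thesis using lconst_open_vimage[OF assms, of "\<lambda>v. \<not> P v"]
    by (auto simp: closedin_def)
qed

lemma lconst_const: "lconst X (\<lambda>x. c)"
  unfolding lconst_def
proof
  fix v show "openin X {x \<in> topspace X. c = v}" by (cases "c = v") auto
qed

lemma lconst_comp: "lconst X f \<Longrightarrow> lconst X (\<lambda>x. h (f x))"
  using lconst_open_vimage[of X f] by (auto simp: lconst_def)

text \<open>The partition \<open>h v\<close> may be chosen separately on each cell of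
  \<open>g\<close>. Shifts of time and copy labels that depend on the dumbbell are shown to be
  clopen data in this way.\<close>

lemma lconst_dep:
  assumes "lconst X g" "\<And>v. lconst X (h v)"
  shows "lconst X (\<lambda>x. h (g x) x)"
  unfolding lconst_def
proof
  fix w
  have "{x \<in> topspace X. h (g x) x = w} =
      \<Union>((\<lambda>v. {x \<in> topspace X. g x = v} \<inter> {x \<in> topspace X. h v x = w}) ` UNIV)" by auto
  also have "openin X \<dots>" using assms by (intro openin_Union) (auto simp: lconst_def intro!: openin_Int)
  finally show "openin X {x \<in> topspace X. h (g x) x = w}" .
qed

lemma lconst_Pair:
  assumes "lconst X f" "lconst X g"
  shows "lconst X (\<lambda>x. (f x, g x))"
  by (rule lconst_dep[of X f "\<lambda>v x. (v, g x)"]) (auto intro: assms lconst_comp[where h="\<lambda>y. (_, y)"])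

lemma lconst_cong:
  assumes "\<And>x. x \<in> topspace X \<Longrightarrow> f x = g x"
  shows "lconst X f \<longleftrightarrow> lconst X g"
proof -
  have "{x \<in> topspace X. f x = v} = {x \<in> topspace X. g x = v}" for v using assms by auto
  then show ?thesis by (simp add: lconst_def)
qed

lemma lconst_continuous:
  assumes "continuous_map X Y h" "lconst Y f"
  shows "lconst X (\<lambda>x. f (h x))"
  unfolding lconst_def
proof
  fix v
  have "openin X {x \<in> topspace X. h x \<in> {y \<in> topspace Y. f y = v}}"
    using assms by (intro openin_continuous_map_preimage) (auto simp: lconst_def)
  moreover have "{x \<in> topspace X. h x \<in> {y \<in> topspace Y. f y = v}} = {x \<in> topspace X. f (h x) = v}"
    using continuous_map_image_subset_topspace[OF assms(1)] by auto
  ultimately show "openin X {x \<in> topspace X. f (h x) = v}" by simp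
qed

lemma compact_space_cover:
  assumes "compact_space X" "\<And>i. i \<in> I \<Longrightarrow> openin X (U i)" "topspace X \<subseteq> (\<Union>i\<in>I. U i)"
  obtains J where "finite J" "J \<subseteq> I" "topspace X \<subseteq> (\<Union>i\<in>J. U i)"
proof -
  have "(\<forall>V\<in>U ` I. openin X V) \<and> topspace X \<subseteq> \<Union>(U ` I)" using assms by blast
  then obtain F where F: "finite F" "F \<subseteq> U ` I" "topspace X \<subseteq> \<Union>F"
    using assms(1)[unfolded compact_space_alt, THEN spec[of _ "U ` I"]] by blast
  from finite_subset_image[OF F(1,2)] obtain J where "J \<subseteq> I" "finite J" "F = U ` J" by blast
  then show ?thesis using F(3) that by blast
qed

lemma lconst_finite_image:
  assumes "compact_space X" "lconst X f"
  shows "finite (f ` topspace X)"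
proof -
  obtain V where V: "finite V" "topspace X \<subseteq> (\<Union>v\<in>V. {x \<in> topspace X. f x = v})"
  proof (rule compact_space_cover[OF assms(1), of UNIV "\<lambda>v. {x \<in> topspace X. f x = v}"])
    show "openin X {x \<in> topspace X. f x = v}" for v by (rule lconstD[OF assms(2)])
  qed auto
  then have "f ` topspace X \<subseteq> V" by auto
  then show ?thesis using V finite_subset by blast
qed

text \<open>Zero-dimensional compact metrizable spaces, by way of a refining sequence of finite clopen
  partitions that separates points.\<close>

definition sepseq :: "'a topology \<Rightarrow> (nat \<Rightarrow> 'a \<Rightarrow> nat) \<Rightarrow> bool" where
  "sepseq X e \<longleftrightarrow> (\<forall>n. lconst X (e n)) \<and>
     (\<forall>x\<in>topspace X. \<forall>y\<in>topspace X. x \<noteq> y \<longrightarrow> (\<exists>n. e n x \<noteq> e n y)) \<and>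
     (\<forall>n. \<forall>x\<in>topspace X. \<forall>y\<in>topspace X. e (Suc n) x = e (Suc n) y \<longrightarrow> e n x = e n y)"

definition zdc :: "'a topology \<Rightarrow> bool" where
  "zdc X \<longleftrightarrow> compact_space X \<and> (\<exists>e. sepseq X e)"

lemma sepseqD:
  assumes "sepseq X e"
  shows "lconst X (e n)"
    and "x \<in> topspace X \<Longrightarrow> y \<in> topspace X \<Longrightarrow> (\<And>n. e n x = e n y) \<Longrightarrow> x = y"
  using assms unfolding sepseq_def by blast+

lemma sepseq_mono:
  assumes "sepseq X e" "x \<in> topspace X" "y \<in> topspace X" "e n x = e n y" "m \<le> n"
  shows "e m x = e m y"
  using assms(5,4)
proof (induction rule: dec_induct)
  case (step n)
  have "e (Suc n) x = e (Suc n) y \<longrightarrow> e n x = e n y"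
    using assms(1-3) unfolding sepseq_def by blast
  with step show ?case by blast
qed

text \<open>Recording all of the first \<open>n\<close> coordinates, not just the last one, makes
  the sequence refining.\<close>

definition sep_code :: "('i::countable \<Rightarrow> 'a \<Rightarrow> 'b::countable) \<Rightarrow> nat \<Rightarrow> 'a \<Rightarrow> nat" where
  "sep_code s n x = to_nat (map (\<lambda>k. s (from_nat k) x) [0..<n])"

lemma lconst_sep_code:
  assumes "\<And>i. lconst X (\<lambda>x. s i (f x))"
  shows "lconst X (\<lambda>x. sep_code s n (f x))"
proof -
  have "lconst X (\<lambda>x. map (\<lambda>k. s (from_nat k) (f x)) [0..<n])"
  proof (induction n)
    case (Suc n)
    have "lconst X (\<lambda>x. (\<lambda>(u, v). u @ [v]) (map (\<lambda>k. s (from_nat k) (f x)) [0..<n], s (from_nat n) (f x)))"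
      by (intro lconst_comp[where h="\<lambda>(u, v). u @ [v]"] lconst_Pair Suc assms)
    then show ?case by simp
  qed (simp add: lconst_const)
  then show ?thesis unfolding sep_code_def by (rule lconst_comp[where h=to_nat])
qed

lemma sepseq_sep_code:
  assumes lc: "\<And>i. lconst X (s i)"
    and sep: "\<And>x y. x \<in> topspace X \<Longrightarrow> y \<in> topspace X \<Longrightarrow> x \<noteq> y \<Longrightarrow> \<exists>i. s i x \<noteq> s i y"
  shows "sepseq X (sep_code s)"
proof -
  have e_eq: "sep_code s n x = sep_code s n y \<longleftrightarrow> (\<forall>k<n. s (from_nat k) x = s (from_nat k) y)" for n x y
    by (auto simp: sep_code_def list_eq_iff_nth_eq)
  have "lconst X (sep_code s n)" for n using lconst_sep_code[of X s "\<lambda>x. x"] lc by simp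
  moreover have "\<exists>n. sep_code s n x \<noteq> sep_code s n y" if "x \<in> topspace X" "y \<in> topspace X" "x \<noteq> y" for x y
  proof -
    from sep[OF that] obtain i where "s i x \<noteq> s i y" by blast
    then have "sep_code s (Suc (to_nat i)) x \<noteq> sep_code s (Suc (to_nat i)) y"
      unfolding e_eq by (intro notI) (drule spec[of _ "to_nat i"], simp)
    then show ?thesis by blast
  qed
  moreover have "sep_code s n x = sep_code s n y" if "sep_code s (Suc n) x = sep_code s (Suc n) y" for n x y
    using that by (simp add: e_eq)
  ultimately show ?thesis unfolding sepseq_def by blast
qed

lemma zdcI:
  fixes s :: "'i::countable \<Rightarrow> 'a \<Rightarrow> 'b::countable"
  assumes "compact_space X" "\<And>i. lconst X (s i)"
    and "\<And>x y. x \<in> topspace X \<Longrightarrow> y \<in> topspace X \<Longrightarrow> x \<noteq> y \<Longrightarrow> \<exists>i. s i x \<noteq> s i y"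
  shows "zdc X"
  using assms(1) sepseq_sep_code[OF assms(2,3)] unfolding zdc_def by blast

text \<open>The cells around \<open>x\<close> decrease. If each of them left \<open>V\<close>,
  compactness would give a point outside \<open>V\<close> lying in all of them, and the sequence
  would fail to separate it from \<open>x\<close>.\<close>

lemma sepseq_base:
  assumes "compact_space X" "sepseq X e" "openin X V" "x \<in> V"
  shows "\<exists>n. {y \<in> topspace X. e n y = e n x} \<subseteq> V"
proof (rule ccontr)
  assume neg: "\<nexists>n. {y \<in> topspace X. e n y = e n x} \<subseteq> V"
  have x: "x \<in> topspace X" using assms(3,4) openin_subset by blast
  define C where "C n = {y \<in> topspace X. e n y = e n x} \<inter> (topspace X - V)" for n
  have "(\<Inter>n. C n) \<noteq> {}"
  proof (rule compact_space_imp_nest[OF assms(1)])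
    show "closedin X (C n)" for n
      unfolding C_def
      by (intro closedin_Int lconst_closed_vimage[OF sepseqD(1)[OF assms(2)], where P="\<lambda>v. v = e n x"])
        (use assms(3) in auto)
    show "C n \<noteq> {}" for n using neg unfolding C_def by blast
    show "decseq C"
    proof (rule decseq_SucI)
      show "C (Suc n) \<subseteq> C n" for n
        unfolding C_def
        by (auto intro: sepseq_mono[OF assms(2) _ x _ le_SucI[OF order_refl]])
    qed
  qed
  then obtain y where y: "\<And>n. y \<in> C n" by blast
  have yX: "y \<in> topspace X" and yV: "y \<notin> V" using y[of 0] by (simp_all add: C_def)
  have "e n y = e n x" for n using y[of n] by (simp add: C_def)
  then have "y = x" by (rule sepseqD(2)[OF assms(2) yX x])
  then show False using assms(4) yV by simp
qed

lemma sepseq_Hausdorff: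
  assumes "sepseq X e"
  shows "Hausdorff_space X"
  unfolding Hausdorff_space_def
proof (intro allI impI)
  fix x y assume xy: "x \<in> topspace X \<and> y \<in> topspace X \<and> x \<noteq> y"
  then obtain n where n: "e n x \<noteq> e n y" using sepseqD(2)[OF assms] by blast
  have "openin X {z \<in> topspace X. e n z = v}" for v using sepseqD(1)[OF assms] by (rule lconstD)
  then show "\<exists>U V. openin X U \<and> openin X V \<and> x \<in> U \<and> y \<in> V \<and> disjnt U V"
    using xy n by (intro exI[of _ "{z \<in> topspace X. e n z = e n x}"] exI[of _ "{z \<in> topspace X. e n z = e n y}"])
      (auto simp: disjnt_iff)
qed

lemma zdc_Hausdorff: "zdc X \<Longrightarrow> Hausdorff_space X"
  by (auto simp: zdc_def intro: sepseq_Hausdorff)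

text \<open>Each point has some index whose cell lies in one cell of \<open>h\<close>; a finite
  subcover and monotonicity make the index uniform.\<close>

lemma sepseq_factor:
  assumes "compact_space X" "sepseq X e" "lconst X h"
  shows "\<exists>n. \<forall>x\<in>topspace X. \<forall>y\<in>topspace X. e n x = e n y \<longrightarrow> h x = h y"
proof -
  have "\<exists>n. {y \<in> topspace X. e n y = e n x} \<subseteq> {y \<in> topspace X. h y = h x}" if "x \<in> topspace X" for x
    using that assms by (intro sepseq_base) (auto simp: lconst_def)
  then obtain N where N: "\<And>x. x \<in> topspace X \<Longrightarrow> {y \<in> topspace X. e (N x) y = e (N x) x} \<subseteq> {y \<in> topspace X. h y = h x}"
    by metis
  obtain V where V: "finite V" "V \<subseteq> topspace X"
      "topspace X \<subseteq> (\<Union>x\<in>V. {y \<in> topspace X. e (N x) y = e (N x) x})"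
  proof (rule compact_space_cover[OF assms(1), of "topspace X" "\<lambda>x. {y \<in> topspace X. e (N x) y = e (N x) x}"])
    show "openin X {y \<in> topspace X. e (N x) y = e (N x) x}" for x
      by (rule lconstD[OF sepseqD(1)[OF assms(2)]])
  qed auto
  define n where "n = Max (N ` V)"
  have "h x = h y" if x: "x \<in> topspace X" and y: "y \<in> topspace X" and eq: "e n x = e n y" for x y
  proof -
    obtain z where z: "z \<in> V" "e (N z) x = e (N z) z" using V(3) x by blast
    have "N z \<le> n" using z V(1) by (auto simp: n_def)
    then have "e (N z) y = e (N z) z" using sepseq_mono[OF assms(2) x y eq] z by metis
    moreover have "{w \<in> topspace X. e (N z) w = e (N z) z} \<subseteq> {w \<in> topspace X. h w = h z}"
      using N z(1) V(2) by blast
    ultimately have "h y = h z" "h x = h z" using z(2) x y by blast+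
    then show ?thesis by simp
  qed
  then show ?thesis by blast
qed

lemma factor_through:
  assumes "\<forall>x\<in>A. \<forall>y\<in>A. g x = g y \<longrightarrow> h x = h y"
  shows "\<exists>\<pi>. \<forall>x\<in>A. h x = \<pi> (g x)"
proof (intro exI ballI)
  fix x assume x: "x \<in> A"
  have "\<exists>y. y \<in> A \<and> g y = g x" using x by blast
  then have "(SOME y. y \<in> A \<and> g y = g x) \<in> A \<and> g (SOME y. y \<in> A \<and> g y = g x) = g x" by (rule someI_ex)
  then show "h x = (\<lambda>v. h (SOME y. y \<in> A \<and> g y = v)) (g x)" using assms x by metis
qed

text \<open>Up to coarsening there are thus only countably many clopen partitions. Universality
  becomes a countable intersection for this reason.\<close>

lemma lconst_countable_code:
  assumes "compact_space X" "sepseq X e" "lconst X h"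
  shows "\<exists>n \<pi>. \<forall>x\<in>topspace X. h x = \<pi> (e n x)"
  using sepseq_factor[OF assms] factor_through[where h=h] by metis

lemma continuous_map_lconst:
  assumes Y: "compact_space Y" "sepseq Y e" and "f ` topspace X \<subseteq> topspace Y"
    and "\<And>n. lconst X (\<lambda>x. e n (f x))"
  shows "continuous_map X Y f"
  unfolding continuous_map_def
proof (intro conjI allI impI)
  fix V assume V: "openin Y V"
  show "openin X {x \<in> topspace X. f x \<in> V}"
  proof (subst openin_subopen, intro ballI)
    fix x assume x: "x \<in> {x \<in> topspace X. f x \<in> V}"
    then obtain n where n: "{y \<in> topspace Y. e n y = e n (f x)} \<subseteq> V"
      using sepseq_base[OF Y V] by blast
    show "\<exists>T. openin X T \<and> x \<in> T \<and> T \<subseteq> {x \<in> topspace X. f x \<in> V}"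
      using x n assms(3,4) by (intro exI[of _ "{z \<in> topspace X. e n (f z) = e n (f x)}"])
        (auto simp: lconst_def)
  qed
qed (use assms(3) in auto)

lemma continuous_map_separating:
  fixes s :: "'i::countable \<Rightarrow> 'a \<Rightarrow> 'b::countable"
  assumes "compact_space Y" "\<And>i. lconst Y (s i)"
    and "\<And>x y. x \<in> topspace Y \<Longrightarrow> y \<in> topspace Y \<Longrightarrow> x \<noteq> y \<Longrightarrow> \<exists>i. s i x \<noteq> s i y"
    and "f ` topspace X \<subseteq> topspace Y" "\<And>i. lconst X (\<lambda>x. s i (f x))"
  shows "continuous_map X Y f"
  by (rule continuous_map_lconst[OF assms(1) sepseq_sep_code[OF assms(2,3)] assms(4) lconst_sep_code[where s=s and f=f, OF assms(5)]])

lemma zdc_homeomorphic: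
  assumes "homeomorphic_map X Y f" "zdc Y"
  shows "zdc X"
proof -
  obtain e where e: "sepseq Y e" and c: "compact_space Y" using assms(2) by (auto simp: zdc_def)
  have f: "continuous_map X Y f" "f ` topspace X = topspace Y" "inj_on f (topspace X)"
    using assms(1) by (auto simp: homeomorphic_eq_everything_map)
  have "compact_space X" using c assms(1) homeomorphic_compact_space homeomorphic_space by blast
  then show ?thesis
  proof (rule zdcI)
    show "lconst X (\<lambda>x. e n (f x))" for n
      using f(1) sepseqD(1)[OF e] by (rule lconst_continuous)
    show "\<exists>n. e n (f x) \<noteq> e n (f y)" if "x \<in> topspace X" "y \<in> topspace X" "x \<noteq> y" for x y
      using that sepseqD(2)[OF e, of "f x" "f y"] f by (auto simp: inj_on_def)
  qed
qed

lemma zdc_prod: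
  assumes "zdc X" "zdc Y"
  shows "zdc (prod_topology X Y)"
proof -
  obtain e e' where e: "sepseq X e" "sepseq Y e'" and c: "compact_space X" "compact_space Y"
    using assms by (auto simp: zdc_def)
  show ?thesis
  proof (rule zdcI)
    show "compact_space (prod_topology X Y)" using c by (simp add: compact_space_prod_topology)
    show "lconst (prod_topology X Y) (\<lambda>z. (e n (fst z), e' n (snd z)))" for n
      using e by (intro lconst_Pair lconst_continuous[OF continuous_map_fst] lconst_continuous[OF continuous_map_snd])
        (auto intro: sepseqD(1))
    show "\<exists>n. (e n (fst x), e' n (snd x)) \<noteq> (e n (fst y), e' n (snd y))"
      if "x \<in> topspace (prod_topology X Y)" "y \<in> topspace (prod_topology X Y)" "x \<noteq> y" for x y
    proof (rule ccontr)
      assume "\<nexists>n. (e n (fst x), e' n (snd x)) \<noteq> (e n (fst y), e' n (snd y))"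
      then have eq: "e n (fst x) = e n (fst y)" "e' n (snd x) = e' n (snd y)" for n by simp_all
      have "fst x = fst y" using that(1,2) by (intro sepseqD(2)[OF e(1) _ _ eq(1)]) auto
      moreover have "snd x = snd y" using that(1,2) by (intro sepseqD(2)[OF e(2) _ _ eq(2)]) auto
      ultimately show False using that(3) by (simp add: prod_eq_iff)
    qed
  qed
qed

text \<open>\<open>S\<close> is the relation between a partition of \<open>X\<close> and one of
  \<open>Y\<close> that is to be preserved. Absorbing separating partitions of both sides in turn
  gives matched sequences, and their inverse limit is \<open>F\<close>. The last clause of the
  conclusion says that the matched pairs are cofinal, so that further properties of \<open>F\<close>
  can be read off from \<open>S\<close>.\<close>

lemma back_and_forth:
  fixes X :: "'a topology" and Y :: "'b topology" and S :: "('a \<Rightarrow> nat) \<Rightarrow> ('b \<Rightarrow> nat) \<Rightarrow> bool"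
  assumes X: "zdc X" and Y: "zdc Y"
    and lc: "\<And>f g. S f g \<Longrightarrow> lconst X f \<and> lconst Y g \<and> f ` topspace X = g ` topspace Y"
    and forward: "\<And>f g h. S f g \<Longrightarrow> lconst X h \<Longrightarrow> \<exists>f' g' \<pi> \<rho>. S f' g' \<and> (\<forall>x\<in>topspace X. f x = \<pi> (f' x)) \<and>
        (\<forall>y\<in>topspace Y. g y = \<pi> (g' y)) \<and> (\<forall>x\<in>topspace X. (h x :: nat) = \<rho> (f' x))"
    and backward: "\<And>f g h. S f g \<Longrightarrow> lconst Y h \<Longrightarrow> \<exists>f' g' \<pi> \<rho>. S f' g' \<and> (\<forall>x\<in>topspace X. f x = \<pi> (f' x)) \<and>
        (\<forall>y\<in>topspace Y. g y = \<pi> (g' y)) \<and> (\<forall>y\<in>topspace Y. (h y :: nat) = \<rho> (g' y))"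
    and S0: "S f0 g0"
  shows "\<exists>F. homeomorphic_map X Y F \<and> (\<forall>x\<in>topspace X. f0 x = g0 (F x)) \<and>
      (\<forall>h::'b \<Rightarrow> nat. lconst Y h \<longrightarrow> (\<exists>f g \<pi>. S f g \<and> (\<forall>x\<in>topspace X. f x = g (F x)) \<and>
         (\<forall>y\<in>topspace Y. h y = \<pi> (g y))))"
proof -
  obtain e where cX: "compact_space X" and e: "sepseq X e" using X by (auto simp: zdc_def)
  obtain e' where cY: "compact_space Y" and e': "sepseq Y e'" using Y by (auto simp: zdc_def)
  define R :: "nat \<Rightarrow> ('a \<Rightarrow> nat) \<times> ('b \<Rightarrow> nat) \<Rightarrow> ('a \<Rightarrow> nat) \<times> ('b \<Rightarrow> nat) \<Rightarrow> bool"
    where "R n = (\<lambda>(f, g) (f', g'). (\<exists>\<pi>. (\<forall>x\<in>topspace X. f x = \<pi> (f' x)) \<and> (\<forall>y\<in>topspace Y. g y = \<pi> (g' y))) \<and>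
      (\<exists>\<rho>. \<forall>x\<in>topspace X. e n x = \<rho> (f' x)) \<and> (\<exists>\<sigma>. \<forall>y\<in>topspace Y. e' n y = \<sigma> (g' y)))" for n :: nat
  have step: "\<exists>f' g'. S f' g' \<and> R n (f, g) (f', g')" if "S f g" for n f g
  proof -
    have "lconst X (e n)" "lconst Y (e' n)" using sepseqD(1)[OF e] sepseqD(1)[OF e'] by auto
    from forward[OF \<open>S f g\<close> this(1)] obtain f1 g1 \<pi>1 \<rho> where 1: "S f1 g1"
        "\<forall>x\<in>topspace X. f x = \<pi>1 (f1 x)" "\<forall>y\<in>topspace Y. g y = \<pi>1 (g1 y)" "\<forall>x\<in>topspace X. e n x = \<rho> (f1 x)"
      by blast
    from backward[OF 1(1) \<open>lconst Y (e' n)\<close>] obtain f2 g2 \<pi>2 \<sigma> where 2: "S f2 g2"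
        "\<forall>x\<in>topspace X. f1 x = \<pi>2 (f2 x)" "\<forall>y\<in>topspace Y. g1 y = \<pi>2 (g2 y)" "\<forall>y\<in>topspace Y. e' n y = \<sigma> (g2 y)"
      by blast
    have "R n (f, g) (f2, g2)"
      unfolding R_def case_prod_conv
    proof (intro conjI)
      show "\<exists>\<pi>. (\<forall>x\<in>topspace X. f x = \<pi> (f2 x)) \<and> (\<forall>y\<in>topspace Y. g y = \<pi> (g2 y))"
        by (rule exI[of _ "\<lambda>v. \<pi>1 (\<pi>2 v)"]) (use 1 2 in simp)
      show "\<exists>\<rho>. \<forall>x\<in>topspace X. e n x = \<rho> (f2 x)"
        by (rule exI[of _ "\<lambda>v. \<rho> (\<pi>2 v)"]) (use 1 2 in simp)
    qed (use 2 in blast)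
    then show ?thesis using 2(1) by blast
  qed
  \<comment> \<open>The condition at \<open>n = 0\<close> pins the start of the sequence to the
    given pair, so that \<open>F\<close> also matches \<open>f0\<close> with
    \<open>g0\<close>.\<close>
  have "\<exists>st. \<forall>n. (S (fst (st n)) (snd (st n)) \<and> (n = 0 \<longrightarrow> st n = (f0, g0))) \<and> R n (st n) (st (Suc n))"
  proof (rule dependent_nat_choice)
    show "\<exists>z. S (fst z) (snd z) \<and> ((0::nat) = 0 \<longrightarrow> z = (f0, g0))"
      by (rule exI[of _ "(f0, g0)"]) (use S0 in simp)
  next
    fix z and n :: nat
    assume "S (fst z) (snd z) \<and> (n = 0 \<longrightarrow> z = (f0, g0))"
    then obtain f' g' where "S f' g'" "R n (fst z, snd z) (f', g')" using step by blast
    then show "\<exists>w. (S (fst w) (snd w) \<and> (Suc n = 0 \<longrightarrow> w = (f0, g0))) \<and> R n z w"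
      by (intro exI[of _ "(f', g')"]) simp
  qed
  then obtain st where st: "\<And>n. S (fst (st n)) (snd (st n))" "st 0 = (f0, g0)"
      "\<And>n. R n (st n) (st (Suc n))"
    by blast
  define f where "f n = fst (st n)" for n
  define g where "g n = snd (st n)" for n
  have S: "S (f n) (g n)" for n using st(1) by (simp add: f_def g_def)
  have f0: "f 0 = f0" "g 0 = g0" using st(2) by (auto simp: f_def g_def)
  have R: "R n (f n, g n) (f (Suc n), g (Suc n))" for n using st(3)[of n] by (simp add: f_def g_def)
  have img: "f n ` topspace X = g n ` topspace Y" for n using lc[OF S] by blast
  have lcf: "lconst X (f n)" "lconst Y (g n)" for n using lc[OF S] by auto
  have "\<forall>n. \<exists>\<pi>. (\<forall>x\<in>topspace X. f n x = \<pi> (f (Suc n) x)) \<and> (\<forall>y\<in>topspace Y. g n y = \<pi> (g (Suc n) y))"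
    using R unfolding R_def case_prod_conv by blast
  from choice[OF this] obtain \<pi> where \<pi>: "\<And>n x. x \<in> topspace X \<Longrightarrow> f n x = \<pi> n (f (Suc n) x)"
      "\<And>n y. y \<in> topspace Y \<Longrightarrow> g n y = \<pi> n (g (Suc n) y)"
    by blast
  have "\<forall>n. \<exists>\<rho>. \<forall>x\<in>topspace X. e n x = \<rho> (f (Suc n) x)"
    using R unfolding R_def case_prod_conv by blast
  from choice[OF this] obtain \<rho> where \<rho>: "\<And>n x. x \<in> topspace X \<Longrightarrow> e n x = \<rho> n (f (Suc n) x)"
    by blast
  have "\<forall>n. \<exists>\<sigma>. \<forall>y\<in>topspace Y. e' n y = \<sigma> (g (Suc n) y)"
    using R unfolding R_def case_prod_conv by blast
  from choice[OF this] obtain \<sigma> where \<sigma>: "\<And>n y. y \<in> topspace Y \<Longrightarrow> e' n y = \<sigma> n (g (Suc n) y)"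
    by blast
  \<comment> \<open>The cells of \<open>Y\<close> with the labels of \<open>x\<close> are nonempty
    because the images agree at each stage, and they decrease; compactness yields the partner of
    \<open>x\<close>.\<close>
  have ex1: "\<exists>y\<in>topspace Y. \<forall>n. g n y = f n x" if x: "x \<in> topspace X" for x
  proof -
    have "(\<Inter>n. {y \<in> topspace Y. g n y = f n x}) \<noteq> {}"
    proof (rule compact_space_imp_nest[OF cY])
      show "closedin Y {y \<in> topspace Y. g n y = f n x}" for n
        by (rule lconst_closed_vimage[OF lcf(2), where P="\<lambda>v. v = f n x"])
      show "{y \<in> topspace Y. g n y = f n x} \<noteq> {}" for n
      proof -
        have "f n x \<in> g n ` topspace Y" using img[of n] x by blast
        then obtain y where "y \<in> topspace Y" "g n y = f n x" by (metis imageE)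
        then show ?thesis by blast
      qed
      show "decseq (\<lambda>n. {y \<in> topspace Y. g n y = f n x})"
      proof (intro decseq_SucI subsetI)
        fix n y assume "y \<in> {y \<in> topspace Y. g (Suc n) y = f (Suc n) x}"
        then show "y \<in> {y \<in> topspace Y. g n y = f n x}"
          using \<pi>(1)[OF x, of n] \<pi>(2)[of y n] by simp
      qed
    qed
    then show ?thesis by blast
  qed
  have ex2: "\<exists>x\<in>topspace X. \<forall>n. f n x = g n y" if y: "y \<in> topspace Y" for y
  proof -
    have "(\<Inter>n. {x \<in> topspace X. f n x = g n y}) \<noteq> {}"
    proof (rule compact_space_imp_nest[OF cX])
      show "closedin X {x \<in> topspace X. f n x = g n y}" for n
        by (rule lconst_closed_vimage[OF lcf(1), where P="\<lambda>v. v = g n y"])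
      show "{x \<in> topspace X. f n x = g n y} \<noteq> {}" for n
      proof -
        have "g n y \<in> f n ` topspace X" using img[of n] y by blast
        then obtain x where "x \<in> topspace X" "f n x = g n y" by (metis imageE)
        then show ?thesis by blast
      qed
      show "decseq (\<lambda>n. {x \<in> topspace X. f n x = g n y})"
      proof (intro decseq_SucI subsetI)
        fix n x assume "x \<in> {x \<in> topspace X. f (Suc n) x = g (Suc n) y}"
        then show "x \<in> {x \<in> topspace X. f n x = g n y}"
          using \<pi>(2)[OF y, of n] \<pi>(1)[of x n] by simp
      qed
    qed
    then show ?thesis by blast
  qed
  obtain F where F: "\<And>x. x \<in> topspace X \<Longrightarrow> F x \<in> topspace Y" "\<And>x n. x \<in> topspace X \<Longrightarrow> g n (F x) = f n x"
    using bchoice[of "topspace X" "\<lambda>x y. y \<in> topspace Y \<and> (\<forall>n. g n y = f n x)"] ex1 by blast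
  have sepX: "x = x'" if x: "x \<in> topspace X" "x' \<in> topspace X" and eq: "\<And>n. f n x = f n x'" for x x'
  proof (rule sepseqD(2)[OF e x])
    show "e n x = e n x'" for n
      by (simp only: \<rho>[OF x(1)] \<rho>[OF x(2)] eq)
  qed
  have sepY: "y = y'" if y: "y \<in> topspace Y" "y' \<in> topspace Y" and eq: "\<And>n. g n y = g n y'" for y y'
  proof (rule sepseqD(2)[OF e' y])
    show "e' n y = e' n y'" for n
      by (simp only: \<sigma>[OF y(1)] \<sigma>[OF y(2)] eq)
  qed
  have inj: "inj_on F (topspace X)"
  proof (rule inj_onI)
    fix x x' assume x: "x \<in> topspace X" "x' \<in> topspace X" and eq: "F x = F x'"
    have "f n x = f n x'" for n using F(2)[OF x(1), of n] F(2)[OF x(2), of n] eq by simp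
    then show "x = x'" by (rule sepX[OF x])
  qed
  have surj: "F ` topspace X = topspace Y"
  proof (intro equalityI subsetI)
    fix y assume y: "y \<in> topspace Y"
    then obtain x where x: "x \<in> topspace X" "\<And>n. f n x = g n y" using ex2 by blast
    have "F x = y" by (rule sepY[OF F(1)[OF x(1)] y]) (simp only: F(2)[OF x(1)] x(2))
    then show "y \<in> F ` topspace X" using x(1) by blast
  qed (use F(1) in blast)
  have "continuous_map X Y F"
  proof (rule continuous_map_lconst[OF cY e'])
    show "F ` topspace X \<subseteq> topspace Y" using surj by simp
    fix n
    have "lconst X (\<lambda>x. e' n (F x)) \<longleftrightarrow> lconst X (\<lambda>x. \<sigma> n (f (Suc n) x))"
    proof (rule lconst_cong)
      fix x assume x: "x \<in> topspace X"
      show "e' n (F x) = \<sigma> n (f (Suc n) x)" by (simp only: \<sigma>[OF F(1)[OF x]] F(2)[OF x])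
    qed
    then show "lconst X (\<lambda>x. e' n (F x))" using lconst_comp[OF lcf(1)] by blast
  qed
  then have hom: "homeomorphic_map X Y F"
    by (rule continuous_imp_homeomorphic_map[OF _ cX zdc_Hausdorff[OF Y] surj inj])
  have "\<exists>f g \<pi>. S f g \<and> (\<forall>x\<in>topspace X. f x = g (F x)) \<and> (\<forall>y\<in>topspace Y. h y = \<pi> (g y))"
    if h: "lconst Y h" for h :: "'b \<Rightarrow> nat"
  proof -
    obtain n \<tau> where "\<forall>y\<in>topspace Y. h y = \<tau> (e' n y)"
      using lconst_countable_code[OF cY e' h] by blast
    then have "\<forall>y\<in>topspace Y. h y = \<tau> (\<sigma> n (g (Suc n) y))" by (simp add: \<sigma>[symmetric])
    then show ?thesis using S[of "Suc n"] F(2)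
      by (intro exI[of _ "f (Suc n)"] exI[of _ "g (Suc n)"] exI[of _ "\<lambda>v. \<tau> (\<sigma> n v)"]) simp
  qed
  moreover have "\<forall>x\<in>topspace X. f0 x = g0 (F x)" using F(2)[of _ 0] f0 by simp
  ultimately show ?thesis using hom by blast
qed


section \<open>Perfect spaces: splitting cells and Brouwer's theorem\<close>

definition perfect :: "'a topology \<Rightarrow> bool" where
  "perfect X \<longleftrightarrow> (\<forall>x\<in>topspace X. \<not> openin X {x})"

lemma lconst_separation:
  assumes "zdc X" "x \<in> topspace X" "y \<in> topspace X" "x \<noteq> y"
  obtains f :: "'a \<Rightarrow> nat" where "lconst X f" "f x \<noteq> f y"
proof -
  obtain e where e: "sepseq X e" using assms(1) by (auto simp: zdc_def)
  from sepseqD(2)[OF e assms(2,3)] assms(4) obtain n where "e n x \<noteq> e n y" by blast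
  then show ?thesis using that sepseqD(1)[OF e] by blast
qed

text \<open>A nonempty open set in a perfect space has two points, so a clopen part can be split off
  from any cell without emptying it. New labels are inserted one at a time.\<close>

lemma perfect_split:
  assumes X: "zdc X" "perfect X" and U: "openin X U" "U \<noteq> {}" and H: "finite H" "H \<noteq> {}"
  shows "\<exists>k. lconst X k \<and> k ` U = H"
  using H
proof (induction H rule: finite_ne_induct)
  case (singleton a)
  then show ?case using U(2) by (intro exI[of _ "\<lambda>_. a"]) (auto simp: lconst_const)
next
  case (insert a H)
  then obtain k b where k: "lconst X k" "k ` U = H" and b: "b \<in> H" by blast
  \<comment> \<open>The cell with the old label \<open>b\<close> is split: the points that
    \<open>e\<close> cannot tell from \<open>y\<close> get the new label \<open>a\<close>, and
    \<open>z\<close> keeps \<open>b\<close> in use.\<close>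
  define V where "V = U \<inter> {x \<in> topspace X. k x = b}"
  have V: "openin X V" unfolding V_def using U(1) lconstD[OF k(1)] by (rule openin_Int)
  have "V \<subseteq> topspace X" by (auto simp: V_def)
  obtain y where y: "y \<in> V" using k(2) b openin_subset[OF U(1)] by (auto simp: V_def)
  then have "\<not> V \<subseteq> {y}" using V X(2) \<open>V \<subseteq> topspace X\<close> unfolding perfect_def
    by (metis empty_iff insert_absorb subset_singletonD subsetD)
  then obtain z where z: "z \<in> V" "z \<noteq> y" by blast
  obtain e :: "_ \<Rightarrow> nat" where e: "lconst X e" "e z \<noteq> e y"
    using lconst_separation[OF X(1)] y z \<open>V \<subseteq> topspace X\<close> by (metis subsetD)
  define k' where "k' x = (if k x = b \<and> e x = e y then a else k x)" for x
  have "lconst X (\<lambda>x. (\<lambda>(u, v). if u = b \<and> v = e y then a else u) (k x, e x))"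
    by (intro lconst_comp[where h="\<lambda>(u, v). if u = b \<and> v = e y then a else u"] lconst_Pair k e)
  then have "lconst X k'" by (simp add: k'_def[abs_def])
  moreover have "k' ` U = insert a H"
  proof (intro equalityI subsetI)
    fix w assume "w \<in> k' ` U" then show "w \<in> insert a H" using k(2) by (auto simp: k'_def)
  next
    fix w assume w: "w \<in> insert a H"
    show "w \<in> k' ` U"
    proof (cases "w = a")
      case True
      then have "w = k' y" "y \<in> U" using y by (auto simp: k'_def V_def)
      then show ?thesis by blast
    next
      case False
      show ?thesis
      proof (cases "w = b")
        case True
        then have "w = k' z" "z \<in> U" using z e by (auto simp: k'_def V_def)
        then show ?thesis by blast
      next
        case nb: False
        obtain x where "x \<in> U" "k x = w" using w False k(2) by blast
        then have "w = k' x" "x \<in> U" using nb by (auto simp: k'_def)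
        then show ?thesis by blast
      qed
    qed
  qed
  ultimately show ?case by blast
qed

text \<open>The partition \<open>h\<close> is imitated cell by cell: over each value
  \<open>v\<close>, the matching cell of \<open>g\<close> is split into exactly the labels that
  \<open>h\<close> takes on the cell of \<open>f\<close>.\<close>

lemma perfect_image_extension:
  fixes f :: "'a \<Rightarrow> nat" and g :: "'b \<Rightarrow> nat" and h :: "'a \<Rightarrow> nat"
  assumes X: "zdc X" and Y: "zdc Y" "perfect Y"
    and f: "lconst X f" and g: "lconst Y g" and h: "lconst X h" and img: "f ` topspace X = g ` topspace Y"
  shows "\<exists>(f' :: 'a \<Rightarrow> nat) (g' :: 'b \<Rightarrow> nat) \<pi> \<rho>. lconst X f' \<and> lconst Y g' \<and> f' ` topspace X = g' ` topspace Y \<and>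
      (\<forall>x\<in>topspace X. f x = \<pi> (f' x)) \<and> (\<forall>y\<in>topspace Y. g y = \<pi> (g' y)) \<and>
      (\<forall>x\<in>topspace X. (h x :: nat) = \<rho> (f' x))"
proof -
  have "\<exists>k. lconst Y k \<and> (v \<in> g ` topspace Y \<longrightarrow>
      k ` {y \<in> topspace Y. g y = v} = h ` {x \<in> topspace X. f x = v})" for v
  proof (cases "v \<in> g ` topspace Y")
    case True
    have "finite (h ` topspace X)" using X h lconst_finite_image by (auto simp: zdc_def)
    then have fin: "finite (h ` {x \<in> topspace X. f x = v})" by (rule finite_subset[rotated]) blast
    have ne: "h ` {x \<in> topspace X. f x = v} \<noteq> {}" using True img by force
    have "{y \<in> topspace Y. g y = v} \<noteq> {}" using True by force
    from perfect_split[OF Y lconstD[OF g] this fin ne] show ?thesis by blast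
  next
    case False
    then show ?thesis by (intro exI[of _ "\<lambda>_. 0"]) (simp add: lconst_const)
  qed
  then have "\<exists>k. \<forall>v. lconst Y (k v) \<and> (v \<in> g ` topspace Y \<longrightarrow>
      k v ` {y \<in> topspace Y. g y = v} = h ` {x \<in> topspace X. f x = v})"
    by (intro choice allI)
  then obtain k where k0: "\<forall>v. lconst Y (k v) \<and> (v \<in> g ` topspace Y \<longrightarrow>
      k v ` {y \<in> topspace Y. g y = v} = h ` {x \<in> topspace X. f x = v})"
    by (rule exE)
  have k: "lconst Y (k v)" "v \<in> g ` topspace Y \<Longrightarrow>
      k v ` {y \<in> topspace Y. g y = v} = h ` {x \<in> topspace X. f x = v}" for v
    using k0[THEN spec, of v] by simp_all
  define f' where "f' x = to_nat (f x, h x)" for x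
  define g' where "g' y = to_nat (g y, k (g y) y)" for y
  have "f' ` topspace X = g' ` topspace Y"
  proof (intro equalityI subsetI)
    fix w assume "w \<in> f' ` topspace X"
    then obtain x where x: "x \<in> topspace X" "w = f' x" by blast
    then have "f x \<in> g ` topspace Y" using img by blast
    from k(2)[OF this] x(1) obtain y where "y \<in> topspace Y" "g y = f x" "k (f x) y = h x" by force
    then show "w \<in> g' ` topspace Y" using x(2) by (intro image_eqI[of _ _ y]) (auto simp: f'_def g'_def)
  next
    fix w assume "w \<in> g' ` topspace Y"
    then obtain y where y: "y \<in> topspace Y" "w = g' y" by blast
    then have "g y \<in> g ` topspace Y" by blast
    from k(2)[OF this] y(1) obtain x where "x \<in> topspace X" "f x = g y" "h x = k (g y) y" by force
    then show "w \<in> f' ` topspace X" using y(2) by (intro image_eqI[of _ _ x]) (auto simp: f'_def g'_def)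
  qed
  note img' = this
  have lf: "lconst X f'" unfolding f'_def by (rule lconst_comp[OF lconst_Pair[OF f h], where h=to_nat])
  have lg: "lconst Y g'" unfolding g'_def
    by (rule lconst_comp[OF lconst_Pair[OF g lconst_dep[where h=k, OF g k(1)]], where h=to_nat])
  show ?thesis
  proof (rule exI[of _ f'], rule exI[of _ g'], rule exI[of _ "\<lambda>v. fst (from_nat v :: nat \<times> nat)"],
      rule exI[of _ "\<lambda>v. snd (from_nat v :: nat \<times> nat)"], intro conjI ballI)
    show "f x = fst (from_nat (f' x) :: nat \<times> nat)" "h x = snd (from_nat (f' x) :: nat \<times> nat)" for x
      by (simp_all add: f'_def)
    show "g y = fst (from_nat (g' y) :: nat \<times> nat)" for y by (simp add: g'_def)
  qed fact+
qed

text \<open>This is Brouwer's characterization of the Cantor space with a prescribed matching of two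
  partitions; equality of images is the preserved relation.\<close>

lemma perfect_zdc_homeomorphism:
  fixes f :: "'a \<Rightarrow> nat" and g :: "'b \<Rightarrow> nat"
  assumes X: "zdc X" "perfect X" and Y: "zdc Y" "perfect Y"
    and fg: "lconst X f" "lconst Y g" "f ` topspace X = g ` topspace Y"
  shows "\<exists>F. homeomorphic_map X Y F \<and> (\<forall>x\<in>topspace X. f x = g (F x))"
proof -
  define S :: "('a \<Rightarrow> nat) \<Rightarrow> ('b \<Rightarrow> nat) \<Rightarrow> bool"
    where "S f g \<longleftrightarrow> lconst X f \<and> lconst Y g \<and> f ` topspace X = g ` topspace Y" for f g
  have "\<exists>F. homeomorphic_map X Y F \<and> (\<forall>x\<in>topspace X. f x = g (F x)) \<and>
      (\<forall>h::'b \<Rightarrow> nat. lconst Y h \<longrightarrow> (\<exists>f g \<pi>. S f g \<and> (\<forall>x\<in>topspace X. f x = g (F x)) \<and>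
         (\<forall>y\<in>topspace Y. h y = \<pi> (g y))))"
  proof (rule back_and_forth[OF X(1) Y(1)])
    show "S f g" using fg by (simp add: S_def)
    show "lconst X f \<and> lconst Y g \<and> f ` topspace X = g ` topspace Y" if "S f g" for f g
      using that by (simp add: S_def)
    fix f :: "'a \<Rightarrow> nat" and g :: "'b \<Rightarrow> nat"
    assume S: "S f g"
    show "\<exists>f' g' \<pi> \<rho>. S f' g' \<and> (\<forall>x\<in>topspace X. f x = \<pi> (f' x)) \<and>
        (\<forall>y\<in>topspace Y. g y = \<pi> (g' y)) \<and> (\<forall>x\<in>topspace X. h x = \<rho> (f' x))"
      if h: "lconst X h" for h :: "'a \<Rightarrow> nat"
    proof -
      from S have "lconst X f" "lconst Y g" "f ` topspace X = g ` topspace Y" unfolding S_def by blast+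
      from perfect_image_extension[OF X(1) Y this(1,2) h this(3)] show ?thesis
        unfolding S_def conj_assoc .
    qed
    show "\<exists>f' g' \<pi> \<rho>. S f' g' \<and> (\<forall>x\<in>topspace X. f x = \<pi> (f' x)) \<and>
        (\<forall>y\<in>topspace Y. g y = \<pi> (g' y)) \<and> (\<forall>y\<in>topspace Y. h y = \<rho> (g' y))"
      if h: "lconst Y h" for h :: "'b \<Rightarrow> nat"
    proof -
      from S have "g ` topspace Y = f ` topspace X" "lconst X f" "lconst Y g" unfolding S_def by blast+
      from perfect_image_extension[OF Y(1) X this(3,2) h this(1)]
      show ?thesis
      proof (elim exE conjE)
        fix g' :: "'b \<Rightarrow> nat" and f' :: "'a \<Rightarrow> nat" and \<pi> \<rho> :: "nat \<Rightarrow> nat"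
        assume "lconst Y g'" "lconst X f'" "g' ` topspace Y = f' ` topspace X"
          and *: "\<forall>y\<in>topspace Y. g y = \<pi> (g' y)" "\<forall>x\<in>topspace X. f x = \<pi> (f' x)"
            "\<forall>y\<in>topspace Y. h y = \<rho> (g' y)"
        then have "S f' g'" by (simp add: S_def)
        then show "\<exists>f' g' \<pi> \<rho>. S f' g' \<and> (\<forall>x\<in>topspace X. f x = \<pi> (f' x)) \<and>
            (\<forall>y\<in>topspace Y. g y = \<pi> (g' y)) \<and> (\<forall>y\<in>topspace Y. h y = \<rho> (g' y))"
          using * by (intro exI conjI)
      qed
    qed
  qed
  then show ?thesis by blast
qed

section \<open>Walks in dumbbells\<close>

text \<open>The vertices of the dumbbell are the integers \<open>x\<close> with \<open>-2L \<le> x < 2L\<close>: the left loop is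
  \<open>x < -L\<close>, the right loop is \<open>L \<le> x\<close>, and the bar lies between. \<open>cw L\<close> is the walk that
  traverses the bar, with position \<open>0\<close> at time \<open>0\<close>.\<close>

definition cw :: "int \<Rightarrow> int \<Rightarrow> int" where
  "cw L x = (if x < - L then x mod L - 2 * L else if x < L then x else x mod L + L)"

text \<open>Steps by one enter the bar from the left loop at \<open>- L\<close> and the right loop
  from the bar at \<open>L\<close>; the two exceptional edges close the loops. No edge leads back to
  the bar or out of the right loop.\<close>

definition dedge :: "int \<Rightarrow> int \<Rightarrow> int \<Rightarrow> bool" where
  "dedge L p q \<longleftrightarrow> - 2 * L \<le> p \<and> p < 2 * L \<and> - 2 * L \<le> q \<and> q < 2 * L \<and>
     (q = p + 1 \<or> p = - L - 1 \<and> q = - 2 * L \<or> p = 2 * L - 1 \<and> q = L)"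

lemma mod_obtain:
  fixes x L :: int
  assumes "L > 0"
  obtains r where "x mod L = r" "0 \<le> r" "r < L"
  using assms by simp

lemma cw_range:
  assumes "L > 0" shows "- 2 * L \<le> cw L x" "cw L x < 2 * L"
proof -
  obtain r where "x mod L = r" "0 \<le> r" "r < L" using mod_obtain[OF assms] .
  then show "- 2 * L \<le> cw L x" "cw L x < 2 * L" using assms by (auto simp: cw_def)
qed

lemma cw_mod: "cw L x mod L = x mod L"
  by (simp add: cw_def mod_diff_eq[symmetric, of "x mod L"])

lemma mod_eqI_shift:
  fixes x L :: int
  assumes "0 \<le> x + k * L" "x + k * L < L"
  shows "x mod L = x + k * L"
proof -
  have "x mod L = (x + k * L) mod L" by simp
  also have "\<dots> = x + k * L" using assms by (rule mod_pos_pos_trivial)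
  finally show ?thesis .
qed

lemma cw_id:
  assumes "- 2 * L \<le> x" "x < 2 * L" shows "cw L x = x"
  using assms mod_eqI_shift[of x 2 L] mod_eqI_shift[of x "-1" L] by (auto simp: cw_def)

lemma mod_add_one:
  fixes x L :: int
  assumes "L > 0"
  shows "(x + 1) mod L = (if x mod L = L - 1 then 0 else x mod L + 1)"
proof -
  have "(x + 1) mod L = (x mod L + 1) mod L" by (simp add: mod_add_left_eq)
  then show ?thesis
    using pos_mod_bound[OF assms, of x] pos_mod_sign[OF assms, of x] by auto
qed

lemma cw_edge:
  assumes "L > 0" shows "dedge L (cw L x) (cw L (x + 1))"
proof -
  have m: "(- L - 1) mod L = L - 1" "(L - 1) mod L = L - 1"
    using mod_eqI_shift[of "- L - 1" 2 L] mod_eqI_shift[of "L - 1" 0 L] assms by simp_all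
  obtain r where r: "x mod L = r" "0 \<le> r" "r < L" using mod_obtain[OF assms] .
  consider "x + 1 < - L" | "x + 1 = - L" | "- L < x + 1" "x + 1 < L" | "x + 1 = L" | "L < x + 1" by linarith
  then show ?thesis
  proof cases
    case 2
    then have "x = - L - 1" by simp
    then show ?thesis using assms m by (simp add: cw_def dedge_def)
  next
    case 4
    then have "x = L - 1" by simp
    then show ?thesis using assms m by (simp add: cw_def dedge_def)
  qed (use mod_add_one[OF assms, of x] r assms in \<open>auto simp: cw_def dedge_def\<close>)
qed

text \<open>Positions are kept modulo \<open>L\<close>, and since \<open>L \<le> L'\<close> each
  loop of the long dumbbell lies over the loop of the short one on the same side. The bar of the
  long one wraps around both short loops.\<close>

lemma cw_cw:
  assumes "L > 0" "L' > 0" "L dvd L'"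
  shows "cw L (cw L' x) = cw L x"
proof -
  have le: "L \<le> L'" using assms by (simp add: zdvd_imp_le)
  have m: "cw L' x mod L = x mod L"
    using assms(3) by (metis cw_mod mod_mod_cancel)
  obtain r where r: "x mod L' = r" "0 \<le> r" "r < L'" using mod_obtain[OF assms(2)] .
  consider "x < - L'" | "- L' \<le> x" "x < L'" | "L' \<le> x" by linarith
  then show ?thesis
  proof cases
    case 1
    then have "cw L' x < - L" using r le by (simp add: cw_def)
    then show ?thesis using m 1 le by (simp add: cw_def[of L])
  next
    case 2
    then show ?thesis by (simp add: cw_def[of L'])
  next
    case 3
    then have "cw L' x \<ge> L" using r le assms by (simp add: cw_def)
    then show ?thesis using m 3 le assms by (simp add: cw_def[of L])
  qed
qed

lemma dedge_pred:
  assumes "L > 0" "dedge L p q" "dedge L p' q" "q \<noteq> L"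
  shows "p = p'"
  using assms by (auto simp: dedge_def)

text \<open>Walks are extended backwards: in the graph of a dumbbell only the vertex \<open>L\<close>, where the bar
  enters the right loop, has two predecessors, and from \<open>L\<close> on a walk is deterministic.\<close>

lemma dedge_walk_segment:
  assumes "L > 0" "\<And>n. n < k \<Longrightarrow> dedge L (w n) (w (Suc n))" "- 2 * L \<le> w 0" "w 0 < 2 * L"
  shows "\<exists>t. \<forall>n\<le>k. w n = cw L (t + int n)"
  using assms(2-)
proof (induction k arbitrary: w)
  case 0
  then show ?case using cw_id[of L "w 0"] by (intro exI[of _ "w 0"]) simp
next
  case (Suc k)
  have e0: "dedge L (w 0) (w (Suc 0))" using Suc.prems(1)[of 0] by simp
  have "\<exists>t. \<forall>n\<le>k. w (Suc n) = cw L (t + int n)"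
    using Suc.prems(1) e0 by (intro Suc.IH) (auto simp: dedge_def)
  then obtain t where t: "\<And>n. n \<le> k \<Longrightarrow> w (Suc n) = cw L (t + int n)" by blast
  have w1: "w (Suc 0) = cw L t" using t[of 0] by simp
  show ?case
  proof (cases "cw L t = L")
    case False
    have "dedge L (cw L (t - 1)) (cw L t)" using cw_edge[OF assms(1), of "t - 1"] by simp
    then have w0: "w 0 = cw L (t - 1)" using dedge_pred[OF assms(1)] e0 w1 False by metis
    have "w n = cw L (t - 1 + int n)" if "n \<le> Suc k" for n
    proof (cases n)
      case (Suc i) then show ?thesis using t[of i] that by (simp add: algebra_simps)
    qed (use w0 in simp)
    then show ?thesis by blast
  next
    \<comment> \<open>A walk arrives at \<open>L\<close> either from the bar or after a full turn of
      the right loop. The future of \<open>L\<close> is forced, so time may be restarted at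
      \<open>s = L\<close> or \<open>s = 2 * L\<close> to fit the predecessor.\<close>
    case True
    obtain r where "t mod L = r" "0 \<le> r" "r < L" using mod_obtain[OF assms(1)] .
    then have tL: "L \<le> t" "t mod L = 0"
      using True assms(1) by (auto simp: cw_def split: if_splits)
    have right: "cw L (t + int i) = int i mod L + L" for i
    proof -
      have "(t + int i) mod L = int i mod L" using tL(2) by (metis add_0 mod_add_left_eq)
      then show ?thesis using tL(1) assms(1) by (simp add: cw_def)
    qed
    have "w 0 = L - 1 \<or> w 0 = 2 * L - 1" using e0 w1 True assms(1) by (auto simp: dedge_def)
    then obtain s where s: "L \<le> s" "s mod L = 0" "w 0 = cw L (s - 1)"
    proof
      assume "w 0 = L - 1"
      then show ?thesis using assms(1) by (intro that[of L]) (auto simp: cw_def)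
    next
      assume "w 0 = 2 * L - 1"
      then show ?thesis using assms(1) cw_id[of L "2 * L - 1"] by (intro that[of "2 * L"]) auto
    qed
    have "w n = cw L (s - 1 + int n)" if "n \<le> Suc k" for n
    proof (cases n)
      case (Suc i)
      have "(s + int i) mod L = int i mod L" using s(2) by (metis add_0 mod_add_left_eq)
      then have "cw L (s + int i) = int i mod L + L" using s(1) assms(1) by (simp add: cw_def)
      then show ?thesis using t[of i] right[of i] that Suc by (simp add: algebra_simps)
    qed (use s in simp)
    then show ?thesis by blast
  qed
qed

text \<open>An edge is a walk of length one, hence part of the traversal \<open>cw L'\<close>, which
  \<open>cw L\<close> folds to a traversal.\<close>

lemma cw_dedge:
  assumes "L > 0" "L' > 0" "L dvd L'" "dedge L' p q"
  shows "dedge L (cw L p) (cw L q)"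
proof -
  have "\<exists>t. \<forall>n\<le>1. (if n = 0 then p else q) = cw L' (t + int n)"
    by (rule dedge_walk_segment) (use assms in \<open>auto simp: dedge_def\<close>)
  then obtain t where t: "\<forall>n\<le>1. (if n = 0 then p else q) = cw L' (t + int n)" by blast
  have "p = cw L' t" "q = cw L' (t + 1)" using t[rule_format, of 0] t[rule_format, of 1] by simp_all
  then show ?thesis using cw_cw[OF assms(1-3)] cw_edge[OF assms(1)] by metis
qed


section \<open>Integer powers of a homeomorphism\<close>

definition ipow :: "'a topology \<Rightarrow> ('a \<Rightarrow> 'a) \<Rightarrow> int \<Rightarrow> 'a \<Rightarrow> 'a" where
  "ipow X T n = (if n \<ge> 0 then T ^^ nat n else inv_into (topspace X) T ^^ nat (- n))"

lemma homeomorphic_map_inj_surj: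
  assumes "homeomorphic_map X X T"
  shows "inj_on T (topspace X)" "T ` topspace X = topspace X" "x \<in> topspace X \<Longrightarrow> T x \<in> topspace X"
  using assms by (auto simp: homeomorphic_eq_everything_map)

lemma homeomorphic_map_inv_into:
  assumes "homeomorphic_map X Y T"
  shows "homeomorphic_map Y X (inv_into (topspace X) T)"
proof -
  obtain g where g: "homeomorphic_maps X Y T g" using assms homeomorphic_map_maps by blast
  then have "homeomorphic_map Y X g" using homeomorphic_maps_map by blast
  moreover have "g y = inv_into (topspace X) T y" if "y \<in> topspace Y" for y
  proof -
    have "g y \<in> topspace X" "T (g y) = y"
      using g that by (auto simp: homeomorphic_maps_def continuous_map_def)
    then show ?thesis
      using assms by (metis homeomorphic_eq_everything_map inv_into_f_f)
  qed
  ultimately show ?thesis using homeomorphic_map_eq by blast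
qed

lemma ipow_in:
  assumes "homeomorphic_map X X T" "x \<in> topspace X"
  shows "ipow X T n x \<in> topspace X"
proof -
  have f: "(h ^^ k) x \<in> topspace X" if "\<And>y. y \<in> topspace X \<Longrightarrow> h y \<in> topspace X" for h :: "'a \<Rightarrow> 'a" and k
    using assms(2) that by (induction k) auto
  show ?thesis
    using f[of T "nat n"] f[of "inv_into (topspace X) T" "nat (- n)"]
      homeomorphic_map_inj_surj(3)[OF assms(1)]
      homeomorphic_map_inj_surj(3)[OF homeomorphic_map_inv_into[OF assms(1)]]
    by (simp add: ipow_def)
qed

lemma ipow_0: "ipow X T 0 x = x"
  by (simp add: ipow_def)

lemma ipow_Suc:
  assumes "homeomorphic_map X X T" "x \<in> topspace X"
  shows "ipow X T (n + 1) x = T (ipow X T n x)"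
proof (cases "n \<ge> 0")
  case True
  then have "nat (n + 1) = Suc (nat n)" by simp
  then show ?thesis using True by (simp add: ipow_def)
next
  case False
  define k where "k = nat (- n) - 1"
  have k: "nat (- n) = Suc k" "nat (- (n + 1)) = k" using False by (simp_all add: k_def)
  have "(inv_into (topspace X) T ^^ k) x = ipow X T (- int k) x"
    by (cases "k = 0") (simp_all add: ipow_def)
  then have "(inv_into (topspace X) T ^^ k) x \<in> T ` topspace X"
    using ipow_in[OF assms] homeomorphic_map_inj_surj(2)[OF assms(1)] by simp
  then have "T (inv_into (topspace X) T ((inv_into (topspace X) T ^^ k) x)) = (inv_into (topspace X) T ^^ k) x"
    by (rule f_inv_into_f)
  moreover have "ipow X T (n + 1) x = (inv_into (topspace X) T ^^ k) x"
    using False k by (cases "n = -1") (simp_all add: ipow_def)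
  ultimately show ?thesis using False k by (simp add: ipow_def)
qed

lemma ipow_add:
  assumes T: "homeomorphic_map X X T" and x: "x \<in> topspace X"
  shows "ipow X T (m + n) x = ipow X T m (ipow X T n x)"
proof (induction m rule: int_induct[where k=0])
  case base
  then show ?case by (simp add: ipow_0)
next
  case (step1 i)
  have "ipow X T (i + 1 + n) x = T (ipow X T (i + n) x)"
    using ipow_Suc[OF assms, of "i + n"] by (simp add: algebra_simps)
  then show ?case using step1 ipow_Suc[OF T ipow_in[OF T x]] by simp
next
  case (step2 i)
  have "T (ipow X T (i - 1 + n) x) = ipow X T (i + n) x"
    using ipow_Suc[OF assms, of "i - 1 + n"] by (simp add: algebra_simps)
  also have "\<dots> = T (ipow X T (i - 1) (ipow X T n x))"
    using step2 ipow_Suc[OF T ipow_in[OF T x], of "i - 1"] by simp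
  finally show ?case
    using homeomorphic_map_inj_surj(1)[OF T] ipow_in[OF T] x by (simp add: inj_on_eq_iff)
qed

lemma ipow_shift:
  assumes T: "homeomorphic_map X X T" and x: "x \<in> topspace X"
  shows "ipow X T n (T x) = T (ipow X T n x)"
proof -
  have "T x = ipow X T 1 x" using ipow_Suc[OF assms, of 0] by (simp add: ipow_0)
  then have "ipow X T n (T x) = ipow X T (n + 1) x" using ipow_add[OF assms, of n 1] by simp
  then show ?thesis using ipow_Suc[OF assms] by simp
qed

lemma ipow_continuous:
  assumes "homeomorphic_map X X T"
  shows "continuous_map X X (ipow X T n)"
proof -
  have f: "continuous_map X X (h ^^ k)" if "continuous_map X X h" for h :: "'a \<Rightarrow> 'a" and k
  proof (induction k)
    case (Suc k)
    then show ?case using continuous_map_compose[OF Suc that] by (simp add: comp_def)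
  qed (simp add: id_def)
  show ?thesis
    unfolding ipow_def
    using f[of T "nat n"] f[of "inv_into (topspace X) T" "nat (- n)"]
      homeomorphic_imp_continuous_map[OF assms]
      homeomorphic_imp_continuous_map[OF homeomorphic_map_inv_into[OF assms]]
    by simp
qed

text \<open>This is the subshift obtained by coding full orbits through the partition
  \<open>f\<close>.\<close>

definition walks :: "'a topology \<Rightarrow> ('a \<Rightarrow> 'a) \<Rightarrow> ('a \<Rightarrow> 'b) \<Rightarrow> (int \<Rightarrow> 'b) set" where
  "walks X T f = {\<lambda>n. f (ipow X T n x) | x. x \<in> topspace X}"

text \<open>By compactness a word is realized as soon as all its central windows are, possibly by
  different points.\<close>

lemma walks_closed:
  assumes X: "compact_space X" and T: "homeomorphic_map X X T" and f: "lconst X f"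
    and ex: "\<And>N::nat. \<exists>x\<in>topspace X. \<forall>n. \<bar>n\<bar> \<le> int N \<longrightarrow> f (ipow X T n x) = w n"
  shows "w \<in> walks X T f"
proof -
  define C where "C N = {x \<in> topspace X. \<forall>n. \<bar>n\<bar> \<le> int N \<longrightarrow> f (ipow X T n x) = w n}" for N :: nat
  have "(\<Inter>N. C N) \<noteq> {}"
  proof (rule compact_space_imp_nest[OF X])
    fix N :: nat
    have "closedin X {x \<in> topspace X. f (ipow X T n x) = w n}" for n
      by (rule lconst_closed_vimage[OF lconst_continuous[OF ipow_continuous[OF T] f], where P="\<lambda>v. v = w n"])
    then have "closedin X (\<Inter>n\<in>{- int N..int N}. {x \<in> topspace X. f (ipow X T n x) = w n})"
      by (intro closedin_Inter) auto
    moreover have "C N = (\<Inter>n\<in>{- int N..int N}. {x \<in> topspace X. f (ipow X T n x) = w n})"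
      by (auto simp: C_def abs_le_iff)
    ultimately show "closedin X (C N)" by simp
    show "C N \<noteq> {}" using ex[of N] unfolding C_def by blast
  next
    show "decseq C"
    proof (intro decseq_SucI subsetI)
      fix N x assume "x \<in> C (Suc N)"
      then show "x \<in> C N" by (simp add: C_def)
    qed
  qed
  then obtain x where x: "\<And>N. x \<in> C N" by blast
  have "x \<in> topspace X" using x[of 0] by (simp add: C_def)
  moreover have "f (ipow X T n x) = w n" for n
    using x[of "nat \<bar>n\<bar>"] by (simp add: C_def)
  ultimately show ?thesis unfolding walks_def by (intro CollectI exI[of _ x]) (simp add: fun_eq_iff)
qed

lemma walks_subset_image:
  assumes "walks X T f \<subseteq> walks Y S g"
  shows "f ` topspace X \<subseteq> g ` topspace Y"
proof
  fix v assume "v \<in> f ` topspace X"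
  then obtain x where x: "x \<in> topspace X" "v = f x" by blast
  then have "(\<lambda>n. f (ipow X T n x)) \<in> walks Y S g" using assms by (auto simp: walks_def)
  then obtain y where "y \<in> topspace Y" "(\<lambda>n. f (ipow X T n x)) = (\<lambda>n. g (ipow Y S n y))"
    by (auto simp: walks_def)
  then have "f x = g y" by (metis ipow_0)
  then show "v \<in> g ` topspace Y" using x(2) \<open>y \<in> topspace Y\<close> by blast
qed

lemma walks_eq_image:
  assumes "walks X T f = walks Y S g"
  shows "f ` topspace X = g ` topspace Y"
  using walks_subset_image[of X T f Y S g] walks_subset_image[of Y S g X T f] assms by auto

text \<open>The pair labels the points by vertices of a disjoint union of dumbbells,
  \<open>\<iota>\<close> naming the dumbbell and \<open>p\<close> the vertex; orbits follow
  edges.\<close>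

definition dmap :: "'a topology \<Rightarrow> ('a \<Rightarrow> 'a) \<Rightarrow> int \<Rightarrow> ('a \<Rightarrow> 'i) \<Rightarrow> ('a \<Rightarrow> int) \<Rightarrow> bool" where
  "dmap X T L \<iota> p \<longleftrightarrow> L > 0 \<and> lconst X \<iota> \<and> lconst X p \<and>
     (\<forall>x\<in>topspace X. \<iota> (T x) = \<iota> x \<and> dedge L (p x) (p (T x)))"

lemma dmap_index:
  assumes "dmap X T L \<iota> p" and T: "homeomorphic_map X X T" and x: "x \<in> topspace X"
  shows "\<iota> (ipow X T n x) = \<iota> x"
proof -
  have inv: "\<iota> (T y) = \<iota> y" if "y \<in> topspace X" for y using assms(1) that by (auto simp: dmap_def)
  show ?thesis
  proof (induction n rule: int_induct[where k=0])
    case base show ?case by (simp add: ipow_0)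
  next
    case (step1 i) then show ?case using ipow_Suc[OF T x, of i] inv[OF ipow_in[OF T x]] by simp
  next
    case (step2 i) then show ?case using ipow_Suc[OF T x, of "i - 1"] inv[OF ipow_in[OF T x], of "i - 1"] by simp
  qed
qed

text \<open>The time \<open>t\<close> has to depend on the window: an orbit that circles the left
  loop for ever agrees with a traversal on each finite window but not globally.\<close>

lemma dmap_window:
  assumes d: "dmap X T L \<iota> p" and T: "homeomorphic_map X X T" and x: "x \<in> topspace X"
  shows "\<exists>t. \<forall>n. \<bar>n\<bar> \<le> N \<longrightarrow> p (ipow X T n x) = cw L (t + n)"
proof (cases "N \<ge> 0")
  case True
  have e: "dedge L (p y) (p (T y))" if "y \<in> topspace X" for y using d that by (auto simp: dmap_def)
  define w where "w k = p (ipow X T (int k - N) x)" for k :: nat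
  have "\<exists>t. \<forall>n\<le>nat (2 * N). w n = cw L (t + int n)"
  proof (rule dedge_walk_segment)
    show "L > 0" using d by (simp add: dmap_def)
    show "dedge L (w n) (w (Suc n))" for n
      using e[OF ipow_in[OF T x]] ipow_Suc[OF T x, of "int n - N"] by (simp add: w_def algebra_simps)
    show "- 2 * L \<le> w 0" "w 0 < 2 * L"
      using e[OF ipow_in[OF T x], of "- N"] by (auto simp: w_def dedge_def)
  qed
  then obtain t where t: "\<And>n. n \<le> nat (2 * N) \<Longrightarrow> w n = cw L (t + int n)" by blast
  have "p (ipow X T n x) = cw L (t + N + n)" if "\<bar>n\<bar> \<le> N" for n
  proof -
    have "nat (n + N) \<le> nat (2 * N)" "int (nat (n + N)) = n + N" using that by auto
    then show ?thesis using t[of "nat (n + N)"] by (simp add: w_def algebra_simps)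
  qed
  then show ?thesis by blast
qed (auto simp: abs_if)

text \<open>On the bar the vertex is the time, so the offset of every window is forced to be
  \<open>p x\<close> and the windows fit together.\<close>

lemma dmap_traverse:
  assumes d: "dmap X T L \<iota> p" and T: "homeomorphic_map X X T" and x: "x \<in> topspace X"
    and mid: "- L \<le> p x" "p x < L"
  shows "p (ipow X T n x) = cw L (n + p x)"
proof -
  have L: "L > 0" using d by (simp add: dmap_def)
  obtain t where t: "\<And>k. \<bar>k\<bar> \<le> \<bar>n\<bar> \<Longrightarrow> p (ipow X T k x) = cw L (t + k)"
    using dmap_window[OF d T x, of "\<bar>n\<bar>"] by blast
  have "p x = cw L t" using t[of 0] by (simp add: ipow_0)
  moreover obtain r where "t mod L = r" "0 \<le> r" "r < L" using mod_obtain[OF L] .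
  ultimately have "t = p x" using mid by (auto simp: cw_def split: if_splits)
  then show ?thesis using t[of n] by (simp add: add.commute)
qed

text \<open>Changing loops would require passing through a time at which \<open>cw L\<close> is on
  the bar. An orbit that avoids the bar therefore stays in one loop and only rotates there.\<close>

lemma dmap_left:
  assumes d: "dmap X T L \<iota> p" and T: "homeomorphic_map X X T" and x: "x \<in> topspace X"
    and nomid: "\<And>n. p (ipow X T n x) < - L \<or> L \<le> p (ipow X T n x)"
  shows "p x < - L \<Longrightarrow> p (ipow X T n x) = (p x + n) mod L - 2 * L"
    and "L \<le> p x \<Longrightarrow> p (ipow X T n x) = (p x + n) mod L + L"
proof -
  have L: "L > 0" using d by (simp add: dmap_def)
  obtain t where t: "\<And>k. \<bar>k\<bar> \<le> \<bar>n\<bar> \<Longrightarrow> p (ipow X T k x) = cw L (t + k)"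
    using dmap_window[OF d T x, of "\<bar>n\<bar>"] by blast
  have px: "p x = cw L t" using t[of 0] by (simp add: ipow_0)
  have pn: "p (ipow X T n x) = cw L (t + n)" using t[of n] by simp
  have no: "cw L (t + k) < - L \<or> L \<le> cw L (t + k)" if "\<bar>k\<bar> \<le> \<bar>n\<bar>" for k
    using nomid[of k] t[OF that] by simp
  have mid: "\<not> (- L \<le> t + k \<and> t + k < L)" if "\<bar>k\<bar> \<le> \<bar>n\<bar>" for k
    using no[OF that] by (auto simp: cw_def)
  obtain r where r: "t mod L = r" "0 \<le> r" "r < L" using mod_obtain[OF L] .
  have m: "(p x + n) mod L = (t + n) mod L" unfolding px by (metis cw_mod mod_add_left_eq)
  {
    assume "p x < - L"
    then have t0: "t < - L" using px r L by (auto simp: cw_def split: if_splits)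
    have "t + n < - L"
    proof (rule ccontr)
      assume "\<not> t + n < - L"
      then have "\<bar>- t - L\<bar> \<le> \<bar>n\<bar>" using t0 by auto
      from mid[OF this] show False using L by simp
    qed
    then show "p (ipow X T n x) = (p x + n) mod L - 2 * L" using pn m by (simp add: cw_def)
  next
    assume "L \<le> p x"
    then have t0: "L \<le> t" using px r L by (auto simp: cw_def split: if_splits)
    have "L \<le> t + n"
    proof (rule ccontr)
      assume "\<not> L \<le> t + n"
      then have "\<bar>L - 1 - t\<bar> \<le> \<bar>n\<bar>" using t0 by auto
      from mid[OF this] show False using L by simp
    qed
    then show "p (ipow X T n x) = (p x + n) mod L + L" using pn m L by (simp add: cw_def)
  }
qed

text \<open>A point at vertex \<open>0\<close> traverses its whole dumbbell, so a suitable shift of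
  its orbit reproduces any finite window of an orbit with the same index.
  \<open>walks_closed\<close> passes to whole words.\<close>

lemma dmap_walks_subset:
  assumes X: "homeomorphic_map X X T" "dmap X T L \<iota> p"
    and Y: "compact_space Y" "homeomorphic_map Y Y S" "dmap Y S L \<kappa> q"
    and ex: "\<And>x. x \<in> topspace X \<Longrightarrow> \<exists>y\<in>topspace Y. \<kappa> y = \<iota> x \<and> q y = 0"
  shows "walks X T (\<lambda>x. (\<iota> x, p x)) \<subseteq> walks Y S (\<lambda>y. (\<kappa> y, q y))"
proof
  fix w assume "w \<in> walks X T (\<lambda>x. (\<iota> x, p x))"
  then obtain x where x: "x \<in> topspace X" and w: "w = (\<lambda>n. (\<iota> (ipow X T n x), p (ipow X T n x)))"
    by (auto simp: walks_def)
  have L: "L > 0" using X(2) by (simp add: dmap_def)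
  obtain y where y: "y \<in> topspace Y" "\<kappa> y = \<iota> x" "q y = 0" using ex[OF x] by blast
  have qy: "q (ipow Y S n y) = cw L n" for n
    using dmap_traverse[OF Y(3,2) y(1)] y(3) L by simp
  show "w \<in> walks Y S (\<lambda>y. (\<kappa> y, q y))"
  proof (rule walks_closed[OF Y(1,2)])
    show "lconst Y (\<lambda>y. (\<kappa> y, q y))" using Y(3) by (simp add: dmap_def lconst_Pair)
    fix N :: nat
    obtain t where t: "\<And>n. \<bar>n\<bar> \<le> int N \<Longrightarrow> p (ipow X T n x) = cw L (t + n)"
      using dmap_window[OF X(2,1) x] by blast
    have z: "ipow Y S t y \<in> topspace Y" by (rule ipow_in[OF Y(2) y(1)])
    have "(\<kappa> (ipow Y S n (ipow Y S t y)), q (ipow Y S n (ipow Y S t y))) = w n" if "\<bar>n\<bar> \<le> int N" for n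
    proof -
      have "ipow Y S n (ipow Y S t y) = ipow Y S (n + t) y" using ipow_add[OF Y(2) y(1)] by simp
      then have "q (ipow Y S n (ipow Y S t y)) = cw L (t + n)" using qy by (simp add: add.commute)
      moreover have "\<kappa> (ipow Y S n (ipow Y S t y)) = \<iota> x"
        using dmap_index[OF Y(3,2) z, of n] dmap_index[OF Y(3,2) y(1), of t] y(2) by simp
      ultimately show ?thesis using w t[OF that] dmap_index[OF X(2,1) x, of n] by simp
    qed
    then show "\<exists>z\<in>topspace Y. \<forall>n. \<bar>n\<bar> \<le> int N \<longrightarrow> (\<kappa> (ipow Y S n z), q (ipow Y S n z)) = w n"
      using z by blast
  qed
qed

section \<open>Universal systems and their uniqueness\<close>


text \<open>The partition given by \<open>\<iota>\<close>, \<open>\<kappa>\<close> and \<open>p\<close> refines \<open>f\<close> by means of \<open>\<phi>\<close>. Its dumbbells are indexed by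
  the pairs \<open>(\<iota>, \<kappa>)\<close>; as \<open>\<phi>\<close> does not depend on \<open>\<kappa> < m\<close>, each of them occurs \<open>m\<close> times. The last two
  clauses say that the words read off the loops are also read off while traversing some dumbbell.\<close>

definition nice :: "'a topology \<Rightarrow> ('a \<Rightarrow> 'a) \<Rightarrow> ('a \<Rightarrow> 'v) \<Rightarrow> int \<Rightarrow> nat \<Rightarrow> int \<Rightarrow> ('a \<Rightarrow> nat) \<Rightarrow>
    ('a \<Rightarrow> nat) \<Rightarrow> ('a \<Rightarrow> int) \<Rightarrow> (nat \<Rightarrow> int \<Rightarrow> 'v) \<Rightarrow> bool" where
  "nice X T f n m L \<iota> \<kappa> p \<phi> \<longleftrightarrow>
     dmap X T L (\<lambda>x. (\<iota> x, \<kappa> x)) p \<and> n dvd L \<and>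
     (\<forall>x\<in>topspace X. \<kappa> x < m \<and> f x = \<phi> (\<iota> x) (p x)) \<and>
     (\<forall>i\<in>\<iota> ` topspace X. (\<forall>a<m. \<exists>x\<in>topspace X. \<iota> x = i \<and> \<kappa> x = a \<and> p x = 0) \<and>
        (\<exists>j\<in>\<iota> ` topspace X. \<forall>q. - 2 * L \<le> q \<and> q < 2 * L \<longrightarrow> \<phi> j q = \<phi> i (q mod L - 2 * L)) \<and>
        (\<exists>j\<in>\<iota> ` topspace X. \<forall>q. - 2 * L \<le> q \<and> q < 2 * L \<longrightarrow> \<phi> j q = \<phi> i (q mod L + L)))"

definition universal :: "'a topology \<Rightarrow> ('a \<Rightarrow> 'a) \<Rightarrow> bool" where
  "universal X T \<longleftrightarrow> (\<forall>f :: 'a \<Rightarrow> nat. lconst X f \<longrightarrow>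
     (\<forall>n>0. \<forall>m>0. \<exists>L \<iota> \<kappa> p \<phi>. nice X T f n m L \<iota> \<kappa> p \<phi>))"

lemma niceD:
  assumes "nice X T f n m L \<iota> \<kappa> p \<phi>"
  shows "dmap X T L (\<lambda>x. (\<iota> x, \<kappa> x)) p" "n dvd L" "L > 0"
    and "x \<in> topspace X \<Longrightarrow> \<kappa> x < m" "x \<in> topspace X \<Longrightarrow> f x = \<phi> (\<iota> x) (p x)"
    and "i \<in> \<iota> ` topspace X \<Longrightarrow> a < m \<Longrightarrow> \<exists>x\<in>topspace X. \<iota> x = i \<and> \<kappa> x = a \<and> p x = 0"
    and "i \<in> \<iota> ` topspace X \<Longrightarrow>
      \<exists>j\<in>\<iota> ` topspace X. \<forall>q. - 2 * L \<le> q \<and> q < 2 * L \<longrightarrow> \<phi> j q = \<phi> i (q mod L - 2 * L)"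
    and "i \<in> \<iota> ` topspace X \<Longrightarrow>
      \<exists>j\<in>\<iota> ` topspace X. \<forall>q. - 2 * L \<le> q \<and> q < 2 * L \<longrightarrow> \<phi> j q = \<phi> i (q mod L + L)"
proof -
  note u = assms[unfolded nice_def]
  show "dmap X T L (\<lambda>x. (\<iota> x, \<kappa> x)) p" "n dvd L" using u by blast+
  then show "L > 0" by (simp add: dmap_def)
  show "x \<in> topspace X \<Longrightarrow> \<kappa> x < m" "x \<in> topspace X \<Longrightarrow> f x = \<phi> (\<iota> x) (p x)" using u by blast+
  show "i \<in> \<iota> ` topspace X \<Longrightarrow> a < m \<Longrightarrow> \<exists>x\<in>topspace X. \<iota> x = i \<and> \<kappa> x = a \<and> p x = 0" using u by blast
  assume i: "i \<in> \<iota> ` topspace X"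
  from u[THEN conjunct2, THEN conjunct2, THEN conjunct2, rule_format, OF i]
  show "\<exists>j\<in>\<iota> ` topspace X. \<forall>q. - 2 * L \<le> q \<and> q < 2 * L \<longrightarrow> \<phi> j q = \<phi> i (q mod L - 2 * L)"
    and "\<exists>j\<in>\<iota> ` topspace X. \<forall>q. - 2 * L \<le> q \<and> q < 2 * L \<longrightarrow> \<phi> j q = \<phi> i (q mod L + L)"
    by (simp_all del: mult_minus_left)
qed

lemma nice_comp:
  assumes "nice X T F n m L \<iota> \<kappa> p \<phi>" "\<And>x. x \<in> topspace X \<Longrightarrow> f x = \<pi> (F x)"
  shows "nice X T f n m L \<iota> \<kappa> p (\<lambda>i q. \<pi> (\<phi> i q))"
  unfolding nice_def
proof (intro conjI ballI)
  note N = niceD[OF assms(1)]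
  show "dmap X T L (\<lambda>x. (\<iota> x, \<kappa> x)) p" "n dvd L" by (fact N)+
  show "\<kappa> x < m" if "x \<in> topspace X" for x using N(4)[OF that] .
  show "f x = \<pi> (\<phi> (\<iota> x) (p x))" if "x \<in> topspace X" for x
    using N(5)[OF that] assms(2)[OF that] by simp
  fix i assume i: "i \<in> \<iota> ` topspace X"
  show "\<forall>a<m. \<exists>x\<in>topspace X. \<iota> x = i \<and> \<kappa> x = a \<and> p x = 0" using N(6)[OF i] by blast
  show "\<exists>j\<in>\<iota> ` topspace X. \<forall>q. - 2 * L \<le> q \<and> q < 2 * L \<longrightarrow> \<pi> (\<phi> j q) = \<pi> (\<phi> i (q mod L - 2 * L))"
    using N(7)[OF i] by metis
  show "\<exists>j\<in>\<iota> ` topspace X. \<forall>q. - 2 * L \<le> q \<and> q < 2 * L \<longrightarrow> \<pi> (\<phi> j q) = \<pi> (\<phi> i (q mod L + L))"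
    using N(8)[OF i] by metis
qed

lemma nice_traverse:
  assumes N: "nice X T f n m L \<iota> \<kappa> p \<phi>" and T: "homeomorphic_map X X T" and x: "x \<in> topspace X"
    and mid: "- L \<le> p x" "p x < L"
  shows "f (ipow X T k x) = \<phi> (\<iota> x) (cw L (k + p x))"
proof -
  note D = niceD(1)[OF N]
  have "\<iota> (ipow X T k x) = \<iota> x" using dmap_index[OF D T x, of k] by simp
  moreover have "p (ipow X T k x) = cw L (k + p x)" by (rule dmap_traverse[OF D T x mid])
  ultimately show ?thesis using niceD(5)[OF N ipow_in[OF T x], of k] by simp
qed

text \<open>An orbit meeting the bar is a traversal. An orbit that never meets it rotates in one
  loop, and the last two clauses of \<open>nice\<close> supply a dumbbell whose traversal spells the
  same word.\<close>

lemma nice_walk: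
  assumes N: "nice X T f n m L \<iota> \<kappa> p \<phi>" and T: "homeomorphic_map X X T" and x: "x \<in> topspace X"
  shows "\<exists>i\<in>\<iota> ` topspace X. \<exists>s. \<forall>k. f (ipow X T k x) = \<phi> i (cw L (k + s))"
proof (cases "\<exists>k. - L \<le> p (ipow X T k x) \<and> p (ipow X T k x) < L")
  case True
  then obtain l where l: "- L \<le> p (ipow X T l x)" "p (ipow X T l x) < L" by blast
  define y where "y = ipow X T l x"
  have y: "y \<in> topspace X" unfolding y_def by (rule ipow_in[OF T x])
  have "f (ipow X T k x) = \<phi> (\<iota> y) (cw L (k + (p y - l)))" for k
  proof -
    have "ipow X T k x = ipow X T (k - l) y" unfolding y_def using ipow_add[OF T x, of "k - l" l] by simp
    moreover have "f (ipow X T (k - l) y) = \<phi> (\<iota> y) (cw L (k - l + p y))"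
      by (rule nice_traverse[OF N T y]) (use l in \<open>simp_all add: y_def\<close>)
    ultimately show ?thesis by (simp add: algebra_simps)
  qed
  then show ?thesis using y by blast
next
  case False
  note D = niceD(1)[OF N]
  have nomid: "p (ipow X T k x) < - L \<or> L \<le> p (ipow X T k x)" for k using False[simplified, THEN spec, of k] by linarith
  have L: "L > 0" by (rule niceD(3)[OF N])
  have f: "f (ipow X T k x) = \<phi> (\<iota> x) (p (ipow X T k x))" for k
    using niceD(5)[OF N ipow_in[OF T x], of k] dmap_index[OF D T x, of k] by simp
  have ix: "\<iota> x \<in> \<iota> ` topspace X" using x by blast
  have m: "cw L (k + p x) mod L = (p x + k) mod L" for k by (simp add: cw_mod add.commute)
  have r: "- 2 * L \<le> cw L (k + p x) \<and> cw L (k + p x) < 2 * L" for k using cw_range[OF L] by blast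
  have "p x < - L \<or> L \<le> p x" using nomid[of 0] by (simp add: ipow_0)
  then show ?thesis
  proof
    assume left: "p x < - L"
    obtain j where j: "j \<in> \<iota> ` topspace X"
        "\<And>q. - 2 * L \<le> q \<and> q < 2 * L \<Longrightarrow> \<phi> j q = \<phi> (\<iota> x) (q mod L - 2 * L)"
      using niceD(7)[OF N ix] by blast
    have "f (ipow X T k x) = \<phi> j (cw L (k + p x))" for k
      using f[of k] dmap_left(1)[OF D T x nomid left, of k] j(2)[OF r] m[of k] by simp
    then show ?thesis using j(1) by blast
  next
    assume right: "L \<le> p x"
    obtain j where j: "j \<in> \<iota> ` topspace X"
        "\<And>q. - 2 * L \<le> q \<and> q < 2 * L \<Longrightarrow> \<phi> j q = \<phi> (\<iota> x) (q mod L + L)"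
      using niceD(8)[OF N ix] by blast
    have "f (ipow X T k x) = \<phi> j (cw L (k + p x))" for k
      using f[of k] dmap_left(2)[OF D T x nomid right, of k] j(2)[OF r] m[of k] by simp
    then show ?thesis using j(1) by blast
  qed
qed

lemma nice_in_walks:
  assumes N: "nice X T f n m L \<iota> \<kappa> p \<phi>" and T: "homeomorphic_map X X T"
    and i: "i \<in> \<iota> ` topspace X" and m: "m > 0"
  shows "(\<lambda>k. \<phi> i (cw L k)) \<in> walks X T f"
proof -
  obtain x where x: "x \<in> topspace X" "\<iota> x = i" "p x = 0" using niceD(6)[OF N i m] by blast
  have "f (ipow X T k x) = \<phi> i (cw L k)" for k
    using nice_traverse[OF N T x(1), of k] x niceD(3)[OF N] by simp
  then have "(\<lambda>k. f (ipow X T k x)) = (\<lambda>k. \<phi> i (cw L k))" by (rule ext)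
  then show ?thesis unfolding walks_def using x(1) by (metis (mono_tags, lifting) mem_Collect_eq)
qed

lemma nice_transfer:
  assumes N: "nice X T f n m L \<iota> \<kappa> p \<phi>" and T: "homeomorphic_map X X T" and w: "w \<in> walks X T f"
  shows "\<exists>i\<in>\<iota> ` topspace X. \<exists>s. \<forall>k. w k = \<phi> i (cw L (k + s))"
proof -
  obtain x where x: "x \<in> topspace X" "w = (\<lambda>k. f (ipow X T k x))" using w unfolding walks_def by blast
  show ?thesis using nice_walk[OF N T x(1)] unfolding x(2) .
qed

text \<open>Over \<open>Y\<close>, take a refinement with as many copies of each dumbbell as there are dumbbells over \<open>X\<close>.
  Equality of the walks matches the dumbbells, up to a shift of time, which is undone by composing
  with a power of \<open>S\<close>; the copies make room to hit all dumbbells over \<open>X\<close>.\<close>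

lemma dumbbell_extension:
  fixes f :: "'a \<Rightarrow> nat" and g :: "'b \<Rightarrow> nat"
  assumes X: "compact_space X" "homeomorphic_map X X T"
    and N: "nice X T f n m L \<iota> \<kappa> p \<phi>" and m: "m > 0"
    and Y: "homeomorphic_map Y Y S" "universal Y S"
    and g: "lconst Y g" and W: "walks X T f = walks Y S g"
  shows "\<exists>\<tau> r. dmap Y S L \<tau> r \<and> (\<forall>y\<in>topspace Y. g y = \<phi> (fst (\<tau> y)) (r y)) \<and>
    \<tau> ` topspace Y \<subseteq> (\<lambda>x. (\<iota> x, \<kappa> x)) ` topspace X \<and>
    (\<forall>k\<in>(\<lambda>x. (\<iota> x, \<kappa> x)) ` topspace X. \<exists>y\<in>topspace Y. \<tau> y = k \<and> r y = 0)"
proof -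
  define K where "K = (\<lambda>x. (\<iota> x, \<kappa> x)) ` topspace X"
  have fin: "finite K"
    unfolding K_def using niceD(1)[OF N] by (intro lconst_finite_image X(1)) (simp add: dmap_def)
  \<comment> \<open>\<open>b\<close> numbers the dumbbells over \<open>X\<close>. The copy with
    number \<open>b k\<close> of a dumbbell over \<open>Y\<close> will be reserved for the target
    \<open>k\<close>.\<close>
  obtain b where b: "bij_betw b K {0..<card K}" using ex_bij_betw_finite_nat[OF fin] by blast
  define M where "M = Suc (card K)"
  have bM: "b k < M" if "k \<in> K" for k using b that by (auto simp: M_def bij_betw_def less_Suc_eq)
  have bi: "k = k'" if "b k = b k'" "k \<in> K" "k' \<in> K" for k k' using b that by (auto simp: bij_betw_def inj_on_def)
  have L: "L > 0" by (rule niceD(3)[OF N])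
  \<comment> \<open>The divisor \<open>L\<close> is requested so that \<open>cw L\<close> folds the
    new dumbbells to length \<open>L\<close>, and \<open>M\<close> copies so that every number
    \<open>b k\<close> occurs.\<close>
  obtain L' \<iota>' \<kappa>' p' \<phi>' where N': "nice Y S g L M L' \<iota>' \<kappa>' p' \<phi>'"
    using Y(2) g L unfolding universal_def M_def by blast
  have L': "L' > 0" by (rule niceD(3)[OF N'])
  have LL: "L dvd L'" by (rule niceD(2)[OF N'])
  note D' = niceD(1)[OF N']
  \<comment> \<open>\<open>s\<close> is the time shift at which dumbbell \<open>j\<close> over
    \<open>Y\<close> spells the word of dumbbell \<open>i\<close> over \<open>X\<close>.\<close>
  define R where "R i j s \<longleftrightarrow> (\<forall>k. \<phi>' j (cw L' (k + s)) = \<phi> i (cw L k))" for i j s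
  have R1: "\<exists>j\<in>\<iota>' ` topspace Y. \<exists>s. R i j s" if "i \<in> \<iota> ` topspace X" for i
  proof -
    have "(\<lambda>k. \<phi> i (cw L k)) \<in> walks Y S g" using nice_in_walks[OF N X(2) that m] W by simp
    from nice_transfer[OF N' Y(1) this] show ?thesis unfolding R_def by metis
  qed
  have R2: "\<exists>i\<in>\<iota> ` topspace X. \<exists>s. R i j s" if "j \<in> \<iota>' ` topspace Y" for j
  proof -
    have "(\<lambda>k. \<phi>' j (cw L' k)) \<in> walks X T f" using nice_in_walks[OF N' Y(1) that] W by (simp add: M_def)
    from nice_transfer[OF N X(2) this] obtain i s where i: "i \<in> \<iota> ` topspace X"
        "\<And>k. \<phi>' j (cw L' k) = \<phi> i (cw L (k + s))" by blast
    have "R i j (- s)" unfolding R_def using i(2) by simp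
    then show ?thesis using i(1) by blast
  qed
  \<comment> \<open>The target of copy \<open>a\<close> of \<open>j\<close> must be compatible with
    \<open>j\<close>; the last clause forces it to be the dumbbell numbered \<open>a\<close>
    whenever that one is compatible. Otherwise any compatible target given by \<open>R2\<close> will
    do.\<close>
  define Q where "Q j a z \<longleftrightarrow> fst z \<in> K \<and> R (fst (fst z)) j (snd z) \<and>
      (\<forall>k\<in>K. b k = a \<and> (\<exists>s. R (fst k) j s) \<longrightarrow> fst z = k)" for j and a :: nat and z :: "(nat \<times> nat) \<times> int"
  have "\<exists>z. Q j a z" if j: "j \<in> \<iota>' ` topspace Y" for j a
  proof (cases "\<exists>k\<in>K. b k = a \<and> (\<exists>s. R (fst k) j s)")
    case True
    then obtain k s where k: "k \<in> K" "b k = a" "R (fst k) j s" by blast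
    have "Q j a (k, s)" unfolding Q_def using k bi by auto
    then show ?thesis by blast
  next
    case False
    obtain i s where "i \<in> \<iota> ` topspace X" "R i j s" using R2[OF j] by blast
    then obtain x where x: "x \<in> topspace X" "R (\<iota> x) j s" by blast
    have "Q j a ((\<iota> x, \<kappa> x), s)" unfolding Q_def using x False by (auto simp: K_def)
    then show ?thesis by blast
  qed
  then obtain z where z: "\<And>j a. j \<in> \<iota>' ` topspace Y \<Longrightarrow> Q j a (z j a)" by metis
  define \<tau> where "\<tau> y = fst (z (\<iota>' y) (\<kappa>' y))" for y
  define \<sigma> where "\<sigma> y = snd (z (\<iota>' y) (\<kappa>' y))" for y
  \<comment> \<open>The power of \<open>S\<close> undoes the time shift between the two words, and
    \<open>cw L\<close> folds the vertex to the shorter dumbbell.\<close>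
  define r where "r y = cw L (p' (ipow Y S (- \<sigma> y) y))" for y
  have Qy: "Q (\<iota>' y) (\<kappa>' y) (\<tau> y, \<sigma> y)" if "y \<in> topspace Y" for y
    using z[of "\<iota>' y" "\<kappa>' y"] that by (simp add: \<tau>_def \<sigma>_def)
  have idx: "\<iota>' (ipow Y S k y) = \<iota>' y" "\<kappa>' (ipow Y S k y) = \<kappa>' y" if "y \<in> topspace Y" for k y
    using dmap_index[OF D' Y(1) that, of k] by simp_all
  have inv: "\<iota>' (S y) = \<iota>' y" "\<kappa>' (S y) = \<kappa>' y" "dedge L' (p' y) (p' (S y))" if "y \<in> topspace Y" for y
    using D' that by (auto simp: dmap_def)
  have lc: "lconst Y \<iota>'" "lconst Y \<kappa>'" "lconst Y p'"
    using D' lconst_comp[of Y "\<lambda>x. (\<iota>' x, \<kappa>' x)" fst] lconst_comp[of Y "\<lambda>x. (\<iota>' x, \<kappa>' x)" snd]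
    by (auto simp: dmap_def)
  have lci: "lconst Y (\<lambda>y. (\<iota>' y, \<kappa>' y))" by (rule lconst_Pair[OF lc(1,2)])
  have l\<tau>: "lconst Y \<tau>" using lconst_comp[OF lci, of "\<lambda>(j, a). fst (z j a)"] by (simp add: \<tau>_def[abs_def])
  have l\<sigma>: "lconst Y \<sigma>" using lconst_comp[OF lci, of "\<lambda>(j, a). snd (z j a)"] by (simp add: \<sigma>_def[abs_def])
  have lr: "lconst Y r"
  proof -
    have "lconst Y (\<lambda>y. cw L (p' (ipow Y S (- v) y)))" for v
      by (rule lconst_comp[OF lconst_continuous[OF ipow_continuous[OF Y(1)] lc(3)]])
    from lconst_dep[OF l\<sigma>, of "\<lambda>v y. cw L (p' (ipow Y S (- v) y))", OF this]
    show ?thesis by (simp add: r_def[abs_def])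
  qed
  have "dmap Y S L \<tau> r"
    unfolding dmap_def
  proof (intro conjI ballI L l\<tau> lr)
    fix y assume y: "y \<in> topspace Y"
    show "\<tau> (S y) = \<tau> y" using inv[OF y] by (simp add: \<tau>_def)
    have "\<sigma> (S y) = \<sigma> y" using inv[OF y] by (simp add: \<sigma>_def)
    then have "r (S y) = cw L (p' (S (ipow Y S (- \<sigma> y) y)))" using ipow_shift[OF Y(1) y] by (simp add: r_def)
    then show "dedge L (r y) (r (S y))"
      using cw_dedge[OF L L' LL inv(3)[OF ipow_in[OF Y(1) y]]] by (simp add: r_def)
  qed
  moreover have "g y = \<phi> (fst (\<tau> y)) (r y)" if y: "y \<in> topspace Y" for y
  proof -
    obtain t where t: "\<And>k. \<bar>k\<bar> \<le> \<bar>\<sigma> y\<bar> \<Longrightarrow> p' (ipow Y S k y) = cw L' (t + k)"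
      using dmap_window[OF D' Y(1) y, of "\<bar>\<sigma> y\<bar>"] by blast
    have "p' y = cw L' t" using t[of 0] by (simp add: ipow_0)
    then have "g y = \<phi>' (\<iota>' y) (cw L' (t - \<sigma> y + \<sigma> y))" using niceD(5)[OF N' y] by simp
    also have "\<dots> = \<phi> (fst (\<tau> y)) (cw L (t - \<sigma> y))"
    proof -
      have "R (fst (\<tau> y)) (\<iota>' y) (\<sigma> y)" using Qy[OF y] unfolding Q_def by simp
      then show ?thesis unfolding R_def by (rule spec)
    qed
    also have "cw L (t - \<sigma> y) = r y"
      using t[of "- \<sigma> y"] cw_cw[OF L L' LL, of "t - \<sigma> y"] by (simp add: r_def)
    finally show ?thesis .
  qed
  moreover have "\<tau> ` topspace Y \<subseteq> K" using Qy unfolding Q_def by auto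
  moreover have "\<exists>y\<in>topspace Y. \<tau> y = k \<and> r y = 0" if k: "k \<in> K" for k
  proof -
    have "fst k \<in> \<iota> ` topspace X" using k by (auto simp: K_def)
    then obtain j s where j: "j \<in> \<iota>' ` topspace Y" "R (fst k) j s" using R1 by blast
    obtain y where y: "y \<in> topspace Y" "\<iota>' y = j" "\<kappa>' y = b k" "p' y = 0"
      using niceD(6)[OF N' j(1) bM[OF k]] by blast
    have "\<tau> y = k" using Qy[OF y(1)] y k j(2) unfolding Q_def by auto
    \<comment> \<open>Moving \<open>y\<close> by \<open>\<sigma> y\<close> cancels the shift built
      into \<open>r\<close>, so that the new vertex of \<open>v\<close> is \<open>0\<close>.\<close>
    define v where "v = ipow Y S (\<sigma> y) y"
    have v: "v \<in> topspace Y" unfolding v_def by (rule ipow_in[OF Y(1) y(1)])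
    have "\<iota>' v = \<iota>' y" "\<kappa>' v = \<kappa>' y" unfolding v_def by (rule idx[OF y(1)])+
    then have "\<tau> v = k" "\<sigma> v = \<sigma> y" using \<open>\<tau> y = k\<close> by (simp_all add: \<tau>_def \<sigma>_def)
    moreover have "ipow Y S (- \<sigma> y) v = y"
      unfolding v_def using ipow_add[OF Y(1) y(1), of "- \<sigma> y" "\<sigma> y"] by (simp add: ipow_0)
    ultimately have "r v = 0" using y(4) L by (simp add: r_def cw_def)
    then show ?thesis using v \<open>\<tau> v = k\<close> by blast
  qed
  ultimately show ?thesis unfolding K_def by blast
qed

lemma walks_comp: "walks X T (\<lambda>x. h (f x)) = (\<lambda>w k. h (w k)) ` walks X T f"
  by (auto simp: walks_def)

text \<open>Refining \<open>f\<close> and \<open>h\<close> jointly by dumbbells over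
  \<open>X\<close> and copying these over \<open>Y\<close> gives both systems the same dumbbells,
  each traversed in both. By \<open>dmap_walks_subset\<close> the finer words then coincide, which
  restores the invariant.\<close>

lemma universal_extension:
  fixes f h :: "'a \<Rightarrow> nat" and g :: "'b \<Rightarrow> nat"
  assumes X: "compact_space X" "homeomorphic_map X X T" "universal X T"
    and Y: "compact_space Y" "homeomorphic_map Y Y S" "universal Y S"
    and fg: "lconst X f" "lconst Y g" "walks X T f = walks Y S g" and h: "lconst X h"
  shows "\<exists>(f' :: 'a \<Rightarrow> nat) (g' :: 'b \<Rightarrow> nat) \<pi> \<rho>. lconst X f' \<and> lconst Y g' \<and> walks X T f' = walks Y S g' \<and>
      (\<forall>x\<in>topspace X. f x = \<pi> (f' x)) \<and> (\<forall>y\<in>topspace Y. g y = \<pi> (g' y)) \<and>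
      (\<forall>x\<in>topspace X. (h x :: nat) = \<rho> (f' x))"
proof -
  define F where "F x = to_nat (f x, h x)" for x
  have "lconst X F" unfolding F_def by (rule lconst_comp[OF lconst_Pair[OF fg(1) h], where h=to_nat])
  then obtain L \<iota> \<kappa> p \<phi> where N: "nice X T F 1 1 L \<iota> \<kappa> p \<phi>"
    using X(3) unfolding universal_def by (metis zero_less_one)
  define \<phi>f where "\<phi>f i q = fst (from_nat (\<phi> i q) :: nat \<times> nat)" for i q
  define \<phi>h where "\<phi>h i q = snd (from_nat (\<phi> i q) :: nat \<times> nat)" for i q
  have Nf: "nice X T f 1 1 L \<iota> \<kappa> p \<phi>f"
    unfolding \<phi>f_def by (rule nice_comp[OF N]) (simp add: F_def)
  have Nh: "nice X T h 1 1 L \<iota> \<kappa> p \<phi>h"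
    unfolding \<phi>h_def by (rule nice_comp[OF N]) (simp add: F_def)
  from dumbbell_extension[OF X(1,2) Nf zero_less_one Y(2,3) fg(2,3)]
  obtain \<tau> r where *: "dmap Y S L \<tau> r \<and> (\<forall>y\<in>topspace Y. g y = \<phi>f (fst (\<tau> y)) (r y)) \<and>
    \<tau> ` topspace Y \<subseteq> (\<lambda>x. (\<iota> x, \<kappa> x)) ` topspace X \<and>
    (\<forall>k\<in>(\<lambda>x. (\<iota> x, \<kappa> x)) ` topspace X. \<exists>y\<in>topspace Y. \<tau> y = k \<and> r y = 0)"
    by (elim exE) (rule that)
  note d = *[THEN conjunct1]
  note gy = *[THEN conjunct2, THEN conjunct1, THEN bspec]
  note sub = *[THEN conjunct2, THEN conjunct2, THEN conjunct1]
  note hit = *[THEN conjunct2, THEN conjunct2, THEN conjunct2, THEN bspec]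
  note DX = niceD(1)[OF N]
  have W1: "walks X T (\<lambda>x. ((\<iota> x, \<kappa> x), p x)) \<subseteq> walks Y S (\<lambda>y. (\<tau> y, r y))"
    by (rule dmap_walks_subset[OF X(2) DX Y(1,2) d]) (use hit in blast)
  have W2: "walks Y S (\<lambda>y. (\<tau> y, r y)) \<subseteq> walks X T (\<lambda>x. ((\<iota> x, \<kappa> x), p x))"
  proof (rule dmap_walks_subset[OF Y(2) d X(1,2) DX])
    fix y assume "y \<in> topspace Y"
    then obtain x where x: "x \<in> topspace X" "\<tau> y = (\<iota> x, \<kappa> x)" using sub by blast
    obtain x' where "x' \<in> topspace X" "\<iota> x' = \<iota> x" "\<kappa> x' = \<kappa> x" "p x' = 0"
      using niceD(6)[OF N, of "\<iota> x" "\<kappa> x"] niceD(4)[OF N x(1)] x(1) by blast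
    then show "\<exists>x\<in>topspace X. (\<iota> x, \<kappa> x) = \<tau> y \<and> p x = 0" using x(2) by auto
  qed
  define f' where "f' x = to_nat ((\<iota> x, \<kappa> x), p x)" for x
  define g' where "g' y = to_nat (\<tau> y, r y)" for y
  have W: "walks X T f' = walks Y S g'"
    unfolding f'_def g'_def walks_comp[where h=to_nat] using W1 W2 by blast
  have lX: "lconst X f'" unfolding f'_def
    by (rule lconst_comp[OF lconst_Pair, where h=to_nat]) (use DX in \<open>simp_all add: dmap_def\<close>)
  have lY: "lconst Y g'" unfolding g'_def
    by (rule lconst_comp[OF lconst_Pair, where h=to_nat]) (use d in \<open>simp_all add: dmap_def\<close>)
  show ?thesis
  proof (rule exI[of _ f'], rule exI[of _ g'],
      rule exI[of _ "\<lambda>v. case from_nat v :: (nat \<times> nat) \<times> int of (k, q) \<Rightarrow> \<phi>f (fst k) q"],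
      rule exI[of _ "\<lambda>v. case from_nat v :: (nat \<times> nat) \<times> int of (k, q) \<Rightarrow> \<phi>h (fst k) q"],
      intro conjI ballI)
    show "f x = (case from_nat (f' x) :: (nat \<times> nat) \<times> int of (k, q) \<Rightarrow> \<phi>f (fst k) q)"
      if "x \<in> topspace X" for x using niceD(5)[OF Nf that] by (simp add: f'_def)
    show "h x = (case from_nat (f' x) :: (nat \<times> nat) \<times> int of (k, q) \<Rightarrow> \<phi>h (fst k) q)"
      if "x \<in> topspace X" for x using niceD(5)[OF Nh that] by (simp add: f'_def)
    show "g y = (case from_nat (g' y) :: (nat \<times> nat) \<times> int of (k, q) \<Rightarrow> \<phi>f (fst k) q)"
      if "y \<in> topspace Y" for y using gy[OF that] by (simp add: g'_def)
  qed (rule lX lY W)+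
qed

text \<open>Equal words make \<open>F\<close> equivariant: if \<open>F (T x)\<close> and
  \<open>S (F x)\<close> differed, a partition \<open>e\<close> would separate them, and words of
  length two over a partition recording both \<open>e y\<close> and \<open>e (S y)\<close> would
  detect this.\<close>

theorem universal_unique:
  assumes X: "zdc X" "homeomorphic_map X X T" "universal X T" "topspace X \<noteq> {}"
    and Y: "zdc Y" "homeomorphic_map Y Y S" "universal Y S" "topspace Y \<noteq> {}"
  shows "\<exists>F. homeomorphic_map X Y F \<and> (\<forall>x\<in>topspace X. F (T x) = S (F x))"
proof -
  define R :: "('a \<Rightarrow> nat) \<Rightarrow> ('b \<Rightarrow> nat) \<Rightarrow> bool"
    where "R f g \<longleftrightarrow> lconst X f \<and> lconst Y g \<and> walks X T f = walks Y S g" for f g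
  have cX: "compact_space X" and cY: "compact_space Y" using X(1) Y(1) by (simp_all add: zdc_def)
  have "\<exists>F. homeomorphic_map X Y F \<and> (\<forall>x\<in>topspace X. (0 :: nat) = 0) \<and>
      (\<forall>h::'b \<Rightarrow> nat. lconst Y h \<longrightarrow> (\<exists>f g \<pi>. R f g \<and> (\<forall>x\<in>topspace X. f x = g (F x)) \<and>
         (\<forall>y\<in>topspace Y. h y = \<pi> (g y))))"
  proof (rule back_and_forth[OF X(1) Y(1), where S=R and ?f0.0="\<lambda>_. 0" and ?g0.0="\<lambda>_. 0"])
    obtain x0 y0 where "x0 \<in> topspace X" "y0 \<in> topspace Y" using X(4) Y(4) by blast
    then have "walks X T (\<lambda>_. 0 :: nat) = {\<lambda>_. 0}" "walks Y S (\<lambda>_. 0 :: nat) = {\<lambda>_. 0}"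
      unfolding walks_def by blast+
    then show "R (\<lambda>_. 0) (\<lambda>_. 0)" by (simp add: R_def lconst_const)
    show "lconst X f \<and> lconst Y g \<and> f ` topspace X = g ` topspace Y" if "R f g" for f g
      using that walks_eq_image unfolding R_def by blast
    fix f :: "'a \<Rightarrow> nat" and g :: "'b \<Rightarrow> nat"
    assume R: "R f g"
    show "\<exists>f' g' \<pi> \<rho>. R f' g' \<and> (\<forall>x\<in>topspace X. f x = \<pi> (f' x)) \<and>
        (\<forall>y\<in>topspace Y. g y = \<pi> (g' y)) \<and> (\<forall>x\<in>topspace X. h x = \<rho> (f' x))"
      if h: "lconst X h" for h :: "'a \<Rightarrow> nat"
    proof -
      from R have "lconst X f" "lconst Y g" "walks X T f = walks Y S g" unfolding R_def by blast+
      from universal_extension[OF cX X(2,3) cY Y(2,3) this h] show ?thesis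
        unfolding R_def conj_assoc .
    qed
    show "\<exists>f' g' \<pi> \<rho>. R f' g' \<and> (\<forall>x\<in>topspace X. f x = \<pi> (f' x)) \<and>
        (\<forall>y\<in>topspace Y. g y = \<pi> (g' y)) \<and> (\<forall>y\<in>topspace Y. h y = \<rho> (g' y))"
      if h: "lconst Y h" for h :: "'b \<Rightarrow> nat"
    proof -
      from R have "walks Y S g = walks X T f" "lconst X f" "lconst Y g" unfolding R_def by simp_all
      from universal_extension[OF cY Y(2,3) cX X(2,3) this(3,2,1) h]
      show ?thesis
      proof (elim exE conjE)
        fix g' :: "'b \<Rightarrow> nat" and f' :: "'a \<Rightarrow> nat" and \<pi> \<rho> :: "nat \<Rightarrow> nat"
        assume "lconst Y g'" "lconst X f'" "walks Y S g' = walks X T f'"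
          and *: "\<forall>y\<in>topspace Y. g y = \<pi> (g' y)" "\<forall>x\<in>topspace X. f x = \<pi> (f' x)"
            "\<forall>y\<in>topspace Y. h y = \<rho> (g' y)"
        then have "R f' g'" by (simp add: R_def)
        then show "\<exists>f' g' \<pi> \<rho>. R f' g' \<and> (\<forall>x\<in>topspace X. f x = \<pi> (f' x)) \<and>
            (\<forall>y\<in>topspace Y. g y = \<pi> (g' y)) \<and> (\<forall>y\<in>topspace Y. h y = \<rho> (g' y))"
          using * by (intro exI conjI)
      qed
    qed
  qed
  then obtain F where F: "homeomorphic_map X Y F"
    and Fh: "\<And>h::'b \<Rightarrow> nat. lconst Y h \<Longrightarrow> \<exists>f g \<pi>. R f g \<and> (\<forall>x\<in>topspace X. f x = g (F x)) \<and>
         (\<forall>y\<in>topspace Y. h y = \<pi> (g y))" by blast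
  have FY: "F x \<in> topspace Y" if "x \<in> topspace X" for x
    using F that by (auto simp: homeomorphic_eq_everything_map)
  have SY: "S y \<in> topspace Y" if "y \<in> topspace Y" for y using homeomorphic_map_inj_surj(3)[OF Y(2) that] .
  have TX: "T x \<in> topspace X" if "x \<in> topspace X" for x using homeomorphic_map_inj_surj(3)[OF X(2) that] .
  have "F (T x) = S (F x)" if x: "x \<in> topspace X" for x
  proof (rule ccontr)
    assume neq: "F (T x) \<noteq> S (F x)"
    obtain e :: "'b \<Rightarrow> nat" where e: "lconst Y e" "e (F (T x)) \<noteq> e (S (F x))"
      using lconst_separation[OF Y(1) FY[OF TX[OF x]] SY[OF FY[OF x]] neq] .
    \<comment> \<open>The label of a point now determines \<open>e\<close> of its successor, and
      matched partitions see the same pairs of consecutive labels.\<close>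
    define h where "h y = to_nat (e y, e (S y))" for y
    have "lconst Y h" unfolding h_def
      by (rule lconst_comp[OF lconst_Pair[OF e(1) lconst_continuous[OF homeomorphic_imp_continuous_map[OF Y(2)] e(1)]], where h=to_nat])
    from Fh[OF this] obtain f g \<pi> where R: "R f g" and fF: "\<And>x. x \<in> topspace X \<Longrightarrow> f x = g (F x)"
      and h\<pi>: "\<And>y. y \<in> topspace Y \<Longrightarrow> h y = \<pi> (g y)" by blast
    have "(\<lambda>n. f (ipow X T n x)) \<in> walks Y S g" using R x unfolding R_def walks_def by blast
    then obtain y where y: "y \<in> topspace Y" "(\<lambda>n. f (ipow X T n x)) = (\<lambda>n. g (ipow Y S n y))"
      unfolding walks_def by blast
    have 0: "f x = g y" using fun_cong[OF y(2), of 0] by (simp add: ipow_0)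
    have 1: "f (T x) = g (S y)"
      using fun_cong[OF y(2), of 1] ipow_Suc[OF X(2) x, of 0] ipow_Suc[OF Y(2) y(1), of 0] by (simp add: ipow_0)
    have "h (F x) = h y" using h\<pi>[OF FY[OF x]] h\<pi>[OF y(1)] fF[OF x] 0 by simp
    moreover have "h (F (T x)) = h (S y)"
      using h\<pi>[OF FY[OF TX[OF x]]] h\<pi>[OF SY[OF y(1)]] fF[OF TX[OF x]] 1 by simp
    ultimately show False using e(2) by (simp add: h_def)
  qed
  then show ?thesis using F by blast
qed

section \<open>Conjugacy classes and realization of finite relations\<close>


lemma universal_iso:
  assumes F: "homeomorphic_map X Y F" and FT: "\<And>x. x \<in> topspace X \<Longrightarrow> F (T x) = S (F x)"
    and U: "universal Y S"
  shows "universal X T"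
  unfolding universal_def
proof (intro allI impI)
  fix f :: "'a \<Rightarrow> nat" and n :: int and m :: nat
  assume f: "lconst X f" and n: "n > 0" and m: "m > 0"
  define G where "G = inv_into (topspace X) F"
  have G: "homeomorphic_map Y X G" unfolding G_def by (rule homeomorphic_map_inv_into[OF F])
  have cF: "continuous_map X Y F" "continuous_map Y X G"
    using homeomorphic_imp_continuous_map[OF F] homeomorphic_imp_continuous_map[OF G] .
  have FX: "F ` topspace X = topspace Y" using F by (simp add: homeomorphic_eq_everything_map)
  have FY: "F x \<in> topspace Y" if "x \<in> topspace X" for x using FX that by blast
  have GF: "G (F x) = x" if "x \<in> topspace X" for x
    using F that by (simp add: G_def homeomorphic_eq_everything_map)
  have "lconst Y (\<lambda>y. f (G y))" by (rule lconst_continuous[OF cF(2) f])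
  with U n m obtain L \<iota> \<kappa> p \<phi> where N: "nice Y S (\<lambda>y. f (G y)) n m L \<iota> \<kappa> p \<phi>"
    unfolding universal_def by blast
  have D: "lconst Y (\<lambda>y. (\<iota> y, \<kappa> y))" "lconst Y p"
    "\<And>y. y \<in> topspace Y \<Longrightarrow> (\<iota> (S y), \<kappa> (S y)) = (\<iota> y, \<kappa> y) \<and> dedge L (p y) (p (S y))"
    using niceD(1)[OF N] unfolding dmap_def by blast+
  have img: "(\<lambda>x. \<iota> (F x)) ` topspace X = \<iota> ` topspace Y" unfolding FX[symmetric] by (simp add: image_image)
  have "nice X T f n m L (\<lambda>x. \<iota> (F x)) (\<lambda>x. \<kappa> (F x)) (\<lambda>x. p (F x)) \<phi>"
    unfolding nice_def img
  proof (intro conjI ballI allI impI)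
    show "dmap X T L (\<lambda>x. (\<iota> (F x), \<kappa> (F x))) (\<lambda>x. p (F x))"
      unfolding dmap_def
    proof (intro conjI ballI)
      show "L > 0" by (rule niceD(3)[OF N])
      show "lconst X (\<lambda>x. (\<iota> (F x), \<kappa> (F x)))" by (rule lconst_continuous[OF cF(1) D(1)])
      show "lconst X (\<lambda>x. p (F x))" by (rule lconst_continuous[OF cF(1) D(2)])
      fix x assume x: "x \<in> topspace X"
      show "(\<iota> (F (T x)), \<kappa> (F (T x))) = (\<iota> (F x), \<kappa> (F x))" "dedge L (p (F x)) (p (F (T x)))"
        using D(3)[OF FY[OF x]] FT[OF x] by simp_all
    qed
    show "n dvd L" by (rule niceD(2)[OF N])
    show "\<kappa> (F x) < m" if "x \<in> topspace X" for x using niceD(4)[OF N FY[OF that]] .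
    show "f x = \<phi> (\<iota> (F x)) (p (F x))" if "x \<in> topspace X" for x
      using niceD(5)[OF N FY[OF that]] GF[OF that] by simp
    fix i assume i: "i \<in> \<iota> ` topspace Y"
    show "\<exists>x\<in>topspace X. \<iota> (F x) = i \<and> \<kappa> (F x) = a \<and> p (F x) = 0" if "a < m" for a
      using niceD(6)[OF N i that] unfolding FX[symmetric] by blast
    show "\<exists>j\<in>\<iota> ` topspace Y. \<forall>q. - 2 * L \<le> q \<and> q < 2 * L \<longrightarrow> \<phi> j q = \<phi> i (q mod L - 2 * L)"
      by (rule niceD(7)[OF N i])
    show "\<exists>j\<in>\<iota> ` topspace Y. \<forall>q. - 2 * L \<le> q \<and> q < 2 * L \<longrightarrow> \<phi> j q = \<phi> i (q mod L + L)"
      by (rule niceD(8)[OF N i])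
  qed
  then show "\<exists>L \<iota> \<kappa> p \<phi>. nice X T f n m L \<iota> \<kappa> p \<phi>" by blast
qed

lemma homeos_restrict:
  assumes "homeomorphic_map X X T"
  shows "restrict T (topspace X) \<in> homeos X"
proof -
  have "homeomorphic_map X X (restrict T (topspace X))"
    by (rule homeomorphic_map_eq[OF assms]) simp
  then show ?thesis by (simp add: homeos_def)
qed

lemma homeosD:
  assumes "T \<in> homeos X"
  shows "homeomorphic_map X X T" "T \<in> extensional (topspace X)" "x \<in> topspace X \<Longrightarrow> T x \<in> topspace X"
  using assms homeomorphic_map_inj_surj(3) by (auto simp: homeos_def)

lemma pullback_homeo:
  assumes F: "homeomorphic_map X Y F" and S: "homeomorphic_map Y Y S"
  shows "restrict (inv_into (topspace X) F \<circ> S \<circ> F) (topspace X) \<in> homeos X"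
    and "x \<in> topspace X \<Longrightarrow> F (restrict (inv_into (topspace X) F \<circ> S \<circ> F) (topspace X) x) = S (F x)"
proof -
  have "homeomorphic_map X X (inv_into (topspace X) F \<circ> (S \<circ> F))"
    by (rule homeomorphic_map_compose[OF homeomorphic_map_compose[OF F S] homeomorphic_map_inv_into[OF F]])
  then show "restrict (inv_into (topspace X) F \<circ> S \<circ> F) (topspace X) \<in> homeos X"
    using homeos_restrict by (simp add: comp_assoc)
  assume x: "x \<in> topspace X"
  have "S (F x) \<in> F ` topspace X" using F S x unfolding homeomorphic_eq_everything_map by blast
  then have "F (inv_into (topspace X) F (S (F x))) = S (F x)" by (rule f_inv_into_f)
  then show "F (restrict (inv_into (topspace X) F \<circ> S \<circ> F) (topspace X) x) = S (F x)" using x by simp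
qed

text \<open>The explicit conjugation of extensional maps is traded for an intertwining
  homeomorphism, the form in which uniqueness is available.\<close>

lemma conj_class_alt:
  assumes T: "T \<in> homeos X"
  shows "T' \<in> conj_class X T \<longleftrightarrow>
    T' \<in> homeos X \<and> (\<exists>F. homeomorphic_map X X F \<and> (\<forall>x\<in>topspace X. F (T x) = T' (F x)))"
proof
  assume "T' \<in> conj_class X T"
  then obtain H where H: "H \<in> homeos X" and T': "T' = restrict (H \<circ> T \<circ> inv_into (topspace X) H) (topspace X)"
    by (auto simp: conj_class_def)
  have "homeomorphic_map X X (H \<circ> (T \<circ> inv_into (topspace X) H))"
    by (rule homeomorphic_map_compose[OF homeomorphic_map_compose[OF
          homeomorphic_map_inv_into[OF homeosD(1)[OF H]] homeosD(1)[OF T]] homeosD(1)[OF H]])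
  then have "T' \<in> homeos X" unfolding T' using homeos_restrict by (simp add: comp_assoc)
  moreover have "H (T x) = T' (H x)" if x: "x \<in> topspace X" for x
  proof -
    have "inv_into (topspace X) H (H x) = x"
      using homeomorphic_map_inj_surj(1)[OF homeosD(1)[OF H]] x by (rule inv_into_f_f)
    then show ?thesis using homeosD(3)[OF H x] by (simp add: T')
  qed
  ultimately show "T' \<in> homeos X \<and> (\<exists>F. homeomorphic_map X X F \<and> (\<forall>x\<in>topspace X. F (T x) = T' (F x)))"
    using homeosD(1)[OF H] by blast
next
  assume "T' \<in> homeos X \<and> (\<exists>F. homeomorphic_map X X F \<and> (\<forall>x\<in>topspace X. F (T x) = T' (F x)))"
  then obtain F where T': "T' \<in> homeos X" and F: "homeomorphic_map X X F"
    and FT: "\<And>x. x \<in> topspace X \<Longrightarrow> F (T x) = T' (F x)" by blast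
  define H where "H = restrict F (topspace X)"
  have H: "H \<in> homeos X" unfolding H_def by (rule homeos_restrict[OF F])
  have "T' y = restrict (H \<circ> T \<circ> inv_into (topspace X) H) (topspace X) y" for y
  proof (cases "y \<in> topspace X")
    case True
    then obtain x where x: "x \<in> topspace X" "y = F x" using homeomorphic_map_inj_surj(2)[OF F] by blast
    have "inv_into (topspace X) H (H x) = x"
      using homeomorphic_map_inj_surj(1)[OF homeosD(1)[OF H]] x(1) by (rule inv_into_f_f)
    then show ?thesis using x True homeosD(3)[OF T x(1)] FT[OF x(1)] by (simp add: H_def)
  next
    case False
    then show ?thesis using homeosD(2)[OF T'] by (simp add: extensional_def)
  qed
  then have "T' = restrict (H \<circ> T \<circ> inv_into (topspace X) H) (topspace X)" by (rule ext)
  then show "T' \<in> conj_class X T" unfolding conj_class_def using H by blast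
qed

lemma conj_class_universal:
  assumes X: "zdc X" "topspace X \<noteq> {}" and T: "T \<in> homeos X" "universal X T"
  shows "conj_class X T = {T \<in> homeos X. universal X T}"
proof (intro equalityI subsetI)
  fix T' assume "T' \<in> conj_class X T"
  then obtain F where T': "T' \<in> homeos X" and F: "homeomorphic_map X X F"
    and FT: "\<And>x. x \<in> topspace X \<Longrightarrow> F (T x) = T' (F x)" using conj_class_alt[OF T(1)] by blast
  define G where "G = inv_into (topspace X) F"
  have G: "homeomorphic_map X X G" unfolding G_def by (rule homeomorphic_map_inv_into[OF F])
  have "G (T' y) = T (G y)" if "y \<in> topspace X" for y
  proof -
    have "y \<in> F ` topspace X" using that homeomorphic_map_inj_surj(2)[OF F] by simp
    then obtain x where x: "x \<in> topspace X" "y = F x" by blast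
    have "G (F z) = z" if "z \<in> topspace X" for z
      unfolding G_def using homeomorphic_map_inj_surj(1)[OF F] that by (rule inv_into_f_f)
    from this[OF x(1)] this[OF homeosD(3)[OF T(1) x(1)]] show ?thesis
      by (simp add: x(2) FT[OF x(1), symmetric])
  qed
  from universal_iso[OF G this T(2)] show "T' \<in> {T \<in> homeos X. universal X T}" using T' by simp
next
  fix T' assume "T' \<in> {T \<in> homeos X. universal X T}"
  then have T': "T' \<in> homeos X" "universal X T'" by simp_all
  from universal_unique[OF X(1) homeosD(1)[OF T(1)] T(2) X(2) X(1) homeosD(1)[OF T'(1)] T'(2) X(2)] T'(1)
  show "T' \<in> conj_class X T" unfolding conj_class_alt[OF T(1)] by (rule conjI[rotated])
qed

lemma finite_iterate_periodic:
  assumes A: "finite A" and h: "\<And>v. v \<in> A \<Longrightarrow> h v \<in> A"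
  obtains n where "n > 0" "\<And>k c v. n \<le> k \<Longrightarrow> v \<in> A \<Longrightarrow> (h ^^ (k + n * c)) v = (h ^^ k) v"
proof -
  have in_A: "(h ^^ k) v \<in> A" if "v \<in> A" for k v using that h by (induction k) auto
  have "range (\<lambda>i. restrict (h ^^ i) A) \<subseteq> A \<rightarrow>\<^sub>E A" using in_A by auto
  then have "finite (range (\<lambda>i. restrict (h ^^ i) A))" using finite_PiE[OF A, of "\<lambda>_. A"] A finite_subset by blast
  then have "\<not> inj (\<lambda>i. restrict (h ^^ i) A)" using finite_imageD infinite_UNIV_nat by blast
  then obtain i j where ij: "i < j" "restrict (h ^^ i) A = restrict (h ^^ j) A"
    unfolding inj_on_def by (metis linorder_neqE_nat)
  define d where "d = j - i"
  have d: "d > 0" "j = i + d" using ij(1) by (simp_all add: d_def)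
  have per: "(h ^^ (k + d)) v = (h ^^ k) v" if "k \<ge> i" "v \<in> A" for k v
  proof -
    have "(h ^^ j) v = (h ^^ i) v" using fun_cong[OF ij(2), of v] that(2) by simp
    moreover have "k + d = (k - i) + j" "k = (k - i) + i" using d that(1) by simp_all
    ultimately show ?thesis by (metis comp_apply funpow_add)
  qed
  have per': "(h ^^ (k + d * c)) v = (h ^^ k) v" if "k \<ge> i" "v \<in> A" for k v c
  proof (induction c)
    case (Suc c)
    have eq: "k + d * Suc c = (k + d * c) + d" by simp
    show ?case unfolding eq using per[of "k + d * c" v] Suc that by simp
  qed simp
  \<comment> \<open>\<open>d * (i + 1)\<close> is a multiple of the period \<open>d\<close> and at
    least the preperiod \<open>i\<close>, so one number serves as both.\<close>
  have "(h ^^ (k + d * (i + 1) * c)) v = (h ^^ k) v" if "k \<ge> d * (i + 1)" "v \<in> A" for k c v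
  proof -
    have "i \<le> d * (i + 1)" using d(1) by (cases d) auto
    then have "k \<ge> i" using that(1) by linarith
    then show ?thesis using per'[OF _ that(2), of k "(i + 1) * c"] by (simp only: mult.assoc)
  qed
  moreover have "d * (i + 1) > 0" using d(1) by simp
  ultimately show thesis using that by blast
qed

text \<open>Every finite relation without dead ends is realized by a clopen partition of a universal
  system: through each edge runs a walk that is eventually periodic in both directions, and such a
  walk is an image of a dumbbell.\<close>

lemma universal_realizes:
  fixes R :: "('v \<times> 'v) set"
  assumes X: "compact_space X" "topspace X \<noteq> {}" "homeomorphic_map X X T" "universal X T"
    and R: "finite R" "R \<noteq> {}" "\<And>e. e \<in> R \<Longrightarrow> \<exists>w. (snd e, w) \<in> R" "\<And>e. e \<in> R \<Longrightarrow> \<exists>w. (w, fst e) \<in> R"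
  shows "\<exists>\<psi>. lconst X \<psi> \<and> (\<lambda>x. (\<psi> x, \<psi> (T x))) ` topspace X = R"
proof -
  define A where "A = fst ` R \<union> snd ` R"
  have "finite A" using R(1) by (simp add: A_def)
  have "\<forall>v\<in>A. \<exists>w. (v, w) \<in> R"
  proof
    fix v assume "v \<in> A"
    then consider e where "e \<in> R" "v = fst e" | e where "e \<in> R" "v = snd e" unfolding A_def by blast
    then show "\<exists>w. (v, w) \<in> R"
    proof cases
      case 1 then show ?thesis by (metis prod.collapse)
    next
      case 2 then show ?thesis using R(3) by simp
    qed
  qed
  from bchoice[OF this] obtain nx where nx: "\<And>v. v \<in> A \<Longrightarrow> (v, nx v) \<in> R" by blast
  have "\<forall>v\<in>A. \<exists>w. (w, v) \<in> R"
  proof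
    fix v assume "v \<in> A"
    then consider e where "e \<in> R" "v = fst e" | e where "e \<in> R" "v = snd e" unfolding A_def by blast
    then show "\<exists>w. (w, v) \<in> R"
    proof cases
      case 1 then show ?thesis using R(4) by simp
    next
      case 2 then show ?thesis by (metis prod.collapse)
    qed
  qed
  from bchoice[OF this] obtain pv where pv: "\<And>v. v \<in> A \<Longrightarrow> (pv v, v) \<in> R" by blast
  have A: "fst e \<in> A" "snd e \<in> A" if "e \<in> R" for e using that by (simp_all add: A_def)
  have nxA: "nx v \<in> A" if "v \<in> A" for v using A(2)[OF nx[OF that]] by simp
  have pvA: "pv v \<in> A" if "v \<in> A" for v using A(1)[OF pv[OF that]] by simp
  have nxk: "(nx ^^ k) v \<in> A" if "v \<in> A" for k v using that nxA by (induction k) auto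
  have pvk: "(pv ^^ k) v \<in> A" if "v \<in> A" for k v using that pvA by (induction k) auto
  obtain n1 where n1: "n1 > 0" "\<And>k c v. k \<ge> n1 \<Longrightarrow> v \<in> A \<Longrightarrow> (nx ^^ (k + n1 * c)) v = (nx ^^ k) v"
    by (rule finite_iterate_periodic[of A nx]) (rule \<open>finite A\<close> nxA that | assumption)+
  obtain n2 where n2: "n2 > 0" "\<And>k c v. k \<ge> n2 \<Longrightarrow> v \<in> A \<Longrightarrow> (pv ^^ (k + n2 * c)) v = (pv ^^ k) v"
    by (rule finite_iterate_periodic[of A pv]) (rule \<open>finite A\<close> pvA that | assumption)+
  obtain \<gamma> where \<gamma>: "bij_betw \<gamma> {0..<card R} R" using ex_bij_betw_nat_finite[OF R(1)] by blast
  have \<gamma>R: "\<gamma> a \<in> R" if "a < card R" for a using bij_betwE[OF \<gamma>] that by simp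
  \<comment> \<open>The walk \<open>u a\<close> crosses the edge \<open>\<gamma> a\<close> between
    times \<open>0\<close> and \<open>1\<close>, then follows chosen successors forwards and chosen
    predecessors backwards.\<close>
  define u where "u a x = (if x \<ge> 1 then (nx ^^ nat (x - 1)) (snd (\<gamma> a)) else (pv ^^ nat (- x)) (fst (\<gamma> a)))"
    for a and x :: int
  have walk: "(u a x, u a (x + 1)) \<in> R" if a: "a < card R" for a x
  proof -
    note A' = A[OF \<gamma>R[OF a]]
    consider "x \<ge> 1" | "x = 0" | "x < 0" by linarith
    then show ?thesis
    proof cases
      case 1
      then have "nat (x + 1 - 1) = Suc (nat (x - 1))" by simp
      then have "u a (x + 1) = nx (u a x)" "u a x \<in> A" using 1 nxk[OF A'(2)] by (simp_all add: u_def)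
      then show ?thesis using nx by simp
    next
      case 2 then show ?thesis using \<gamma>R[OF a] by (simp add: u_def)
    next
      case 3
      then have "nat (- x) = Suc (nat (- (x + 1)))" by simp
      then have "u a x = pv (u a (x + 1))" "u a (x + 1) \<in> A" using 3 pvk[OF A'(1)] by (simp_all add: u_def)
      then show ?thesis using pv by simp
    qed
  qed
  \<comment> \<open>A common multiple of both periods. The factor 2 makes \<open>L - 1\<close> at
    least \<open>n1\<close>: forward iteration starts at time \<open>1\<close>, so the right loop
    begins with iterate \<open>L - 1\<close>.\<close>
  define n where "n = 2 * n1 * n2"
  have "n > 0" using n1 n2 by (simp add: n_def)
  have cR: "card R > 0" using R(1,2) by (simp add: card_gt_0_iff)
  \<comment> \<open>Only the dumbbells matter here, so the partition to be refined is trivial. Copy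
    \<open>a\<close> of each dumbbell will carry the walk through edge \<open>a\<close>.\<close>
  obtain L \<iota> \<kappa> p \<phi> where N: "nice X T (\<lambda>_. 0 :: nat) (int n) (card R) L \<iota> \<kappa> p \<phi>"
    using X(4) \<open>n > 0\<close> cR lconst_const[of X "0 :: nat"] unfolding universal_def by (metis of_nat_0_less_iff)
  have L: "L > 0" by (rule niceD(3)[OF N])
  obtain c where c: "L = int n * c" using niceD(2)[OF N] by blast
  have "c > 0" using L c \<open>n > 0\<close> by (simp add: zero_less_mult_iff)
  define c' where "c' = nat c"
  have Ln: "L = int (n * c')" "c' > 0" using c \<open>c > 0\<close> by (simp_all add: c'_def)
  have L1: "L = int (n1 * (2 * n2 * c'))" "nat (L - 1) \<ge> n1"
  proof -
    show *: "L = int (n1 * (2 * n2 * c'))" using Ln by (simp add: n_def)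
    have "n2 * c' \<ge> 1" using n2 Ln by (simp add: Suc_leI)
    then have "n1 * (2 * (n2 * c')) \<ge> n1 * 2" by simp
    then have "n1 * (2 * n2 * c') \<ge> n1 * 2" by (simp add: mult.assoc)
    then show "nat (L - 1) \<ge> n1" using * n1 by linarith
  qed
  have L2: "L = int (n2 * (2 * n1 * c'))" "nat L \<ge> n2"
  proof -
    show *: "L = int (n2 * (2 * n1 * c'))" using Ln by (simp add: n_def)
    have "2 * n1 * c' \<ge> 1" using n1 Ln by (simp add: Suc_leI)
    then have "n2 * (2 * n1 * c') \<ge> n2 * 1" by (rule mult_le_mono2)
    then show "nat L \<ge> n2" using * by linarith
  qed
  have right: "u a (2 * L) = u a L" if a: "a < card R" for a
  proof -
    have "nat (2 * L - 1) = nat (L - 1) + n1 * (2 * n2 * c')" using L L1(1) by linarith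
    then show ?thesis using n1(2)[OF L1(2) A(2)[OF \<gamma>R[OF a]], of "2 * n2 * c'"] L by (simp add: u_def)
  qed
  have left: "u a (- 2 * L) = u a (- L)" if a: "a < card R" for a
  proof -
    have "nat (2 * L) = nat L + n2 * (2 * n1 * c')" using L L2(1) by linarith
    then show ?thesis using n2(2)[OF L2(2) A(1)[OF \<gamma>R[OF a]], of "2 * n1 * c'"] L by (simp add: u_def)
  qed
  define \<psi> where "\<psi> x = u (\<kappa> x) (p x)" for x
  have D: "lconst X (\<lambda>x. (\<iota> x, \<kappa> x))" "lconst X p"
    "\<And>x. x \<in> topspace X \<Longrightarrow> (\<iota> (T x), \<kappa> (T x)) = (\<iota> x, \<kappa> x) \<and> dedge L (p x) (p (T x))"
    using niceD(1)[OF N] unfolding dmap_def by blast+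
  have "lconst X (\<lambda>x. (\<lambda>((i, k), q). u k q) ((\<iota> x, \<kappa> x), p x))"
    by (rule lconst_comp[OF lconst_Pair[OF D(1,2)]])
  then have "lconst X \<psi>" by (simp add: \<psi>_def[abs_def])
  moreover have "(\<psi> x, \<psi> (T x)) \<in> R" if x: "x \<in> topspace X" for x
  proof -
    have k: "\<kappa> (T x) = \<kappa> x" "\<kappa> x < card R" using D(3)[OF x] niceD(4)[OF N x] by simp_all
    have "p (T x) = p x + 1 \<or> p x = - L - 1 \<and> p (T x) = - 2 * L \<or> p x = 2 * L - 1 \<and> p (T x) = L"
      using D(3)[OF x] by (simp add: dedge_def)
    then have "u (\<kappa> x) (p (T x)) = u (\<kappa> x) (p x + 1)" using left[OF k(2)] right[OF k(2)] by auto
    then show ?thesis using walk[OF k(2), of "p x"] k(1) by (simp add: \<psi>_def)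
  qed
  moreover have "\<exists>x\<in>topspace X. (\<psi> x, \<psi> (T x)) = e" if "e \<in> R" for e
  proof -
    have "e \<in> \<gamma> ` {0..<card R}" using bij_betw_imp_surj_on[OF \<gamma>] that by simp
    then obtain a where a: "a < card R" "\<gamma> a = e" by auto
    obtain x0 where "x0 \<in> topspace X" using X(2) by blast
    then obtain x where x: "x \<in> topspace X" "\<kappa> x = a" "p x = 0" using niceD(6)[OF N _ a(1)] by blast
    have "L \<ge> 2" using L1(2) n1(1) by linarith
    then have "p (T x) = 1" "\<kappa> (T x) = a" using D(3)[OF x(1)] x by (auto simp: dedge_def)
    then have "\<psi> x = fst e" "\<psi> (T x) = snd e" using x a by (simp_all add: \<psi>_def u_def)
    then show ?thesis using x(1) by (intro bexI[of _ x]) simp_all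
  qed
  ultimately show ?thesis by (intro exI[of _ \<psi>]) blast
qed

section \<open>The topology of uniform convergence\<close>


locale compact_metric =
  fixes m :: "'a metric" and X :: "'a topology"
  assumes X_def: "X = mtopology_of m" and compact: "compact_space X" and nonempty: "topspace X \<noteq> {}"
begin

lemma topspace_eq: "topspace X = mspace m"
  by (simp add: X_def)

lemma mdist_self: "x \<in> topspace X \<Longrightarrow> mdist m x x = 0"
  by (simp add: topspace_eq)

lemma openin_ball:
  assumes "openin X U" "x \<in> U"
  obtains r where "r > 0" "\<And>y. y \<in> topspace X \<Longrightarrow> mdist m x y < r \<Longrightarrow> y \<in> U"
proof -
  have M: "Metric_space (mspace m) (mdist m)" by simp
  have "openin (Metric_space.mtopology (mspace m) (mdist m)) U"
    using assms(1) by (simp add: X_def mtopology_of_def)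
  then obtain r where "r > 0" "Metric_space.mball (mspace m) (mdist m) x r \<subseteq> U"
    using assms(2) unfolding Metric_space.openin_mtopology[OF M] by blast
  moreover have "x \<in> topspace X" using assms openin_subset by blast
  ultimately show ?thesis
    by (intro that[of r]) (auto simp: Metric_space.mball_def[OF M] topspace_eq)
qed

lemma open_ball: "openin X {y \<in> topspace X. mdist m x y < r}" if "x \<in> topspace X"
proof -
  have M: "Metric_space (mspace m) (mdist m)" by simp
  have "openin (Metric_space.mtopology (mspace m) (mdist m)) (Metric_space.mball (mspace m) (mdist m) x r)"
    by (rule Metric_space.openin_mball[OF M])
  moreover have "Metric_space.mball (mspace m) (mdist m) x r = {y \<in> topspace X. mdist m x y < r}"
    using that by (auto simp: Metric_space.mball_def[OF M] topspace_eq)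
  ultimately show ?thesis by (simp add: X_def mtopology_of_def)
qed

text \<open>\<open>r\<close> is a Lebesgue number of the clopen partition given by \<open>g\<close>;
  the doubled radius leaves room for the triangle inequality.\<close>

lemma lconst_uniform:
  assumes g: "lconst X g"
  shows "\<exists>r>0. \<forall>x\<in>topspace X. \<forall>y\<in>topspace X. mdist m x y < r \<longrightarrow> g x = g y"
proof -
  have "\<exists>r>0. \<forall>y\<in>topspace X. mdist m x y < 2 * r \<longrightarrow> g y = g x" if x: "x \<in> topspace X" for x
  proof -
    from openin_ball[OF lconstD[OF g, of "g x"], of x] x
    obtain r where "r > 0" "\<And>y. y \<in> topspace X \<Longrightarrow> mdist m x y < r \<Longrightarrow> y \<in> {z \<in> topspace X. g z = g x}"
      by blast
    then show ?thesis by (intro exI[of _ "r / 2"]) simp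
  qed
  then have "\<forall>x\<in>topspace X. \<exists>r>0. \<forall>y\<in>topspace X. mdist m x y < 2 * r \<longrightarrow> g y = g x" by blast
  from bchoice[OF this] obtain r where r: "\<And>x. x \<in> topspace X \<Longrightarrow> r x > 0"
      "\<And>x y. x \<in> topspace X \<Longrightarrow> y \<in> topspace X \<Longrightarrow> mdist m x y < 2 * r x \<Longrightarrow> g y = g x" by blast
  obtain J where J: "finite J" "J \<subseteq> topspace X" "topspace X \<subseteq> (\<Union>x\<in>J. {y \<in> topspace X. mdist m x y < r x})"
  proof (rule compact_space_cover[OF compact, of "topspace X" "\<lambda>x. {y \<in> topspace X. mdist m x y < r x}"])
    show "openin X {y \<in> topspace X. mdist m x y < r x}" if "x \<in> topspace X" for x by (rule open_ball[OF that])
    show "topspace X \<subseteq> (\<Union>x\<in>topspace X. {y \<in> topspace X. mdist m x y < r x})"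
      using r(1) mdist_self by fastforce
  qed (rule that)
  define \<epsilon> where "\<epsilon> = Min (insert 1 (r ` J))"
  have "\<epsilon> > 0" using J r(1) by (auto simp: \<epsilon>_def)
  moreover have "g x = g y" if x: "x \<in> topspace X" and y: "y \<in> topspace X" and d: "mdist m x y < \<epsilon>" for x y
  proof -
    obtain z where z: "z \<in> J" "mdist m z x < r z" using J(3) x by blast
    have zX: "z \<in> topspace X" using z J(2) by blast
    have "\<epsilon> \<le> r z" using J(1) z(1) by (simp add: \<epsilon>_def)
    moreover have "mdist m z y \<le> mdist m z x + mdist m x y" using x y zX by (intro mdist_triangle) (simp_all add: topspace_eq)
    ultimately have "mdist m z y < 2 * r z" "mdist m z x < 2 * r z" using z(2) d r(1)[OF zX] by linarith+
    then show ?thesis using r(2)[OF zX y] r(2)[OF zX x] by simp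
  qed
  ultimately show ?thesis by blast
qed

lemma fine_partition:
  assumes z: "zdc X" and \<epsilon>: "\<epsilon> > 0"
  shows "\<exists>f :: 'a \<Rightarrow> nat. lconst X f \<and> (\<forall>x\<in>topspace X. \<forall>y\<in>topspace X. f x = f y \<longrightarrow> mdist m x y < \<epsilon>)"
proof -
  obtain e where e: "sepseq X e" using z by (auto simp: zdc_def)
  have "\<forall>x\<in>topspace X. \<exists>n. {y \<in> topspace X. e n y = e n x} \<subseteq> {y \<in> topspace X. mdist m x y < \<epsilon> / 2}"
  proof
    fix x assume x: "x \<in> topspace X"
    show "\<exists>n. {y \<in> topspace X. e n y = e n x} \<subseteq> {y \<in> topspace X. mdist m x y < \<epsilon> / 2}"
      by (rule sepseq_base[OF compact e open_ball[OF x]]) (use x \<epsilon> in \<open>simp add: mdist_self\<close>)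
  qed
  from bchoice[OF this] obtain N where N: "\<And>x. x \<in> topspace X \<Longrightarrow>
      {y \<in> topspace X. e (N x) y = e (N x) x} \<subseteq> {y \<in> topspace X. mdist m x y < \<epsilon> / 2}" by blast
  obtain J where J: "finite J" "J \<subseteq> topspace X"
      "topspace X \<subseteq> (\<Union>x\<in>J. {y \<in> topspace X. e (N x) y = e (N x) x})"
  proof (rule compact_space_cover[OF compact, of "topspace X" "\<lambda>x. {y \<in> topspace X. e (N x) y = e (N x) x}"])
    show "openin X {y \<in> topspace X. e (N x) y = e (N x) x}" for x
      by (rule lconstD[OF sepseqD(1)[OF e]])
  qed auto
  define n where "n = Max (N ` J)"
  have "mdist m x y < \<epsilon>" if x: "x \<in> topspace X" and y: "y \<in> topspace X" and eq: "e n x = e n y" for x y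
  proof -
    obtain z where z: "z \<in> J" "e (N z) x = e (N z) z" using J(3) x by blast
    have zX: "z \<in> topspace X" using z J(2) by blast
    have "N z \<le> n" using z J(1) by (simp add: n_def)
    from sepseq_mono[OF e x y eq this] have ey: "e (N z) y = e (N z) z" using z(2) by simp
    have "mdist m z x < \<epsilon> / 2" "mdist m z y < \<epsilon> / 2" using N[OF zX] x y ey z(2) by blast+
    moreover have "mdist m x y \<le> mdist m x z + mdist m z y" using x y zX by (intro mdist_triangle) (simp_all add: topspace_eq)
    ultimately show ?thesis by (simp add: mdist_commute)
  qed
  then show ?thesis using sepseqD(1)[OF e, of n] by blast
qed

lemma sup_dist_bdd:
  assumes "f \<in> homeos X" "g \<in> homeos X"
  shows "bdd_above ((\<lambda>x. mdist m (f x) (g x)) ` mspace m)"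
proof -
  have M: "Metric_space (mspace m) (mdist m)" by simp
  have "compactin (Metric_space.mtopology (mspace m) (mdist m)) (mspace m)"
    using compact by (simp add: X_def compact_space_def) (simp add: mtopology_of_def)
  then have "Metric_space.mbounded (mspace m) (mdist m) (mspace m)"
    by (rule Metric_space.compactin_imp_mbounded[OF M])
  then obtain B where B: "\<And>x y. x \<in> mspace m \<Longrightarrow> y \<in> mspace m \<Longrightarrow> mdist m x y \<le> B"
    by (auto simp: Metric_space.mbounded_alt[OF M])
  show ?thesis
    using homeosD(3)[OF assms(1)] homeosD(3)[OF assms(2)] by (intro bdd_aboveI2[where M=B] B) (simp_all add: topspace_eq)
qed

lemma sup_dist_upper:
  assumes "f \<in> homeos X" "g \<in> homeos X" "x \<in> topspace X"
  shows "mdist m (f x) (g x) \<le> sup_dist m f g"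
  using cSUP_upper[OF _ sup_dist_bdd[OF assms(1,2)], of x] assms by (simp add: sup_dist_def X_def)

lemma sup_dist_least:
  assumes "f \<in> homeos X" "g \<in> homeos X" "\<And>x. x \<in> topspace X \<Longrightarrow> mdist m (f x) (g x) \<le> c"
  shows "sup_dist m f g \<le> c"
proof -
  have "mspace m \<noteq> {}" using nonempty unfolding topspace_eq .
  from cSUP_least[OF this, of "\<lambda>x. mdist m (f x) (g x)" c] show ?thesis
    using assms by (simp add: sup_dist_def X_def)
qed

lemma Metric_space_homeos: "Metric_space (homeos X) (sup_dist m)"
  unfolding X_def
  by (rule Metric_space_sup_dist) (use compact nonempty in \<open>simp_all add: X_def\<close>)

lemma homeo_topology_eq: "homeo_topology m = Metric_space.mtopology (homeos X) (sup_dist m)"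
  by (simp add: homeo_topology_def X_def)

lemma topspace_homeo: "topspace (homeo_topology m) = homeos X"
  unfolding homeo_topology_eq by (rule Metric_space.topspace_mtopology[OF Metric_space_homeos])

lemma openin_homeoI:
  assumes "U \<subseteq> homeos X"
    and "\<And>T. T \<in> U \<Longrightarrow> \<exists>r>0. \<forall>T'\<in>homeos X. (\<forall>x\<in>topspace X. mdist m (T x) (T' x) < r) \<longrightarrow> T' \<in> U"
  shows "openin (homeo_topology m) U"
  unfolding homeo_topology_eq Metric_space.openin_mtopology[OF Metric_space_homeos]
proof (intro conjI allI impI assms(1))
  fix T assume T: "T \<in> U"
  then obtain r where r: "r > 0" "\<And>T'. T' \<in> homeos X \<Longrightarrow> (\<forall>x\<in>topspace X. mdist m (T x) (T' x) < r) \<Longrightarrow> T' \<in> U"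
    using assms(2) by blast
  have "T' \<in> U" if "T' \<in> Metric_space.mball (homeos X) (sup_dist m) T r" for T'
  proof -
    have T': "T \<in> homeos X" "T' \<in> homeos X" "sup_dist m T T' < r"
      using that unfolding Metric_space.in_mball[OF Metric_space_homeos] by simp_all
    have "mdist m (T x) (T' x) < r" if "x \<in> topspace X" for x
      using sup_dist_upper[OF T'(1,2) that] T'(3) by linarith
    then show ?thesis using r(2)[OF T'(2)] by blast
  qed
  then show "\<exists>r>0. Metric_space.mball (homeos X) (sup_dist m) T r \<subseteq> U" using r(1) by blast
qed

lemma dense_homeoI:
  assumes "S \<subseteq> homeos X"
    and "\<And>T \<epsilon>. T \<in> homeos X \<Longrightarrow> \<epsilon> > 0 \<Longrightarrow> \<exists>T'\<in>S. \<forall>x\<in>topspace X. mdist m (T x) (T' x) < \<epsilon>"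
  shows "homeo_topology m closure_of S = homeos X"
proof (intro equalityI subsetI)
  fix T assume T: "T \<in> homeos X"
  show "T \<in> homeo_topology m closure_of S"
    unfolding homeo_topology_eq Metric_space.metric_closure_of[OF Metric_space_homeos]
  proof (intro CollectI conjI allI impI T)
    fix r :: real assume r: "r > 0"
    \<comment> \<open>Pointwise distances below a bound only give a supremum not exceeding it, so
      half of the radius is requested.\<close>
    then have "r / 2 > 0" by simp
    from assms(2)[OF T this] obtain T' where T': "T' \<in> S" "\<And>x. x \<in> topspace X \<Longrightarrow> mdist m (T x) (T' x) < r / 2"
      by blast
    have T'H: "T' \<in> homeos X" using T'(1) assms(1) by blast
    have "sup_dist m T T' \<le> r / 2" by (rule sup_dist_least[OF T T'H]) (use T'(2) in \<open>simp add: less_imp_le\<close>)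
    then have "T' \<in> Metric_space.mball (homeos X) (sup_dist m) T r"
      unfolding Metric_space.in_mball[OF Metric_space_homeos] using T T'H r by simp
    then show "\<exists>y\<in>S. y \<in> Metric_space.mball (homeos X) (sup_dist m) T r" using T'(1) by blast
  qed
next
  fix T assume "T \<in> homeo_topology m closure_of S"
  then show "T \<in> homeos X" using closure_of_subset_topspace[of "homeo_topology m" S] topspace_homeo by blast
qed

definition nice_homeos :: "('a \<Rightarrow> nat) \<Rightarrow> int \<Rightarrow> nat \<Rightarrow> ('a \<Rightarrow> 'a) set" where
  "nice_homeos f n k = {T \<in> homeos X. \<exists>L \<iota> \<kappa> p \<phi>. nice X T f n k L \<iota> \<kappa> p \<phi>}"

text \<open>Only the \<open>dmap\<close> clause of \<open>nice\<close> involves the homeomorphism.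
  If \<open>T'\<close> is closer to \<open>T\<close> than the Lebesgue number of the partition, then
  \<open>T x\<close> and \<open>T' x\<close> lie in the same cell, so \<open>T'\<close> follows the
  same edges.\<close>

lemma openin_nice_homeos: "openin (homeo_topology m) (nice_homeos f n k)"
proof (rule openin_homeoI)
  show "nice_homeos f n k \<subseteq> homeos X" by (auto simp: nice_homeos_def)
  fix T assume T: "T \<in> nice_homeos f n k"
  then have TH: "T \<in> homeos X" by (simp add: nice_homeos_def)
  from T obtain L \<iota> \<kappa> p \<phi> where N: "nice X T f n k L \<iota> \<kappa> p \<phi>" unfolding nice_homeos_def by blast
  have D: "L > 0" "lconst X (\<lambda>x. (\<iota> x, \<kappa> x))" "lconst X p"
    "\<And>x. x \<in> topspace X \<Longrightarrow> (\<iota> (T x), \<kappa> (T x)) = (\<iota> x, \<kappa> x) \<and> dedge L (p x) (p (T x))"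
    using niceD(1)[OF N] unfolding dmap_def by blast+
  obtain r where r: "r > 0" "\<And>x y. x \<in> topspace X \<Longrightarrow> y \<in> topspace X \<Longrightarrow> mdist m x y < r \<Longrightarrow>
      ((\<iota> x, \<kappa> x), p x) = ((\<iota> y, \<kappa> y), p y)"
    using lconst_uniform[OF lconst_Pair[OF D(2,3)]] by blast
  have "T' \<in> nice_homeos f n k"
    if T': "T' \<in> homeos X" and close: "\<forall>x\<in>topspace X. mdist m (T x) (T' x) < r" for T'
  proof -
    have "dmap X T' L (\<lambda>x. (\<iota> x, \<kappa> x)) p"
      unfolding dmap_def
    proof (intro conjI ballI D(1-3))
      fix x assume x: "x \<in> topspace X"
      have "((\<iota> (T x), \<kappa> (T x)), p (T x)) = ((\<iota> (T' x), \<kappa> (T' x)), p (T' x))"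
        by (rule r(2)[OF homeosD(3)[OF TH x] homeosD(3)[OF T' x]]) (use close x in blast)
      then show "(\<iota> (T' x), \<kappa> (T' x)) = (\<iota> x, \<kappa> x)" "dedge L (p x) (p (T' x))" using D(4)[OF x] by simp_all
    qed
    then have "nice X T' f n k L \<iota> \<kappa> p \<phi>" using N unfolding nice_def by blast
    then show ?thesis using T' unfolding nice_homeos_def by blast
  qed
  then show "\<exists>r>0. \<forall>T'\<in>homeos X. (\<forall>x\<in>topspace X. mdist m (T x) (T' x) < r) \<longrightarrow> T' \<in> nice_homeos f n k"
    using r(1) by blast
qed

text \<open>Every partition is coarser than some \<open>e i\<close>, and a refinement of
  \<open>e i\<close> serves all coarser partitions by \<open>nice_comp\<close>. This leaves a
  countable intersection.\<close>

lemma universal_homeos_eq: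
  assumes e: "sepseq X e"
  shows "{T \<in> homeos X. universal X T} = (\<Inter>(i, n, k). nice_homeos (e i) (int (Suc n)) (Suc k))"
proof (intro equalityI subsetI)
  fix T assume T: "T \<in> {T \<in> homeos X. universal X T}"
  then have "T \<in> nice_homeos (e i) (int (Suc n)) (Suc k)" for i n k
    using sepseqD(1)[OF e, of i] unfolding universal_def nice_homeos_def by (auto simp del: of_nat_Suc)
  then show "T \<in> (\<Inter>(i, n, k). nice_homeos (e i) (int (Suc n)) (Suc k))" by auto
next
  fix T assume "T \<in> (\<Inter>(i, n, k). nice_homeos (e i) (int (Suc n)) (Suc k))"
  then have T: "T \<in> nice_homeos (e i) (int (Suc n)) (Suc k)" for i n k by auto
  have "\<exists>L \<iota> \<kappa> p \<phi>. nice X T f n k L \<iota> \<kappa> p \<phi>" if f: "lconst X f" and n: "n > 0" and k: "k > 0" for f :: "'a \<Rightarrow> nat" and n k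
  proof -
    obtain i \<pi> where i: "\<And>x. x \<in> topspace X \<Longrightarrow> f x = \<pi> (e i x)"
      using lconst_countable_code[OF compact e f] by blast
    have nk: "int (Suc (nat (n - 1))) = n" "Suc (k - 1) = k" using n k by simp_all
    from T[of i "nat (n - 1)" "k - 1"] obtain L \<iota> \<kappa> p \<phi> where "nice X T (e i) n k L \<iota> \<kappa> p \<phi>"
      unfolding nice_homeos_def nk by blast
    from nice_comp[OF this, where f=f and \<pi>=\<pi>, OF i] show ?thesis by blast
  qed
  moreover have "T \<in> homeos X" using T[of 0 0 0] by (simp add: nice_homeos_def)
  ultimately show "T \<in> {T \<in> homeos X. universal X T}" unfolding universal_def by blast
qed

lemma universal_gdelta:
  assumes "zdc X"
  shows "gdelta_in (homeo_topology m) {T \<in> homeos X. universal X T}"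
proof -
  obtain e where e: "sepseq X e" using assms by (auto simp: zdc_def)
  show ?thesis
    unfolding universal_homeos_eq[OF e]
    by (rule gdelta_in_Inter) (auto intro!: open_imp_gdelta_in openin_nice_homeos)
qed

text \<open>Given \<open>S\<close> and a partition \<open>f\<close> with cells of diameter below the
  tolerance, a universal map realizes the transition relation of \<open>f\<close> under
  \<open>S\<close>. Conjugating it so that equal transitions correspond gives a map sending each
  point into the same cell as \<open>S\<close> does.\<close>

lemma universal_dense:
  assumes X: "zdc X" "perfect X" and T0: "homeomorphic_map X X T0" "universal X T0"
  shows "homeo_topology m closure_of {T \<in> homeos X. universal X T} = homeos X"
proof (rule dense_homeoI)
  fix S \<epsilon> assume S: "S \<in> homeos X" and \<epsilon>: "(\<epsilon>::real) > 0"
  obtain f :: "'a \<Rightarrow> nat" where f: "lconst X f"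
    "\<And>x y. x \<in> topspace X \<Longrightarrow> y \<in> topspace X \<Longrightarrow> f x = f y \<Longrightarrow> mdist m x y < \<epsilon>"
    using fine_partition[OF X(1) \<epsilon>] by blast
  define R where "R = (\<lambda>x. (f x, f (S x))) ` topspace X"
  have lR: "lconst X (\<lambda>x. (f x, f (S x)))"
    by (rule lconst_Pair[OF f(1) lconst_continuous[OF homeomorphic_imp_continuous_map[OF homeosD(1)[OF S]] f(1)]])
  obtain \<psi> where \<psi>: "lconst X \<psi>" "(\<lambda>x. (\<psi> x, \<psi> (T0 x))) ` topspace X = R"
  proof -
    have "finite R" unfolding R_def by (rule lconst_finite_image[OF compact lR])
    moreover have "R \<noteq> {}" using nonempty by (simp add: R_def)
    moreover have "\<exists>w. (snd e, w) \<in> R" if eR: "e \<in> R" for e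
    proof -
      obtain x where x: "x \<in> topspace X" "e = (f x, f (S x))" using eR unfolding R_def by blast
      then have "(snd e, f (S (S x))) \<in> R" unfolding R_def using homeosD(3)[OF S x(1)] by (intro image_eqI[of _ _ "S x"]) simp_all
      then show ?thesis by blast
    qed
    moreover have "\<exists>w. (w, fst e) \<in> R" if eR: "e \<in> R" for e
    proof -
      obtain x where x: "x \<in> topspace X" "e = (f x, f (S x))" using eR unfolding R_def by blast
      have "x \<in> S ` topspace X" using homeomorphic_map_inj_surj(2)[OF homeosD(1)[OF S]] x(1) by simp
      then obtain y where y: "y \<in> topspace X" "x = S y" by blast
      then have "(f y, fst e) \<in> R" unfolding R_def using x(2) by (intro image_eqI[of _ _ y]) simp_all
      then show ?thesis by blast
    qed
    ultimately show ?thesis using universal_realizes[OF compact nonempty T0, of R] that by blast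
  qed
  \<comment> \<open>Points are labelled by edges, not by vertices, so that \<open>F\<close> matches
    the present cell and the next one at the same time.\<close>
  define F1 where "F1 x = to_nat (f x, f (S x))" for x
  define F2 where "F2 x = to_nat (\<psi> x, \<psi> (T0 x))" for x
  have l1: "lconst X F1" unfolding F1_def by (rule lconst_comp[OF lR, where h=to_nat])
  have l2: "lconst X F2" unfolding F2_def
    by (rule lconst_comp[OF lconst_Pair[OF \<psi>(1) lconst_continuous[OF homeomorphic_imp_continuous_map[OF T0(1)] \<psi>(1)]], where h=to_nat])
  have "F1 ` topspace X = to_nat ` R" by (simp add: F1_def R_def image_image)
  also have "\<dots> = F2 ` topspace X" by (simp add: F2_def \<psi>(2)[symmetric] image_image)
  finally have img: "F1 ` topspace X = F2 ` topspace X" .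
  obtain F where F: "homeomorphic_map X X F" "\<And>x. x \<in> topspace X \<Longrightarrow> F1 x = F2 (F x)"
    using perfect_zdc_homeomorphism[OF X X l1 l2 img] by blast
  define T where "T = restrict (inv_into (topspace X) F \<circ> T0 \<circ> F) (topspace X)"
  have T: "T \<in> homeos X" unfolding T_def by (rule pullback_homeo(1)[OF F(1) T0(1)])
  have FT: "F (T x) = T0 (F x)" if "x \<in> topspace X" for x
    unfolding T_def by (rule pullback_homeo(2)[OF F(1) T0(1) that])
  have "universal X T" by (rule universal_iso[OF F(1) FT T0(2)])
  moreover have "mdist m (S x) (T x) < \<epsilon>" if x: "x \<in> topspace X" for x
  proof -
    have eq: "f y = \<psi> (F y) \<and> f (S y) = \<psi> (T0 (F y))" if "y \<in> topspace X" for y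
      using F(2)[OF that] by (simp add: F1_def F2_def)
    have "f (T x) = \<psi> (F (T x))" using eq[OF homeosD(3)[OF T x]] by simp
    also have "\<dots> = f (S x)" using eq[OF x] FT[OF x] by simp
    finally show ?thesis using f(2)[OF homeosD(3)[OF S x] homeosD(3)[OF T x]] by simp
  qed
  ultimately show "\<exists>T'\<in>{T \<in> homeos X. universal X T}. \<forall>x\<in>topspace X. mdist m (S x) (T' x) < \<epsilon>"
    using T by blast
qed auto

text \<open>Each open set in the intersection contains the dense set of universal homeomorphisms, so
  its closed complement has empty interior.\<close>

lemma first_category_complement:
  assumes X: "zdc X" and dense: "homeo_topology m closure_of {T \<in> homeos X. universal X T} = homeos X"
  shows "first_category_in (homeo_topology m) (homeos X - {T \<in> homeos X. universal X T})"
proof -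
  obtain e where e: "sepseq X e" using assms by (auto simp: zdc_def)
  define N where "N = (\<lambda>(i, n, k). homeos X - nice_homeos (e i) (int (Suc n)) (Suc k))"
  have "nowhere_dense_in (homeo_topology m) (N j)" for j
  proof -
    obtain i n k where j: "j = (i, n, k)" by (cases j)
    have Nj: "N j = homeos X - nice_homeos (e i) (int (Suc n)) (Suc k)" by (simp add: N_def j)
    have cl: "closedin (homeo_topology m) (N j)"
      unfolding Nj topspace_homeo[symmetric] by (rule closedin_diff[OF closedin_topspace openin_nice_homeos])
    define V where "V = homeo_topology m interior_of (N j)"
    have V: "openin (homeo_topology m) V" "V \<subseteq> N j" unfolding V_def by (simp_all add: interior_of_subset)
    have "V = {}"
    proof (rule ccontr)
      assume "V \<noteq> {}"
      then obtain T where T: "T \<in> V" by blast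
      then have "T \<in> homeo_topology m closure_of {T \<in> homeos X. universal X T}"
        using V(2) dense unfolding Nj by blast
      then obtain T' where "T' \<in> {T \<in> homeos X. universal X T}" "T' \<in> V"
        using T V(1) unfolding in_closure_of by blast
      then show False using V(2) unfolding universal_homeos_eq[OF e] Nj by blast
    qed
    then show ?thesis
      unfolding nowhere_dense_in_def closure_of_closedin[OF cl] V_def[symmetric]
      using closedin_subset[OF cl] by simp
  qed
  moreover have "homeos X - {T \<in> homeos X. universal X T} = \<Union>(range N)"
    unfolding universal_homeos_eq[OF e] by (auto simp: N_def)
  ultimately show ?thesis
    unfolding first_category_in_def by (intro exI[of _ "range N"]) auto
qed

end

section \<open>Gaps of the Cantor set\<close>


text \<open>These are the left end points of the intervals that make up stage
  \<open>n\<close>.\<close>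

primrec cantor_left :: "nat \<Rightarrow> real set" where
  "cantor_left 0 = {0}"
| "cantor_left (Suc n) = (\<lambda>x. x / 3) ` cantor_left n \<union> (\<lambda>x. (x + 2) / 3) ` cantor_left n"

text \<open>The gap removed from \<open>[l, l + 1 / 3 ^ n]\<close> in passing to stage
  \<open>n + 1\<close>. Its length has exponent \<open>n + 1\<close>, so the gaps retained in
  \<open>D_set\<close> are those with even \<open>n\<close>.\<close>

definition middle_third :: "nat \<Rightarrow> real \<Rightarrow> real set" where
  "middle_third n l = {l + 1 / 3 ^ Suc n<..<l + 2 / 3 ^ Suc n}"

lemma cantor_left_bounds: "l \<in> cantor_left n \<Longrightarrow> 0 \<le> l \<and> l + 1 / 3 ^ n \<le> 1"
proof (induction n arbitrary: l)
  case (Suc n)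
  then obtain x where x: "x \<in> cantor_left n" "l = x / 3 \<or> l = (x + 2) / 3" by auto
  have "1 / 3 ^ Suc n = (1 / 3 ^ n) / (3::real)" by simp
  then show ?case using Suc.IH[OF x(1)] x(2) by auto
qed simp

lemma cantor_stage_eq: "cantor_stage n = (\<Union>l\<in>cantor_left n. {l..l + 1 / 3 ^ n})"
proof (induction n)
  case (Suc n)
  have a: "(\<lambda>x. x / 3) ` {l..l + 1 / 3 ^ n} = {l / 3..l / 3 + 1 / 3 ^ Suc n}" for l :: real
    using image_affinity_atLeastAtMost[of "1 / 3" 0 l "l + 1 / 3 ^ n"] by (simp add: field_simps)
  have b: "(\<lambda>x. (x + 2) / 3) ` {l..l + 1 / 3 ^ n} = {(l + 2) / 3..(l + 2) / 3 + 1 / 3 ^ Suc n}" for l :: real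
    using image_affinity_atLeastAtMost[of "1 / 3" "2 / 3" l "l + 1 / 3 ^ n"] by (simp add: field_simps)
  have "cantor_stage (Suc n) = (\<Union>l\<in>cantor_left n. (\<lambda>x. x / 3) ` {l..l + 1 / 3 ^ n}) \<union>
      (\<Union>l\<in>cantor_left n. (\<lambda>x. (x + 2) / 3) ` {l..l + 1 / 3 ^ n})"
    by (simp add: Suc image_UN)
  also have "\<dots> = (\<Union>l\<in>cantor_left (Suc n). {l..l + 1 / 3 ^ Suc n})"
    unfolding a b cantor_left.simps by (simp add: UN_Un)
  finally show ?case .
qed simp

lemma cantor_set_scale:
  assumes "c \<in> cantor_set" shows "c / 3 \<in> cantor_set" "(c + 2) / 3 \<in> cantor_set"
proof -
  have c: "c \<in> cantor_stage n" for n using assms by (simp add: cantor_set_def)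
  have "c / 3 \<in> cantor_stage n \<and> (c + 2) / 3 \<in> cantor_stage n" for n
  proof (cases n)
    case 0
    then show ?thesis using c[of 0] by simp
  next
    case (Suc k)
    then show ?thesis using c[of k] by auto
  qed
  then show "c / 3 \<in> cantor_set" "(c + 2) / 3 \<in> cantor_set" by (auto simp: cantor_set_def)
qed

lemma cantor_set_copy:
  "l \<in> cantor_left n \<Longrightarrow> c \<in> cantor_set \<Longrightarrow> l + c / 3 ^ n \<in> cantor_set"
proof (induction n arbitrary: l)
  case (Suc n)
  then obtain x where x: "x \<in> cantor_left n" "l = x / 3 \<or> l = (x + 2) / 3" by auto
  have "x + c / 3 ^ n \<in> cantor_set" using Suc.IH[OF x(1) Suc.prems(2)] .
  then have "(x + c / 3 ^ n) / 3 \<in> cantor_set" "(x + c / 3 ^ n + 2) / 3 \<in> cantor_set"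
    by (rule cantor_set_scale)+
  moreover have "c / 3 ^ Suc n = c / 3 ^ n / 3" by simp
  then have "l + c / 3 ^ Suc n = (x + c / 3 ^ n) / 3 \<or> l + c / 3 ^ Suc n = (x + c / 3 ^ n + 2) / 3"
    using x(2) by (auto simp: add_divide_distrib)
  ultimately show ?case by metis
qed simp

lemma cantor_set_basic: "closed cantor_set" "cantor_set \<subseteq> {0..1}" "0 \<in> cantor_set" "1 \<in> cantor_set"
proof -
  show "closed cantor_set" "0 \<in> cantor_set" "1 \<in> cantor_set"
    unfolding cantor_set_def using cantor_stage_props by (simp_all add: closed_INT)
  show "cantor_set \<subseteq> {0..1}" using cantor_stage_props(2)[of 0] unfolding cantor_set_def by blast
qed

lemma compact_cantor_set: "compact cantor_set"
  using cantor_set_basic(1,2) by (meson bounded_closed_interval bounded_subset compact_eq_bounded_closed)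

lemma cantor_left_Suc:
  "l \<in> cantor_left n \<Longrightarrow> l \<in> cantor_left (Suc n) \<and> l + 2 / 3 ^ Suc n \<in> cantor_left (Suc n)"
proof (induction n arbitrary: l)
  case (Suc n)
  then obtain x where x: "x \<in> cantor_left n" "l = x / 3 \<or> l = (x + 2) / 3" by auto
  have ih: "x \<in> cantor_left (Suc n)" "x + 2 / 3 ^ Suc n \<in> cantor_left (Suc n)" using Suc.IH[OF x(1)] by auto
  have "y / 3 \<in> cantor_left (Suc (Suc n)) \<and> (y + 2) / 3 \<in> cantor_left (Suc (Suc n))"
    if "y \<in> cantor_left (Suc n)" for y
    using that unfolding cantor_left.simps(2)[of "Suc n"] by blast
  note Y = this[OF ih(1)] this[OF ih(2)]
  have e: "2 / 3 ^ Suc (Suc n) = 2 / 3 ^ Suc n / (3::real)" by simp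
  define t :: real where "t = 2 / 3 ^ Suc n"
  have "l + t / 3 = (x + t) / 3 \<and> l = x / 3 \<or> l + t / 3 = (x + t + 2) / 3 \<and> l = (x + 2) / 3"
    using x(2) by (auto simp: add_divide_distrib)
  then show ?case using Y unfolding e t_def[symmetric] by metis
qed simp

lemma cantor_left_mono:
  assumes "l \<in> cantor_left n" "n \<le> k"
  shows "l \<in> cantor_left k"
  using assms(2,1) by (induction rule: dec_induct) (use cantor_left_Suc in blast)+

text \<open>The right end points of the intervals of a stage are \<open>r\<close> with \<open>r - 1 / 3 ^ n\<close> a left end point.\<close>

lemma cantor_right_mono:
  assumes "r - 1 / 3 ^ n \<in> cantor_left n" "n \<le> k"
  shows "r - 1 / 3 ^ k \<in> cantor_left k"
  using assms(2,1)
proof (induction rule: dec_induct)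
  case (step k)
  then have "r - 1 / 3 ^ k + 2 / 3 ^ Suc k \<in> cantor_left (Suc k)" using cantor_left_Suc by blast
  moreover have "r - 1 / 3 ^ k + 2 / 3 ^ Suc k = r - 1 / 3 ^ Suc k" by (simp add: field_simps)
  ultimately show ?case by simp
qed

lemma middle_third_disjoint_stage:
  "l \<in> cantor_left n \<Longrightarrow> middle_third n l \<inter> cantor_stage (Suc n) = {}"
proof (induction n arbitrary: l)
  case 0
  then show ?case by (auto simp: middle_third_def)
next
  case (Suc n)
  then obtain x where x: "x \<in> cantor_left n" "l = x / 3 \<or> l = (x + 2) / 3" by auto
  have b: "0 \<le> x" "x + 1 / 3 ^ n \<le> 1" using cantor_left_bounds[OF x(1)] by auto
  have p: "2 / 3 ^ Suc n < (1 / 3 ^ n :: real)" "0 < (1 / 3 ^ Suc n :: real)" by (simp_all add: field_simps)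
  have ih: "y \<notin> cantor_stage (Suc n)" if "x + 1 / 3 ^ Suc n < y" "y < x + 2 / 3 ^ Suc n" for y
  proof -
    have "y \<in> middle_third n x" unfolding middle_third_def greaterThanLessThan_iff using that by blast
    then show ?thesis using Suc.IH[OF x(1)] by blast
  qed
  have st: "cantor_stage (Suc n) \<subseteq> {0..1}" by (rule cantor_stage_props(2))
  show ?case
  proof (rule ccontr)
    assume "\<not> ?thesis"
    then obtain z where z: "z \<in> middle_third (Suc n) l" "z \<in> cantor_stage (Suc (Suc n))" by blast
    from z(2) obtain y where y: "y \<in> cantor_stage (Suc n)" "z = y / 3 \<or> z = (y + 2) / 3"
      unfolding cantor_stage.simps(2)[of "Suc n"] by blast
    have y01: "0 \<le> y" "y \<le> 1" using st y(1) by auto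
    have e: "1 / 3 ^ Suc (Suc n) = (1 / 3 ^ Suc n) / (3 :: real)" "2 / 3 ^ Suc (Suc n) = (2 / 3 ^ Suc n) / (3 :: real)"
      by simp_all
    have zz: "l + (1 / 3 ^ Suc n) / 3 < z" "z < l + (2 / 3 ^ Suc n) / 3"
      using z(1) unfolding middle_third_def e by simp_all
    define s :: real where "s = 1 / 3 ^ Suc n"
    have e2: "2 / 3 ^ Suc n = 2 * s" "1 / 3 ^ n = 3 * s" by (simp_all add: s_def)
    have zz: "l + s / 3 < z" "z < l + 2 * s / 3" using zz unfolding e2 s_def[symmetric] by simp_all
    have p: "0 < s" using p(2) unfolding s_def[symmetric] .
    have b: "0 \<le> x" "x + 3 * s \<le> 1" using b unfolding e2 .
    \<comment> \<open>If \<open>l\<close> and \<open>z\<close> come from the same similarity,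
      scaling by 3 gives a point in the middle third for \<open>x\<close> one stage earlier; if they
      come from different ones, the two outer thirds are too far apart.\<close>
    have "x + s < y \<and> y < x + 2 * s"
      using x(2) y(2)
    proof (elim disjE)
      assume "l = x / 3" "z = (y + 2) / 3" then have False using zz y01 b p by (simp add: field_simps)
      then show ?thesis ..
    next
      assume "l = (x + 2) / 3" "z = y / 3" then have False using zz y01 b p by (simp add: field_simps)
      then show ?thesis ..
    next
      assume "l = x / 3" "z = y / 3" then have "x + s < y" "y < x + 2 * s" using zz by (simp_all add: field_simps)
      then show ?thesis ..
    next
      assume "l = (x + 2) / 3" "z = (y + 2) / 3" then have "x + s < y" "y < x + 2 * s" using zz by (simp_all add: field_simps)
      then show ?thesis ..
    qed
    then have "x + 1 / 3 ^ Suc n < y" "y < x + 2 / 3 ^ Suc n" unfolding e2 s_def[symmetric] by blast+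
    then show False using ih y(1) by blast
  qed
qed

lemma component_of_interval:
  fixes a b :: real
  assumes "a < b" "{a<..<b} \<subseteq> S" "a \<notin> S" "b \<notin> S"
  shows "{a<..<b} \<in> components S"
  unfolding in_components_maximal
proof (intro conjI allI impI)
  show "{a<..<b} \<noteq> {}" using assms(1) by simp
  fix d assume d: "d \<noteq> {} \<and> {a<..<b} \<subseteq> d \<and> d \<subseteq> S \<and> connected d"
  have "d \<subseteq> {a<..<b}"
  proof
    fix x assume x: "x \<in> d"
    have i: "y \<in> d" if "u \<in> d" "v \<in> d" "u \<le> y" "y \<le> v" for u v y
      using d that unfolding connected_iff_interval by blast
    have "(a + b) / 2 \<in> {a<..<b}" using assms(1) by simp
    then have m: "(a + b) / 2 \<in> d" using d by blast
    have "a < x"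
    proof (rule ccontr)
      assume "\<not> a < x"
      then have "a \<in> d" using i[OF x m] assms(1) by simp
      then show False using d assms(3) by blast
    qed
    moreover have "x < b"
    proof (rule ccontr)
      assume "\<not> x < b"
      then have "b \<in> d" using i[OF m x] assms(1) by simp
      then show False using d assms(4) by blast
    qed
    ultimately show "x \<in> {a<..<b}" by simp
  qed
  then show "d = {a<..<b}" using d by blast
qed (use assms in simp_all)

lemma components_eq_of_common:
  assumes "A \<in> components S" "B \<in> components S" "x \<in> A" "x \<in> B"
  shows "A = B"
  using components_nonoverlap[OF assms(1,2)] assms(3,4) by blast

lemma middle_third_facts:
  assumes l: "l \<in> cantor_left n"
  shows "l + 1 / 3 ^ Suc n \<in> cantor_set" "l + 2 / 3 ^ Suc n \<in> cantor_set"
    and "middle_third n l \<inter> cantor_set = {}"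
    and "l + 1 / 3 ^ Suc n < l + 2 / 3 ^ Suc n"
    and "middle_third n l \<subseteq> {0..1}"
    and "middle_third n l \<in> components ({0..1} - cantor_set)"
    and "Inf (middle_third n l) = l + 1 / 3 ^ Suc n" "Sup (middle_third n l) = l + 2 / 3 ^ Suc n"
proof -
  note L = cantor_left_Suc[OF l]
  show 1: "l + 1 / 3 ^ Suc n \<in> cantor_set"
    using cantor_set_copy[OF conjunct1[OF L] cantor_set_basic(4)] .
  show 2: "l + 2 / 3 ^ Suc n \<in> cantor_set"
    using cantor_set_copy[OF conjunct2[OF L] cantor_set_basic(3)] by simp
  show 3: "middle_third n l \<inter> cantor_set = {}"
    using middle_third_disjoint_stage[OF l] unfolding cantor_set_def by blast
  have "(0::real) < 1 / 3 ^ Suc n" by simp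
  then show 4: "l + 1 / 3 ^ Suc n < l + 2 / 3 ^ Suc n" by (simp add: divide_strict_right_mono)
  show 5: "middle_third n l \<subseteq> {0..1}"
  proof
    have b: "0 \<le> l + 1 / 3 ^ Suc n" "l + 2 / 3 ^ Suc n \<le> 1"
      using subsetD[OF cantor_set_basic(2) 1] subsetD[OF cantor_set_basic(2) 2] unfolding atLeastAtMost_iff by blast+
    fix x assume "x \<in> middle_third n l"
    then have "l + 1 / 3 ^ Suc n < x" "x < l + 2 / 3 ^ Suc n" unfolding middle_third_def greaterThanLessThan_iff by blast+
    then show "x \<in> {0..1}" using b unfolding atLeastAtMost_iff by linarith
  qed
  show "middle_third n l \<in> components ({0..1} - cantor_set)"
    unfolding middle_third_def
  proof (rule component_of_interval[OF 4])
    show "{l + 1 / 3 ^ Suc n<..<l + 2 / 3 ^ Suc n} \<subseteq> {0..1} - cantor_set"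
      using 3 5 unfolding middle_third_def by blast
  qed (use 1 2 in blast)+
  show "Inf (middle_third n l) = l + 1 / 3 ^ Suc n" "Sup (middle_third n l) = l + 2 / 3 ^ Suc n"
    using 4 by (simp_all add: middle_third_def)
qed

lemma middle_third_length:
  "l \<in> cantor_left n \<Longrightarrow> Sup (middle_third n l) - Inf (middle_third n l) = 1 / 3 ^ Suc n"
  using middle_third_facts(7,8)[of l n] by (simp add: field_simps)

lemma outside_cantor_set:
  assumes x: "x \<in> {0..1}" "x \<notin> cantor_set"
  obtains n l where "l \<in> cantor_left n" "x \<in> middle_third n l"
proof -
  have ex: "\<exists>k. x \<notin> cantor_stage k" using x(2) by (auto simp: cantor_set_def)
  \<comment> \<open>At the first stage that misses \<open>x\<close>, the point lies in an interval
    of the stage before, hence in the third removed from it.\<close>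
  define k where "k = (LEAST k. x \<notin> cantor_stage k)"
  have k: "x \<notin> cantor_stage k" unfolding k_def using ex by (rule LeastI_ex)
  have "k \<noteq> 0" using k x(1) by (cases k) auto
  then obtain n where n: "k = Suc n" using not0_implies_Suc by blast
  have "x \<in> cantor_stage n" using not_less_Least[of n "\<lambda>k. x \<notin> cantor_stage k"] n by (simp add: k_def)
  then obtain l where l: "l \<in> cantor_left n" "l \<le> x" "x \<le> l + 1 / 3 ^ n" unfolding cantor_stage_eq by auto
  note L = cantor_left_Suc[OF l(1)]
  have "x \<notin> {l..l + 1 / 3 ^ Suc n}" "x \<notin> {l + 2 / 3 ^ Suc n..l + 2 / 3 ^ Suc n + 1 / 3 ^ Suc n}"
    using k L unfolding n cantor_stage_eq[of "Suc n"] by blast+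
  moreover have "l + 2 / 3 ^ Suc n + 1 / 3 ^ Suc n = l + 1 / 3 ^ n" by (simp add: field_simps)
  ultimately have "x \<in> middle_third n l" using l(2,3) unfolding middle_third_def by auto
  then show ?thesis using that l(1) by blast
qed

lemma components_cantor_complement:
  "components ({0..1} - cantor_set) = {middle_third n l | n l. l \<in> cantor_left n}"
proof (intro equalityI subsetI)
  fix j assume j: "j \<in> components ({0..1} - cantor_set)"
  then obtain x where x: "x \<in> j" using in_components_nonempty by blast
  then have "x \<in> {0..1}" "x \<notin> cantor_set" using in_components_subset[OF j] by auto
  then obtain n l where "l \<in> cantor_left n" "x \<in> middle_third n l" by (rule outside_cantor_set)
  then have "j = middle_third n l" using components_eq_of_common[OF j middle_third_facts(6) x] by blast
  then show "j \<in> {middle_third n l | n l. l \<in> cantor_left n}" using \<open>l \<in> cantor_left n\<close> by blast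
qed (use middle_third_facts(6) in blast)

lemma D_set_eq: "D_set = cantor_set \<union> \<Union>{middle_third n l | n l. even n \<and> l \<in> cantor_left n}"
proof -
  have len: "(\<exists>k::nat. Sup (middle_third n l) - Inf (middle_third n l) = 1 / 3 ^ (2 * k + 1)) \<longleftrightarrow> even n"
    if "l \<in> cantor_left n" for n l
  proof -
    have "Sup (middle_third n l) - Inf (middle_third n l) = 1 / 3 ^ Suc n"
      by (rule middle_third_length[OF that])
    moreover have "1 / (3::real) ^ Suc n = 1 / 3 ^ (2 * k + 1) \<longleftrightarrow> n = 2 * k" for k
    proof -
      have "1 / (3::real) ^ Suc n = 1 / 3 ^ (2 * k + 1) \<longleftrightarrow> (3::real) ^ Suc n = 3 ^ (2 * k + 1)"
        by (simp add: field_simps)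
      also have "\<dots> \<longleftrightarrow> Suc n = 2 * k + 1" by (rule power_inject_exp) simp
      finally show ?thesis by simp
    qed
    ultimately show ?thesis by (auto elim: evenE)
  qed
  have "{j \<in> components ({0..1} - cantor_set). \<exists>k::nat. Sup j - Inf j = 1 / 3 ^ (2 * k + 1)} =
      {middle_third n l | n l. even n \<and> l \<in> cantor_left n}"
    unfolding components_cantor_complement using len by blast
  then show ?thesis by (simp add: D_set_def)
qed

lemma odd_middle_third_disjoint:
  assumes l: "l \<in> cantor_left n" and "odd n"
  shows "middle_third n l \<inter> D_set = {}"
proof (rule ccontr)
  assume "middle_third n l \<inter> D_set \<noteq> {}"
  then obtain x where x: "x \<in> middle_third n l" "x \<in> D_set" by blast
  then have "x \<notin> cantor_set" using middle_third_facts(3)[OF l] by blast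
  then obtain n' l' where n': "even n'" "l' \<in> cantor_left n'" "x \<in> middle_third n' l'"
    using x(2) unfolding D_set_eq by blast
  have eq: "middle_third n l = middle_third n' l'"
    by (rule components_eq_of_common[OF middle_third_facts(6)[OF l] middle_third_facts(6)[OF n'(2)] x(1) n'(3)])
  have "1 / (3::real) ^ Suc n = 1 / 3 ^ Suc n'"
    using middle_third_length[OF l] middle_third_length[OF n'(2)] unfolding eq by (rule trans[OF sym])
  then have "(3::real) ^ Suc n = 3 ^ Suc n'" by (simp add: field_simps)
  then have "Suc n = Suc n'" by (subst (asm) power_inject_exp) simp_all
  then show False using n'(1) assms(2) by simp
qed

lemma D_gaps_eq: "D_gaps = {middle_third n l | n l. even n \<and> l \<in> cantor_left n}"
proof (intro equalityI subsetI)
  have in_gaps: "middle_third n l \<in> D_gaps" if "even n" "l \<in> cantor_left n" for n l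
  proof -
    have "middle_third n l \<subseteq> D_set - cantor_set"
      using that middle_third_facts(3)[OF that(2)] unfolding D_set_eq by blast
    then show ?thesis
      unfolding D_gaps_def middle_third_def
      using middle_third_facts(1,2,4)[OF that(2)] by (intro component_of_interval) simp_all
  qed
  show "j \<in> D_gaps" if "j \<in> {middle_third n l | n l. even n \<and> l \<in> cantor_left n}" for j
    using that in_gaps by blast
  fix j assume j: "j \<in> D_gaps"
  then have jc: "j \<in> components (D_set - cantor_set)" by (simp add: D_gaps_def)
  then obtain x where x: "x \<in> j" using in_components_nonempty by blast
  then have "x \<in> D_set - cantor_set" using in_components_subset[OF jc] by blast
  then obtain n l where n: "even n" "l \<in> cantor_left n" "x \<in> middle_third n l" unfolding D_set_eq by blast
  have "j = middle_third n l"
    using components_eq_of_common[OF jc _ x n(3)] in_gaps[OF n(1,2)] by (simp add: D_gaps_def)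
  then show "j \<in> {middle_third n l | n l. even n \<and> l \<in> cantor_left n}" using n by blast
qed

lemma D_set_bounds: "D_set \<subseteq> {0..1}"
  unfolding D_set_eq using cantor_set_basic(2) middle_third_facts(5) by blast

lemma cantor_sub_D: "cantor_set \<subseteq> D_set"
  by (simp add: D_set_eq)

lemma gap_facts:
  assumes "j \<in> D_gaps"
  shows "Inf j \<in> cantor_set" "Sup j \<in> cantor_set" "j \<inter> cantor_set = {}" "j \<subseteq> D_set"
proof -
  obtain n l where n: "even n" "l \<in> cantor_left n" "j = middle_third n l" using assms unfolding D_gaps_eq by blast
  show "Inf j \<in> cantor_set" "Sup j \<in> cantor_set" "j \<inter> cantor_set = {}"
    using middle_third_facts[OF n(2)] n(3) by simp_all
  show "j \<subseteq> D_set" using n unfolding D_set_eq by blast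
qed

lemma D_set_cases:
  assumes "a \<in> D_set" "a \<notin> cantor_set"
  obtains j where "j \<in> D_gaps" "a \<in> j"
  using assms unfolding D_set_eq D_gaps_eq by blast

lemma D_gaps_disjoint:
  assumes "j \<in> D_gaps" "j' \<in> D_gaps" "x \<in> j" "x \<in> j'" shows "j = j'"
  using assms components_eq_of_common unfolding D_gaps_def by blast

lemma power_third_small:
  fixes d :: real
  assumes "d > 0"
  obtains N where "\<And>n. n \<ge> N \<Longrightarrow> 1 / 3 ^ n < d"
proof -
  obtain N where N: "(1 / 3 :: real) ^ N < d" using real_arch_pow_inv[OF assms, of "1 / 3"] by auto
  have "1 / 3 ^ n < d" if "n \<ge> N" for n
  proof -
    have "(1 / 3 :: real) ^ n \<le> (1 / 3) ^ N" by (rule power_decreasing[OF that]) simp_all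
    then show ?thesis using N by (simp add: power_one_over)
  qed
  then show ?thesis using that by blast
qed

text \<open>The right end of a gap remains a left end point at all later stages. At odd levels
  \<open>k\<close> the third removed next to it is missing from \<open>D_set\<close>;
  \<open>e\<close> is the midpoint of such a third, with \<open>k\<close> chosen large enough for
  \<open>d\<close>.\<close>

lemma cut_right_of_gap:
  assumes "j \<in> D_gaps" "d > 0"
  obtains e where "e \<notin> D_set" "Sup j < e" "e < Sup j + d"
proof -
  obtain n l where n: "even n" "l \<in> cantor_left n" "j = middle_third n l" using assms(1) unfolding D_gaps_eq by blast
  obtain N where N: "\<And>k. k \<ge> N \<Longrightarrow> 1 / 3 ^ k < d" using power_third_small[OF assms(2)] by blast
  define k where "k = 2 * (n + N) + 1"
  have k: "k \<ge> Suc n" "odd k" "k \<ge> N" by (simp_all add: k_def)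
  have S: "Sup j \<in> cantor_left k"
    using cantor_left_mono[OF conjunct2[OF cantor_left_Suc[OF n(2)]] k(1)] middle_third_facts(8)[OF n(2)] n(3) by simp
  define e where "e = Sup j + 1 / 3 ^ Suc k + (1 / 3 ^ Suc k) / 2"
  have p: "(0 :: real) < 1 / 3 ^ Suc k" "2 / 3 ^ Suc k = 2 * (1 / 3 ^ Suc k :: real)" "1 / 3 ^ k = 3 * (1 / 3 ^ Suc k :: real)"
    by simp_all
  define t :: real where "t = 1 / 3 ^ Suc k"
  have "middle_third k (Sup j) = {(Sup j) + t<..<(Sup j) + 2 * t}"
    unfolding middle_third_def p(2) t_def ..
  then have "e \<in> middle_third k (Sup j)"
    using p(1) unfolding e_def t_def[symmetric] by simp
  then have "e \<notin> D_set" using odd_middle_third_disjoint[OF S k(2)] by blast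
  moreover have "Sup j < e" "e < Sup j + d"
    using N[OF k(3)] p(1) unfolding e_def p(3) t_def[symmetric] by simp_all
  ultimately show ?thesis using that by blast
qed

text \<open>Symmetrically, \<open>Inf j\<close> is the right end of a stage interval at each later
  level; its left end point is \<open>Inf j - 1 / 3 ^ k\<close>.\<close>

lemma cut_left_of_gap:
  assumes "j \<in> D_gaps" "d > 0"
  obtains e where "e \<notin> D_set" "e < Inf j" "Inf j - d < e"
proof -
  obtain n l where n: "even n" "l \<in> cantor_left n" "j = middle_third n l" using assms(1) unfolding D_gaps_eq by blast
  obtain N where N: "\<And>k. k \<ge> N \<Longrightarrow> 1 / 3 ^ k < d" using power_third_small[OF assms(2)] by blast
  define k where "k = 2 * (n + N) + 1"
  have k: "k \<ge> Suc n" "odd k" "k \<ge> N" by (simp_all add: k_def)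
  have "Inf j - 1 / 3 ^ Suc n \<in> cantor_left (Suc n)"
    using cantor_left_Suc[OF n(2)] middle_third_facts(7)[OF n(2)] n(3) by simp
  then have S: "Inf j - 1 / 3 ^ k \<in> cantor_left k" by (rule cantor_right_mono[OF _ k(1)])
  define e where "e = Inf j - 1 / 3 ^ k + 1 / 3 ^ Suc k + (1 / 3 ^ Suc k) / 2"
  have p: "(0 :: real) < 1 / 3 ^ Suc k" "2 / 3 ^ Suc k = 2 * (1 / 3 ^ Suc k :: real)" "1 / 3 ^ k = 3 * (1 / 3 ^ Suc k :: real)"
    by simp_all
  define t :: real where "t = 1 / 3 ^ Suc k"
  have "middle_third k (Inf j - 1 / 3 ^ k) = {(Inf j - 1 / 3 ^ k) + t<..<(Inf j - 1 / 3 ^ k) + 2 * t}"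
    unfolding middle_third_def p(2) t_def ..
  then have "e \<in> middle_third k (Inf j - 1 / 3 ^ k)"
    using p(1) unfolding e_def t_def[symmetric] by simp
  then have "e \<notin> D_set" using odd_middle_third_disjoint[OF S k(2)] by blast
  moreover have "e < Inf j" "Inf j - d < e"
    using N[OF k(3)] p(1) unfolding e_def p(3) t_def[symmetric] by simp_all
  ultimately show ?thesis using that by blast
qed

text \<open>The stage interval around \<open>c\<close> at a large even level contains a retained
  middle third.\<close>

lemma gap_near:
  assumes "c \<in> cantor_set" "d > 0"
  obtains j where "j \<in> D_gaps" "c - d < Inf j" "Sup j < c + d"
proof -
  obtain N where N: "\<And>k. k \<ge> N \<Longrightarrow> 1 / 3 ^ k < d" using power_third_small[OF assms(2)] by blast
  define k where "k = 2 * N"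
  have k: "even k" "k \<ge> N" by (simp_all add: k_def)
  have "c \<in> cantor_stage k" using assms(1) by (simp add: cantor_set_def)
  then obtain l where l: "l \<in> cantor_left k" "l \<le> c" "c \<le> l + 1 / 3 ^ k" unfolding cantor_stage_eq by auto
  have p: "(0 :: real) < 1 / 3 ^ Suc k" "2 / 3 ^ Suc k = 2 * (1 / 3 ^ Suc k :: real)" "1 / 3 ^ k = 3 * (1 / 3 ^ Suc k :: real)"
    by simp_all
  have "middle_third k l \<in> D_gaps" unfolding D_gaps_eq using k(1) l(1) by blast
  moreover have "c - d < Inf (middle_third k l)" "Sup (middle_third k l) < c + d"
    unfolding middle_third_facts(7,8)[OF l(1)] using l N[OF k(2)] p by linarith+
  ultimately show ?thesis using that by blast
qed

lemma closed_D_set: "closed D_set"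
proof -
  have "{0..1} - D_set = \<Union>{middle_third n l | n l. odd n \<and> l \<in> cantor_left n}"
  proof (intro equalityI subsetI)
    fix x assume x: "x \<in> {0..1} - D_set"
    then have "x \<in> {0..1}" "x \<notin> cantor_set" using cantor_sub_D by auto
    then obtain n l where l: "l \<in> cantor_left n" "x \<in> middle_third n l" by (rule outside_cantor_set)
    then have "odd n" using x unfolding D_set_eq by blast
    then show "x \<in> \<Union>{middle_third n l | n l. odd n \<and> l \<in> cantor_left n}" using l by blast
  next
    fix x assume "x \<in> \<Union>{middle_third n l | n l. odd n \<and> l \<in> cantor_left n}"
    then obtain n l where "odd n" "l \<in> cantor_left n" "x \<in> middle_third n l" by blast
    then show "x \<in> {0..1} - D_set" using odd_middle_third_disjoint middle_third_facts(5) by blast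
  qed
  then have "open ({0..1} - D_set)" by (auto simp: middle_third_def)
  moreover have "D_set = {0..1} - ({0..1} - D_set)" using D_set_bounds by blast
  ultimately show ?thesis by (metis closed_Diff closed_atLeastAtMost)
qed


section \<open>Cutting D into pieces around retained gaps\<close>

lemma gap_iff:
  assumes "j \<in> D_gaps"
  shows "x \<in> j \<longleftrightarrow> Inf j < x \<and> x < Sup j"
  by (subst gap_interval(2)[OF assms]) simp

text \<open>Reals outside \<open>D_set\<close> cut the model into clopen invariant pieces.\<close>

lemma cut_or_gap_left:
  assumes c: "c \<in> cantor_set" and d: "d > 0"
  shows "(\<exists>e. e \<notin> D_set \<and> c - d < e \<and> e < c) \<or> (\<exists>j\<in>D_gaps. c = Sup j)"
proof (cases "\<exists>e. e \<notin> D_set \<and> c - d < e \<and> e < c")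
  case False
  then have D: "a \<in> D_set" if "c - d < a" "a < c" for a using that by blast
  \<comment> \<open>If another Cantor point is within reach, a retained gap fits between it and
    \<open>c\<close> and has a cut beside it. Otherwise the midpoint \<open>a\<close> lies in a
    retained gap, which can only end at \<open>c\<close>.\<close>
  show ?thesis
  proof (cases "\<exists>c'\<in>cantor_set. c - d < c' \<and> c' < c")
    case True
    then obtain c' where c': "c' \<in> cantor_set" "c - d < c'" "c' < c" by blast
    obtain j where j: "j \<in> D_gaps" "c' - min (c' - (c - d)) (c - c') < Inf j" "Sup j < c' + min (c' - (c - d)) (c - c')"
      using gap_near[OF c'(1), of "min (c' - (c - d)) (c - c')"] c' by auto
    have b: "c - d < Inf j" "Sup j < c" "Inf j < Sup j" using j gap_interval(1)[OF j(1)] by linarith+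
    then have "c - Sup j > 0" by simp
    then obtain e where e: "e \<notin> D_set" "Sup j < e" "e < Sup j + (c - Sup j)" using cut_right_of_gap[OF j(1)] by blast
    then show ?thesis using D[of e] b by auto
  next
    case noC: False
    define a where "a = c - d / 2"
    have a: "c - d < a" "a < c" using d by (simp_all add: a_def)
    then have "a \<in> D_set" "a \<notin> cantor_set" using D noC by auto
    then obtain j where j: "j \<in> D_gaps" "a \<in> j" by (rule D_set_cases)
    have aj: "Inf j < a" "a < Sup j" using gap_iff[OF j(1)] j(2) by auto
    have "Sup j \<le> c"
    proof (rule ccontr)
      assume "\<not> Sup j \<le> c"
      then have "c \<in> j" using gap_iff[OF j(1)] aj a by auto
      then show False using gap_facts(3)[OF j(1)] c by blast
    qed
    moreover have "\<not> Sup j < c" using noC gap_facts(2)[OF j(1)] aj a by force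
    ultimately show ?thesis using j(1) by force
  qed
qed blast

lemma cut_or_gap_right:
  assumes c: "c \<in> cantor_set" and d: "d > 0"
  shows "(\<exists>e. e \<notin> D_set \<and> c < e \<and> e < c + d) \<or> (\<exists>j\<in>D_gaps. c = Inf j)"
proof (cases "\<exists>e. e \<notin> D_set \<and> c < e \<and> e < c + d")
  case False
  then have D: "a \<in> D_set" if "c < a" "a < c + d" for a using that by blast
  show ?thesis
  proof (cases "\<exists>c'\<in>cantor_set. c < c' \<and> c' < c + d")
    case True
    then obtain c' where c': "c' \<in> cantor_set" "c < c'" "c' < c + d" by blast
    obtain j where j: "j \<in> D_gaps" "c' - min (c + d - c') (c' - c) < Inf j" "Sup j < c' + min (c + d - c') (c' - c)"
      using gap_near[OF c'(1), of "min (c + d - c') (c' - c)"] c' by auto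
    have b: "c < Inf j" "Sup j < c + d" "Inf j < Sup j" using j gap_interval(1)[OF j(1)] by linarith+
    then have "Inf j - c > 0" by simp
    then obtain e where e: "e \<notin> D_set" "e < Inf j" "Inf j - (Inf j - c) < e" using cut_left_of_gap[OF j(1)] by blast
    then show ?thesis using D[of e] b by auto
  next
    case noC: False
    define a where "a = c + d / 2"
    have a: "c < a" "a < c + d" using d by (simp_all add: a_def)
    then have "a \<in> D_set" "a \<notin> cantor_set" using D noC by auto
    then obtain j where j: "j \<in> D_gaps" "a \<in> j" by (rule D_set_cases)
    have aj: "Inf j < a" "a < Sup j" using gap_iff[OF j(1)] j(2) by auto
    have "c \<le> Inf j"
    proof (rule ccontr)
      assume "\<not> c \<le> Inf j"
      then have "c \<in> j" using gap_iff[OF j(1)] aj a by auto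
      then show False using gap_facts(3)[OF j(1)] c by blast
    qed
    moreover have "\<not> c < Inf j" using noC gap_facts(1)[OF j(1)] aj a by force
    ultimately show ?thesis using j(1) by force
  qed
qed blast

text \<open>Off \<open>E\<close>, two reals get the same number exactly if no element of
  \<open>E\<close> lies between them; the count numbers the pieces from left to right.\<close>

definition piece :: "real set \<Rightarrow> real \<Rightarrow> nat" where
  "piece E a = card {e \<in> E. e < a}"

lemma piece_mono: "finite E \<Longrightarrow> a \<le> b \<Longrightarrow> piece E a \<le> piece E b"
  unfolding piece_def by (intro card_mono) auto

lemma piece_less:
  assumes "finite E" "e \<in> E" "a \<le> e" "e < b"
  shows "piece E a < piece E b"
proof -
  have "{e \<in> E. e < a} \<subseteq> {e \<in> E. e < b}" using assms(3,4) by auto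
  moreover have "e \<in> {e \<in> E. e < b}" "e \<notin> {e \<in> E. e < a}" using assms(2-4) by auto
  ultimately have "{e \<in> E. e < a} \<subset> {e \<in> E. e < b}" by blast
  then show ?thesis unfolding piece_def using assms(1) by (intro psubset_card_mono) simp_all
qed

lemma piece_eqI:
  assumes "\<And>e. e \<in> E \<Longrightarrow> e < a \<longleftrightarrow> e < b"
  shows "piece E a = piece E b"
proof -
  have "{e \<in> E. e < a} = {e \<in> E. e < b}" using assms by auto
  then show ?thesis by (simp add: piece_def)
qed

lemma piece_eqD:
  assumes "finite E" "piece E a = piece E b" "e \<in> E"
  shows "e < a \<longleftrightarrow> e < b"
  using piece_less[OF assms(1,3), of a b] piece_less[OF assms(1,3), of b a] assms(2) by force

text \<open>Cuts avoid \<open>D_set\<close>, hence every retained gap together with its ends, so a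
  gap is never split.\<close>

lemma piece_gap:
  assumes "E \<inter> D_set = {}" "j \<in> D_gaps" "Inf j \<le> a" "a \<le> Sup j"
  shows "piece E a = piece E (Inf j)"
proof (rule piece_eqI)
  fix e assume "e \<in> E"
  then have "e \<notin> j" "e \<noteq> Inf j" "e \<noteq> Sup j"
    using assms(1) gap_facts[OF assms(2)] cantor_sub_D by blast+
  then have "\<not> (Inf j < e \<and> e < Sup j)" using gap_iff[OF assms(2)] by blast
  then show "e < a \<longleftrightarrow> e < Inf j" using assms(3,4) \<open>e \<noteq> Inf j\<close> \<open>e \<noteq> Sup j\<close> by linarith
qed

lemma cantor_point_in_piece:
  assumes "E \<inter> D_set = {}" "a \<in> D_set"
  obtains c where "c \<in> cantor_set" "piece E c = piece E a"
proof (cases "a \<in> cantor_set")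
  case False
  then obtain j where j: "j \<in> D_gaps" "a \<in> j" using assms(2) D_set_cases by blast
  then have "Inf j \<le> a" "a \<le> Sup j" using gap_iff[OF j(1)] by auto
  then show ?thesis using piece_gap[OF assms(1) j(1)] gap_facts(1)[OF j(1)] that by metis
qed (use that in blast)

lemma piece_local:
  assumes "finite E" "c \<notin> E"
  obtains d where "d > 0" "\<And>a. \<bar>a - c\<bar> < d \<Longrightarrow> piece E a = piece E c"
proof -
  define d where "d = Min (insert 1 ((\<lambda>e. \<bar>e - c\<bar>) ` E))"
  have fin: "finite (insert 1 ((\<lambda>e. \<bar>e - c\<bar>) ` E))" using assms(1) by simp
  have "d > 0" unfolding d_def using fin assms(2) by (subst Min_gr_iff) auto
  moreover have "piece E a = piece E c" if "\<bar>a - c\<bar> < d" for a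
  proof (rule piece_eqI)
    fix e assume "e \<in> E"
    then have "d \<le> \<bar>e - c\<bar>" unfolding d_def using fin by (intro Min_le) auto
    then show "e < a \<longleftrightarrow> e < c" using that by linarith
  qed
  ultimately show ?thesis using that by blast
qed

text \<open>The gap \<open>j\<close> is the bar of piece \<open>i\<close>; the two loops are \<open>\<delta>\<close>-close to the ends of \<open>j\<close>.\<close>

definition bar_of :: "real set \<Rightarrow> real \<Rightarrow> nat \<Rightarrow> real set \<Rightarrow> bool" where
  "bar_of E \<delta> i j \<longleftrightarrow> j \<in> D_gaps \<and> piece E (Inf j) = i \<and>
     (\<forall>b\<in>D_set. piece E b = i \<longrightarrow> (b \<le> Inf j \<longrightarrow> Inf j - b < \<delta>) \<and> (Sup j \<le> b \<longrightarrow> b - Sup j < \<delta>))"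

text \<open>In a piece shorter than \<open>\<delta>\<close> any retained gap can be the bar, and one
  exists near each Cantor point.\<close>

lemma short_piece_bar:
  assumes E: "finite E" "E \<inter> D_set = {}" and a: "a \<in> D_set"
    and short: "\<And>b b'. b \<in> D_set \<Longrightarrow> b' \<in> D_set \<Longrightarrow> piece E b = piece E a \<Longrightarrow> piece E b' = piece E a \<Longrightarrow> b' - b < \<delta>"
  shows "\<exists>j. bar_of E \<delta> (piece E a) j"
proof -
  obtain c where c: "c \<in> cantor_set" "piece E c = piece E a" using cantor_point_in_piece[OF E(2) a] .
  have "c \<notin> E" using c(1) E(2) cantor_sub_D by blast
  then obtain d where d: "d > 0" "\<And>x. \<bar>x - c\<bar> < d \<Longrightarrow> piece E x = piece E c" using piece_local[OF E(1)] by blast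
  obtain j where j: "j \<in> D_gaps" "c - d < Inf j" "Sup j < c + d" using gap_near[OF c(1) d(1)] .
  have "\<bar>Inf j - c\<bar> < d" "\<bar>Sup j - c\<bar> < d" using j gap_interval(1)[OF j(1)] by linarith+
  then have p: "piece E (Inf j) = piece E a" "piece E (Sup j) = piece E a" using d(2) c(2) by auto
  have "Inf j \<in> D_set" "Sup j \<in> D_set" using gap_facts(1,2)[OF j(1)] cantor_sub_D by blast+
  then have "bar_of E \<delta> (piece E a) j" unfolding bar_of_def using j(1) p short by blast
  then show ?thesis by blast
qed

text \<open>Either \<open>c\<close> has cuts within half of \<open>\<delta>\<close> on both sides,
  or it is an end of a retained gap, which may be long. In the second case the cuts are placed just
  outside that gap.\<close>

lemma good_interval:
  assumes c: "c \<in> cantor_set" and \<delta>: "\<delta> > 0"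
  shows "\<exists>e e'. e \<notin> D_set \<and> e' \<notin> D_set \<and> e < c \<and> c < e' \<and> (e' - e < \<delta> \<or>
    (\<exists>j\<in>D_gaps. e < Inf j \<and> Sup j < e' \<and> Inf j - e < \<delta> \<and> e' - Sup j < \<delta>))"
proof -
  have gap: ?thesis if j: "j \<in> D_gaps" and "c = Sup j \<or> c = Inf j" for j
  proof -
    obtain e where e: "e \<notin> D_set" "e < Inf j" "Inf j - \<delta> < e" using cut_left_of_gap[OF j \<delta>] .
    obtain e' where e': "e' \<notin> D_set" "Sup j < e'" "e' < Sup j + \<delta>" using cut_right_of_gap[OF j \<delta>] .
    show ?thesis
      by (rule exI[of _ e], rule exI[of _ e']) (use that e e' gap_interval(1)[OF j] in auto)
  qed
  have d2: "\<delta> / 2 > 0" using \<delta> by simp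
  consider j where "j \<in> D_gaps" "c = Sup j \<or> c = Inf j"
    | e e' where "e \<notin> D_set" "c - \<delta> / 2 < e" "e < c" "e' \<notin> D_set" "c < e'" "e' < c + \<delta> / 2"
    using cut_or_gap_left[OF c d2] cut_or_gap_right[OF c d2] by blast
  then show ?thesis
  proof cases
    case 1 then show ?thesis by (rule gap)
  next
    case 2
    then show ?thesis by (intro exI[of _ e] exI[of _ e']) auto
  qed
qed

text \<open>Finitely many good intervals cover the Cantor set by compactness; all their end points
  are used as cuts, and each piece then lies inside one of the intervals.\<close>

lemma cuts_with_bars:
  assumes \<delta>: "\<delta> > 0"
  obtains E where "finite E" "E \<inter> D_set = {}" "\<And>a. a \<in> D_set \<Longrightarrow> \<exists>j. bar_of E \<delta> (piece E a) j"
proof -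
  define G where "G e e' \<longleftrightarrow> e' - e < \<delta> \<or>
    (\<exists>j\<in>D_gaps. e < Inf j \<and> Sup j < e' \<and> Inf j - e < \<delta> \<and> e' - Sup j < \<delta>)" for e e'
  have "\<forall>c\<in>cantor_set. \<exists>z. fst z \<notin> D_set \<and> snd z \<notin> D_set \<and> fst z < c \<and> c < snd z \<and> G (fst z) (snd z)"
  proof
    fix c assume "c \<in> cantor_set"
    from good_interval[OF this \<delta>] obtain e e' where "e \<notin> D_set" "e' \<notin> D_set" "e < c" "c < e'" "G e e'"
      unfolding G_def by blast
    then show "\<exists>z. fst z \<notin> D_set \<and> snd z \<notin> D_set \<and> fst z < c \<and> c < snd z \<and> G (fst z) (snd z)"
      by (intro exI[of _ "(e, e')"]) simp
  qed
  from bchoice[OF this] obtain z where z: "\<And>c. c \<in> cantor_set \<Longrightarrow> fst (z c) \<notin> D_set \<and> snd (z c) \<notin> D_set \<and>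
      fst (z c) < c \<and> c < snd (z c) \<and> G (fst (z c)) (snd (z c))" by blast
  from compact_cantor_set obtain K where K: "K \<subseteq> cantor_set" "finite K" "cantor_set \<subseteq> (\<Union>c\<in>K. {fst (z c)<..<snd (z c)})"
    by (rule compactE_image[of cantor_set cantor_set "\<lambda>c. {fst (z c)<..<snd (z c)}"]) (use z in auto)
  define E where "E = (\<lambda>c. fst (z c)) ` K \<union> (\<lambda>c. snd (z c)) ` K"
  have E: "finite E" "E \<inter> D_set = {}" unfolding E_def using K z by auto
  have "\<exists>j. bar_of E \<delta> (piece E a) j" if a: "a \<in> D_set" for a
  proof -
    obtain c0 where c0: "c0 \<in> cantor_set" "piece E c0 = piece E a" using cantor_point_in_piece[OF E(2) a] .
    then obtain c where c: "c \<in> K" "fst (z c) < c0" "c0 < snd (z c)" using K(3) by auto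
    have zE: "fst (z c) \<in> E" "snd (z c) \<in> E" using c(1) by (auto simp: E_def)
    have in_int: "fst (z c) < b \<and> b < snd (z c)" if b: "b \<in> D_set" "piece E b = piece E a" for b
    proof -
      have e: "piece E b = piece E c0" using b c0 by simp
      have "fst (z c) < b" using piece_eqD[OF E(1) e zE(1)] c(2) by simp
      moreover have "\<not> snd (z c) < b" using piece_eqD[OF E(1) e zE(2)] c(3) by simp
      moreover have "snd (z c) \<noteq> b" using b(1) zE(2) E(2) by blast
      ultimately show ?thesis by linarith
    qed
    have "G (fst (z c)) (snd (z c))" using z K(1) c(1) by blast
    then consider "snd (z c) - fst (z c) < \<delta>"
      | j where "j \<in> D_gaps" "fst (z c) < Inf j" "Sup j < snd (z c)" "Inf j - fst (z c) < \<delta>" "snd (z c) - Sup j < \<delta>"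
      unfolding G_def by blast
    then show ?thesis
    proof cases
      case 1
      show ?thesis
      proof (rule short_piece_bar[OF E a])
        fix b b' assume "b \<in> D_set" "b' \<in> D_set" "piece E b = piece E a" "piece E b' = piece E a"
        then show "b' - b < \<delta>" using in_int[of b] in_int[of b'] 1 by linarith
      qed
    next
      case 2
      show ?thesis
      proof (cases "piece E (Inf j) = piece E a")
        case True
        have "bar_of E \<delta> (piece E a) j"
          unfolding bar_of_def
        proof (intro conjI ballI impI)
          fix b assume b: "b \<in> D_set" "piece E b = piece E a"
          show "b - Sup j < \<delta>" "Inf j - b < \<delta>" using in_int[OF b] 2 by linarith+
        qed (use 2 True in auto)
        then show ?thesis by blast
      next
        \<comment> \<open>A further cut has separated the piece from \<open>j\<close>. It then lies
          entirely on one side of \<open>j\<close>, where the interval is shorter than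
          \<open>\<delta>\<close>.\<close>
        case False
        show ?thesis
        proof (rule short_piece_bar[OF E a])
          have side: "(b < Inf j \<and> a < Inf j) \<or> (Sup j < b \<and> Sup j < a)" if b: "b \<in> D_set" "piece E b = piece E a" for b
          proof -
            have nb: "\<not> (Inf j \<le> x \<and> x \<le> Sup j)" if "piece E x = piece E a" for x
              using piece_gap[OF E(2) 2(1), of x] that False by auto
            have "x < Inf j \<or> Sup j < x" if "piece E x = piece E a" for x using nb[OF that] by linarith
            note s = this[OF b(2)] this[OF refl]
            have no: "\<not> (x < Inf j \<and> Sup j < y)" if "piece E x = piece E a" "piece E y = piece E a" for x y
            proof
              assume xy: "x < Inf j \<and> Sup j < y"
              have "piece E x \<le> piece E (Inf j)" "piece E (Inf j) \<le> piece E y"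
                using piece_mono[OF E(1)] xy gap_interval(1)[OF 2(1)] by auto
              then show False using that False by simp
            qed
            show ?thesis using s no[OF b(2) refl] no[OF refl b(2)] by blast
          qed
          fix b b' assume b: "b \<in> D_set" "b' \<in> D_set" "piece E b = piece E a" "piece E b' = piece E a"
          show "b' - b < \<delta>"
            using side[OF b(1,3)] side[OF b(2,4)] in_int[OF b(1,3)] in_int[OF b(2,4)] 2 gap_interval(1)[OF 2(1)] by linarith
        qed
      qed
    qed
  qed
  then show ?thesis using that E by blast
qed

lemma gap_left_in_piece:
  assumes E: "finite E" "E \<inter> D_set = {}" and j: "j \<in> D_gaps"
  obtains \<alpha> j' where "\<alpha> \<notin> D_set" "\<alpha> < Inf j" "piece E \<alpha> = piece E (Inf j)"
    "j' \<in> D_gaps" "Sup j' < \<alpha>" "piece E (Inf j') = piece E (Inf j)"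
proof -
  have "Inf j \<notin> E" using gap_facts(1)[OF j] cantor_sub_D E(2) by blast
  then obtain d where d: "d > 0" "\<And>a. \<bar>a - Inf j\<bar> < d \<Longrightarrow> piece E a = piece E (Inf j)" using piece_local[OF E(1)] by blast
  \<comment> \<open>Bounding \<open>d'\<close> by the length of \<open>j\<close> as well keeps
    \<open>j'\<close> from being \<open>j\<close> or from lying to its right.\<close>
  define d' where "d' = min d (Sup j - Inf j)"
  have "d' > 0" using d(1) gap_interval(1)[OF j] by (simp add: d'_def)
  then obtain j' where j': "j' \<in> D_gaps" "Inf j - d' < Inf j'" "Sup j' < Inf j + d'" using gap_near[OF gap_facts(1)[OF j]] by blast
  have i: "Inf j' < Sup j'" "Inf j < Sup j"
    using gap_interval(1)[OF j'(1)] gap_interval(1)[OF j] by auto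
  have le: "Sup j' \<le> Inf j"
  proof (rule ccontr)
    assume n: "\<not> Sup j' \<le> Inf j"
    define x where "x = (max (Inf j) (Inf j') + Sup j') / 2"
    have x: "Inf j < x" "Inf j' < x" "x < Sup j'" using i(1) n by (auto simp: x_def max_def field_simps)
    have sj: "Sup j' < Sup j" using j'(3) by (simp add: d'_def)
    have "x \<in> j'" using x gap_iff[OF j'(1)] by simp
    have "x \<in> j" using x sj gap_iff[OF j] by simp
    then have "j = j'" using D_gaps_disjoint[OF j j'(1) _ \<open>x \<in> j'\<close>] by blast
    then show False using sj by simp
  qed
  \<comment> \<open>Two retained gaps never touch: cuts accumulate at the right end of
    \<open>j'\<close>, and one of them would fall inside \<open>j\<close>.\<close>
  have ne: "Sup j' \<noteq> Inf j"
  proof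
    assume eq: "Sup j' = Inf j"
    obtain e where e: "e \<notin> D_set" "Sup j' < e" "e < Sup j' + (Sup j - Inf j)"
      using cut_right_of_gap[OF j'(1), of "Sup j - Inf j"] i(2) by auto
    then have "e \<in> j" using eq gap_iff[OF j] by simp
    then show False using gap_facts(4)[OF j] \<open>e \<notin> D_set\<close> by blast
  qed
  then obtain \<alpha> where \<alpha>: "\<alpha> \<notin> D_set" "\<alpha> < Inf j" "Inf j - (Inf j - Sup j') < \<alpha>"
    using cut_left_of_gap[OF j, of "Inf j - Sup j'"] le by auto
  have dd: "d' \<le> d" by (simp add: d'_def)
  have "piece E \<alpha> = piece E (Inf j)" by (rule d(2)) (use \<alpha> j' i(1) dd in linarith)
  moreover have "piece E (Inf j') = piece E (Inf j)" by (rule d(2)) (use le j' i(1) dd in linarith)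
  moreover have "Sup j' < \<alpha>" using \<alpha>(3) by simp
  ultimately show ?thesis using that \<alpha>(1,2) j'(1) by blast
qed

lemma gap_right_in_piece:
  assumes E: "finite E" "E \<inter> D_set = {}" and j: "j \<in> D_gaps"
  obtains \<beta> j' where "\<beta> \<notin> D_set" "Sup j < \<beta>" "piece E \<beta> = piece E (Inf j)"
    "j' \<in> D_gaps" "\<beta> < Inf j'" "piece E (Inf j') = piece E (Inf j)"
proof -
  have S: "piece E (Sup j) = piece E (Inf j)" using piece_gap[OF E(2) j, of "Sup j"] gap_interval(1)[OF j] by simp
  have "Sup j \<notin> E" using gap_facts(2)[OF j] cantor_sub_D E(2) by blast
  then obtain d where d: "d > 0" "\<And>a. \<bar>a - Sup j\<bar> < d \<Longrightarrow> piece E a = piece E (Sup j)" using piece_local[OF E(1)] by blast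
  define d' where "d' = min d (Sup j - Inf j)"
  have "d' > 0" using d(1) gap_interval(1)[OF j] by (simp add: d'_def)
  then obtain j' where j': "j' \<in> D_gaps" "Sup j - d' < Inf j'" "Sup j' < Sup j + d'" using gap_near[OF gap_facts(2)[OF j]] by blast
  have i: "Inf j' < Sup j'" "Inf j < Sup j"
    using gap_interval(1)[OF j'(1)] gap_interval(1)[OF j] by auto
  have le: "Sup j \<le> Inf j'"
  proof (rule ccontr)
    assume n: "\<not> Sup j \<le> Inf j'"
    define x where "x = (min (Sup j) (Sup j') + Inf j') / 2"
    have x: "Inf j' < x" "x < Sup j'" "x < Sup j" using i(1) n by (auto simp: x_def min_def field_simps)
    have sj: "Inf j < Inf j'" using j'(2) by (simp add: d'_def)
    have "x \<in> j'" using x gap_iff[OF j'(1)] by simp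
    moreover have "x \<in> j" using x sj gap_iff[OF j] by simp
    ultimately have "j = j'" using D_gaps_disjoint[OF j j'(1)] by blast
    then show False using sj by simp
  qed
  have ne: "Inf j' \<noteq> Sup j"
  proof
    assume eq: "Inf j' = Sup j"
    obtain e where e: "e \<notin> D_set" "e < Inf j'" "Inf j' - (Sup j - Inf j) < e"
      using cut_left_of_gap[OF j'(1), of "Sup j - Inf j"] i(2) by auto
    then have "Inf j < e" "e < Sup j" using eq by simp_all
    then have "e \<in> j" using gap_iff[OF j] by simp
    then show False using gap_facts(4)[OF j] \<open>e \<notin> D_set\<close> by blast
  qed
  then obtain \<beta> where \<beta>: "\<beta> \<notin> D_set" "Sup j < \<beta>" "\<beta> < Sup j + (Inf j' - Sup j)"
    using cut_right_of_gap[OF j, of "Inf j' - Sup j"] le by auto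
  have dd: "d' \<le> d" by (simp add: d'_def)
  have "piece E \<beta> = piece E (Sup j)" by (rule d(2)) (use \<beta> j' i(1) dd in linarith)
  moreover have "piece E (Inf j') = piece E (Sup j)" by (rule d(2)) (use le j' i(1) dd in linarith)
  moreover have "\<beta> < Inf j'" using \<beta>(3) by simp
  ultimately show ?thesis using that \<beta>(1,2) j'(1) S by auto
qed

text \<open>Cutting every piece on both sides of its bar yields, next to each end of the bar of a piece,
  a whole piece that is \<open>\<delta>\<close>-close to that end.\<close>

lemma cuts_with_neighbours:
  assumes \<delta>: "\<delta> > 0"
  obtains E where "finite E" "E \<inter> D_set = {}"
    "\<And>a. a \<in> D_set \<Longrightarrow> \<exists>j. bar_of E \<delta> (piece E a) j \<and>
      (\<exists>c\<in>D_set. \<forall>b\<in>D_set. piece E b = piece E c \<longrightarrow> \<bar>b - Inf j\<bar> < \<delta>) \<and>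
      (\<exists>c\<in>D_set. \<forall>b\<in>D_set. piece E b = piece E c \<longrightarrow> \<bar>b - Sup j\<bar> < \<delta>)"
proof -
  obtain F where F: "finite F" "F \<inter> D_set = {}" "\<And>a. a \<in> D_set \<Longrightarrow> \<exists>j. bar_of F \<delta> (piece F a) j"
    by (rule cuts_with_bars[OF \<delta>]) (rule that | assumption)+
  define I where "I = piece F ` D_set"
  have finI: "finite I"
  proof -
    have "I \<subseteq> {..card F}" unfolding I_def piece_def using F(1) by (auto intro!: card_mono)
    then show ?thesis using finite_subset by blast
  qed
  have "\<forall>i\<in>I. \<exists>j. bar_of F \<delta> i j" using F(3) by (auto simp: I_def)
  from bchoice[OF this] obtain J where J: "\<And>i. i \<in> I \<Longrightarrow> bar_of F \<delta> i (J i)" by blast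
  have Jg: "J i \<in> D_gaps" "piece F (Inf (J i)) = i" if "i \<in> I" for i using J[OF that] by (simp_all add: bar_of_def)
  have Jw: "Inf (J i) - b < \<delta>" if "i \<in> I" "b \<in> D_set" "piece F b = i" "b \<le> Inf (J i)" for i b
    using J[OF that(1)] that(2-) by (auto simp: bar_of_def)
  have Jw': "b - Sup (J i) < \<delta>" if "i \<in> I" "b \<in> D_set" "piece F b = i" "Sup (J i) \<le> b" for i b
    using J[OF that(1)] that(2-) by (auto simp: bar_of_def)
  have "\<forall>i\<in>I. \<exists>z. fst z \<notin> D_set \<and> fst z < Inf (J i) \<and> piece F (fst z) = i \<and>
      snd z \<in> D_gaps \<and> Sup (snd z) < fst z \<and> piece F (Inf (snd z)) = i"
  proof
    fix i assume i: "i \<in> I"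
    obtain \<alpha> j' where "\<alpha> \<notin> D_set" "\<alpha> < Inf (J i)" "piece F \<alpha> = piece F (Inf (J i))"
      "j' \<in> D_gaps" "Sup j' < \<alpha>" "piece F (Inf j') = piece F (Inf (J i))"
      using gap_left_in_piece[OF F(1,2) Jg(1)[OF i]] .
    then show "\<exists>z. fst z \<notin> D_set \<and> fst z < Inf (J i) \<and> piece F (fst z) = i \<and>
      snd z \<in> D_gaps \<and> Sup (snd z) < fst z \<and> piece F (Inf (snd z)) = i"
      using Jg(2)[OF i] by (intro exI[of _ "(\<alpha>, j')"]) simp
  qed
  from bchoice[OF this] obtain z where z: "\<And>i. i \<in> I \<Longrightarrow> fst (z i) \<notin> D_set \<and> fst (z i) < Inf (J i) \<and>
      piece F (fst (z i)) = i \<and> snd (z i) \<in> D_gaps \<and> Sup (snd (z i)) < fst (z i) \<and> piece F (Inf (snd (z i))) = i"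
    by blast
  have "\<forall>i\<in>I. \<exists>z. fst z \<notin> D_set \<and> Sup (J i) < fst z \<and> piece F (fst z) = i \<and>
      snd z \<in> D_gaps \<and> fst z < Inf (snd z) \<and> piece F (Inf (snd z)) = i"
  proof
    fix i assume i: "i \<in> I"
    obtain \<beta> j' where "\<beta> \<notin> D_set" "Sup (J i) < \<beta>" "piece F \<beta> = piece F (Inf (J i))"
      "j' \<in> D_gaps" "\<beta> < Inf j'" "piece F (Inf j') = piece F (Inf (J i))"
      using gap_right_in_piece[OF F(1,2) Jg(1)[OF i]] .
    then show "\<exists>z. fst z \<notin> D_set \<and> Sup (J i) < fst z \<and> piece F (fst z) = i \<and>
      snd z \<in> D_gaps \<and> fst z < Inf (snd z) \<and> piece F (Inf (snd z)) = i"
      using Jg(2)[OF i] by (intro exI[of _ "(\<beta>, j')"]) simp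
  qed
  from bchoice[OF this] obtain w where w: "\<And>i. i \<in> I \<Longrightarrow> fst (w i) \<notin> D_set \<and> Sup (J i) < fst (w i) \<and>
      piece F (fst (w i)) = i \<and> snd (w i) \<in> D_gaps \<and> fst (w i) < Inf (snd (w i)) \<and> piece F (Inf (snd (w i))) = i"
    by blast
  define \<alpha> where "\<alpha> i = fst (z i)" for i
  define \<beta> where "\<beta> i = fst (w i)" for i
  define jl where "jl i = snd (z i)" for i
  define jr where "jr i = snd (w i)" for i
  note z = z[folded \<alpha>_def jl_def]
  note w = w[folded \<beta>_def jr_def]
  define E where "E = F \<union> \<alpha> ` I \<union> \<beta> ` I"
  have E: "finite E" "E \<inter> D_set = {}" unfolding E_def using F finI z w by auto
  have old: "piece F a = piece F b" if "piece E a = piece E b" for a b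
    by (rule piece_eqI) (use piece_eqD[OF E(1) that] in \<open>auto simp: E_def\<close>)
  \<comment> \<open>A new cut made inside another piece of \<open>F\<close> lies on the same side of
    all points of piece \<open>i\<close>, so only \<open>\<alpha> i\<close> and
    \<open>\<beta> i\<close> subdivide piece \<open>i\<close>.\<close>
  have new: "piece E a = piece E b"
    if ab: "piece F a = i" "piece F b = i" and i: "i \<in> I" and s: "\<alpha> i < a \<longleftrightarrow> \<alpha> i < b" "\<beta> i < a \<longleftrightarrow> \<beta> i < b" for a b i
  proof (rule piece_eqI)
    have far1: "e < y" if "e < x" "piece F x = i" "piece F y = i" "piece F e \<noteq> i" for e x y
    proof (rule ccontr)
      assume "\<not> e < y"
      then have "piece F y \<le> piece F e" "piece F e \<le> piece F x" using piece_mono[OF F(1)] that(1) by auto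
      then show False using that by simp
    qed
    have far: "e < a \<longleftrightarrow> e < b" if "piece F e \<noteq> i" for e
      using far1 ab that by blast
    fix e assume "e \<in> E"
    then consider "e \<in> F" | k where "k \<in> I" "e = \<alpha> k" | k where "k \<in> I" "e = \<beta> k" unfolding E_def by blast
    then show "e < a \<longleftrightarrow> e < b"
    proof cases
      case 1 then show ?thesis using piece_eqD[OF F(1)] ab by metis
    next
      case 2 then show ?thesis using far[of e] z[OF 2(1)] s(1) by (cases "k = i") auto
    next
      case 3 then show ?thesis using far[of e] w[OF 3(1)] s(2) by (cases "k = i") auto
    qed
  qed
  have sides: "(\<alpha> i < b \<longleftrightarrow> \<alpha> i < a) \<and> (\<beta> i < b \<longleftrightarrow> \<beta> i < a)" if "piece E b = piece E a" "i \<in> I" for a b i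
    using piece_eqD[OF E(1) that(1), of "\<alpha> i"] piece_eqD[OF E(1) that(1), of "\<beta> i"] that(2) by (auto simp: E_def)
  have gD: "Inf j \<in> D_set" "Sup j \<in> D_set" if "j \<in> D_gaps" for j
    using gap_facts(1,2)[OF that] cantor_sub_D by blast+
  have "\<exists>j. bar_of E \<delta> (piece E a) j \<and>
      (\<exists>c\<in>D_set. \<forall>b\<in>D_set. piece E b = piece E c \<longrightarrow> \<bar>b - Inf j\<bar> < \<delta>) \<and>
      (\<exists>c\<in>D_set. \<forall>b\<in>D_set. piece E b = piece E c \<longrightarrow> \<bar>b - Sup j\<bar> < \<delta>)" if a: "a \<in> D_set" for a
  proof -
    define i where "i = piece F a"
    have i: "i \<in> I" using a by (simp add: i_def I_def)
    note zi = z[OF i] and wi = w[OF i] and Ji = Jg[OF i]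
    have Jlt: "Inf (J i) < Sup (J i)" by (rule gap_interval(1)[OF Ji(1)])
    have jlt: "Inf (jl i) < Sup (jl i)" "Inf (jr i) < Sup (jr i)" using gap_interval(1) zi wi by blast+
    have ord: "Sup (jl i) < \<alpha> i" "\<alpha> i < Inf (J i)" "Sup (J i) < \<beta> i" "\<beta> i < Inf (jr i)"
      using zi wi by blast+
    have ai: "piece F a = i" by (simp add: i_def)
    have Fi: "piece F (Inf (jl i)) = i" "piece F (Inf (jr i)) = i" "piece F (Inf (J i)) = i" using zi wi Ji by blast+
    have same: "piece E x = piece E a" if x: "piece F x = i"
      and c: "x < \<alpha> i \<and> a < \<alpha> i \<or> \<beta> i < x \<and> \<beta> i < a \<or> \<alpha> i < x \<and> x < \<beta> i \<and> \<alpha> i < a \<and> a < \<beta> i" for x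
    proof (rule new[OF x ai i])
      show "\<alpha> i < x \<longleftrightarrow> \<alpha> i < a" "\<beta> i < x \<longleftrightarrow> \<beta> i < a" using c ord Jlt by (elim disjE; linarith)+
    qed
    have left: "b < Inf (J i) \<and> Inf (J i) - b < \<delta>" if b: "b \<in> D_set" "piece E b = piece E (Inf (jl i))" for b
    proof -
      have "piece F b = i" using old[OF b(2)] zi by simp
      moreover have "b < Inf (J i)" using sides[OF b(2) i] zi jlt by linarith
      ultimately show ?thesis using Jw[OF i b(1)] by simp
    qed
    have right: "Sup (J i) < b \<and> b - Sup (J i) < \<delta>" if b: "b \<in> D_set" "piece E b = piece E (Inf (jr i))" for b
    proof -
      have "piece F b = i" using old[OF b(2)] wi by simp
      moreover have "Sup (J i) < b" using sides[OF b(2) i] wi by linarith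
      ultimately show ?thesis using Jw'[OF i b(1)] by simp
    qed
    \<comment> \<open>The two outer pieces are short, take \<open>jl i\<close> or
      \<open>jr i\<close> as bar and serve as their own neighbours. The middle piece keeps the bar
      \<open>J i\<close> and has the outer ones as neighbours.\<close>
    consider "a < \<alpha> i" | "\<beta> i < a" | "\<alpha> i < a" "a < \<beta> i" | "a = \<alpha> i" | "a = \<beta> i" by linarith
    then show ?thesis
    proof cases
      case 1
      have pe: "piece E (Inf (jl i)) = piece E a" by (rule same[OF Fi(1)]) (use 1 ord jlt in linarith)
      have pS: "piece E (Sup (jl i)) = piece E a" using piece_gap[OF E(2), of "jl i" "Sup (jl i)"] zi jlt pe by simp
      have inS: "Sup (jl i) < Inf (J i) \<and> Inf (J i) - Sup (jl i) < \<delta>" using left[of "Sup (jl i)"] gD zi pS pe by simp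
      have inI: "Inf (jl i) < Inf (J i) \<and> Inf (J i) - Inf (jl i) < \<delta>" using left[of "Inf (jl i)"] gD zi by simp
      have cl: "\<bar>b - Inf (jl i)\<bar> < \<delta> \<and> \<bar>b - Sup (jl i)\<bar> < \<delta>" if "b \<in> D_set" "piece E b = piece E a" for b
        using left[of b] that pe inS inI by auto
      have "bar_of E \<delta> (piece E a) (jl i)"
        unfolding bar_of_def using zi pe cl by (auto simp: abs_less_iff)
      then show ?thesis using cl a by blast
    next
      case 2
      have pe: "piece E (Inf (jr i)) = piece E a" by (rule same[OF Fi(2)]) (use 2 ord in linarith)
      have pS: "piece E (Sup (jr i)) = piece E a" using piece_gap[OF E(2), of "jr i" "Sup (jr i)"] wi jlt pe by simp
      have inS: "Sup (J i) < Sup (jr i) \<and> Sup (jr i) - Sup (J i) < \<delta>" using right[of "Sup (jr i)"] gD wi pS pe by simp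
      have inI: "Sup (J i) < Inf (jr i) \<and> Inf (jr i) - Sup (J i) < \<delta>" using right[of "Inf (jr i)"] gD wi by simp
      have cl: "\<bar>b - Inf (jr i)\<bar> < \<delta> \<and> \<bar>b - Sup (jr i)\<bar> < \<delta>" if "b \<in> D_set" "piece E b = piece E a" for b
        using right[of b] that pe inS inI by auto
      have "bar_of E \<delta> (piece E a) (jr i)"
        unfolding bar_of_def using wi pe cl by (auto simp: abs_less_iff)
      then show ?thesis using cl a by blast
    next
      case 3
      have pe: "piece E (Inf (J i)) = piece E a" by (rule same[OF Fi(3)]) (use 3 ord Jlt in linarith)
      have "bar_of E \<delta> (piece E a) (J i)"
        unfolding bar_of_def
      proof (intro conjI ballI impI)
        fix b assume b: "b \<in> D_set" "piece E b = piece E a"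
        have "piece F b = i" using old[OF b(2)] by (simp add: i_def)
        then show "Inf (J i) - b < \<delta>" if "b \<le> Inf (J i)" using Jw[OF i b(1) _ that] by simp
        show "b - Sup (J i) < \<delta>" if "Sup (J i) \<le> b" using Jw'[OF i b(1) \<open>piece F b = i\<close> that] .
      qed (use Ji pe in auto)
      moreover have "\<forall>b\<in>D_set. piece E b = piece E (Inf (jl i)) \<longrightarrow> \<bar>b - Inf (J i)\<bar> < \<delta>" using left by force
      moreover have "\<forall>b\<in>D_set. piece E b = piece E (Inf (jr i)) \<longrightarrow> \<bar>b - Sup (J i)\<bar> < \<delta>" using right by force
      moreover have "Inf (jl i) \<in> D_set" "Inf (jr i) \<in> D_set" using gD zi wi by auto
      ultimately show ?thesis by blast
    qed (use a zi wi in auto)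
  qed
  then show ?thesis using that E by blast
qed

section \<open>The adding machine and the model system\<close>


lemma lconst_subtopology:
  assumes "lconst X f" shows "lconst (subtopology X S) f"
  unfolding lconst_def
proof
  fix v
  have "{x \<in> topspace (subtopology X S). f x = v} = {x \<in> topspace X. f x = v} \<inter> S" by auto
  then show "openin (subtopology X S) {x \<in> topspace (subtopology X S). f x = v}"
    using lconstD[OF assms, of v] by (auto simp: openin_subtopology)
qed

lemma lconst_less_cut:
  fixes h :: "'a \<Rightarrow> real"
  assumes h: "continuous_map X euclideanreal h" and e: "\<And>x. x \<in> topspace X \<Longrightarrow> h x \<noteq> e"
  shows "lconst X (\<lambda>x. h x < e)"
  unfolding lconst_def
proof
  fix v
  have "openin X {x \<in> topspace X. h x \<in> {..<e}}" "openin X {x \<in> topspace X. h x \<in> {e<..}}"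
    by (rule openin_continuous_map_preimage[OF h]; simp)+
  moreover have "{x \<in> topspace X. h x \<in> {e<..}} = {x \<in> topspace X. (h x < e) = False}"
    using e by (auto simp: not_less le_less)
  ultimately show "openin X {x \<in> topspace X. (h x < e) = v}" by (cases v) simp_all
qed

lemma theta_topspace:
  "t \<in> topspace theta_topology \<longleftrightarrow> t \<in> extensional {1..} \<and> (\<forall>m\<ge>1. 0 \<le> t m \<and> t m < int m) \<and>
     (\<forall>m\<ge>1. \<forall>n\<ge>1. m dvd n \<longrightarrow> t n mod int m = t m)"
  by (auto simp: theta_topology_def PiE_iff)

lemma theta_lconst:
  assumes "m \<ge> 1" shows "lconst theta_topology (\<lambda>t. t m)"
proof -
  have "continuous_map (product_topology (\<lambda>m. discrete_topology {0..<int m}) {1..}) (discrete_topology {0..<int m}) (\<lambda>t. t m)"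
    using continuous_map_product_projection[of m "{1..}" "\<lambda>m. discrete_topology {0..<int m}"] assms by simp
  moreover have "lconst (discrete_topology {0..<int m}) (\<lambda>v. v)" by (auto simp: lconst_def)
  ultimately have "lconst (product_topology (\<lambda>m. discrete_topology {0..<int m}) {1..}) (\<lambda>t. t m)"
    by (rule lconst_continuous)
  then show ?thesis unfolding theta_topology_def by (rule lconst_subtopology)
qed

lemma theta_compact: "compact_space theta_topology"
proof -
  define P where "P = product_topology (\<lambda>m. discrete_topology {0..<int m}) {1::nat..}"
  define S where "S = {t :: nat \<Rightarrow> int. \<forall>m\<ge>1. \<forall>n\<ge>1. m dvd n \<longrightarrow> t n mod int m = t m}"
  have cP: "compact_space P" unfolding P_def by (simp add: compact_space_product_topology compact_space_discrete_topology)
  have coord: "lconst P (\<lambda>t. t m)" if "m \<ge> 1" for m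
  proof -
    have "continuous_map P (discrete_topology {0..<int m}) (\<lambda>t. t m)"
      unfolding P_def
      using continuous_map_product_projection[of m "{1..}" "\<lambda>m. discrete_topology {0..<int m}"] that by simp
    moreover have "lconst (discrete_topology {0..<int m}) (\<lambda>v. v)" by (auto simp: lconst_def)
    ultimately show ?thesis by (rule lconst_continuous)
  qed
  define K :: "(nat \<times> nat) set" where "K = {(m, n). m \<ge> 1 \<and> n \<ge> 1 \<and> m dvd n}"
  have "closedin P {t \<in> topspace P. (\<lambda>(u, v). v mod int (fst k) = u) (t (fst k), t (snd k))}" if "k \<in> K" for k
    by (rule lconst_closed_vimage[OF lconst_Pair[OF coord coord]]) (use that in \<open>auto simp: K_def\<close>)
  then have "closedin P (\<Inter>k\<in>K. {t \<in> topspace P. (\<lambda>(u, v). v mod int (fst k) = u) (t (fst k), t (snd k))})"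
    by (intro closedin_Inter) (auto simp: K_def)
  \<comment> \<open>A nonempty index set keeps the intersection inside the carrier of the
    product.\<close>
  moreover have "(1, 1) \<in> K" by (simp add: K_def)
  then have "(\<Inter>k\<in>K. {t \<in> topspace P. (\<lambda>(u, v). v mod int (fst k) = u) (t (fst k), t (snd k))}) = topspace P \<inter> S"
    unfolding K_def S_def by fastforce
  ultimately have "compactin P (topspace P \<inter> S)" using closedin_compact_space[OF cP] by simp
  then have "compact_space (subtopology P (topspace P \<inter> S))" by (rule compact_space_subtopology)
  moreover have "subtopology P (topspace P \<inter> S) = subtopology P S" by (simp only: subtopology_restrict)
  ultimately have "compact_space (subtopology P S)" by simp
  then show ?thesis unfolding theta_topology_def P_def S_def .
qed

lemma theta_of_int_in: "theta_of_int x \<in> topspace theta_topology"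
proof -
  have "x mod int n mod int m = x mod int m" if "m dvd n" for m n
    using that by (simp add: mod_mod_cancel)
  then show ?thesis unfolding theta_topspace by (auto simp: theta_of_int_def)
qed

lemma theta_of_int_apply: "m \<ge> 1 \<Longrightarrow> theta_of_int x m = x mod int m"
  by (simp add: theta_of_int_def)

lemma theta_add_apply: "m \<ge> 1 \<Longrightarrow> theta_add t (theta_of_int x) m = (t m + x) mod int m"
  by (simp add: theta_add_def theta_of_int_apply mod_add_right_eq)

lemma theta_add_in:
  assumes "t \<in> topspace theta_topology" shows "theta_add t (theta_of_int x) \<in> topspace theta_topology"
  unfolding theta_topspace
proof (intro conjI allI impI)
  show "theta_add t (theta_of_int x) \<in> extensional {1..}" by (simp add: theta_add_def)
  show "0 \<le> theta_add t (theta_of_int x) m" "theta_add t (theta_of_int x) m < int m" if "m \<ge> 1" for m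
    using that by (simp_all add: theta_add_apply)
  fix m n :: nat assume mn: "1 \<le> m" "1 \<le> n" "m dvd n"
  have "(t n + x) mod int n mod int m = (t n + x) mod int m" using mn by (simp add: mod_mod_cancel)
  also have "\<dots> = (t n mod int m + x) mod int m" by (simp add: mod_add_left_eq)
  also have "t n mod int m = t m" using assms mn unfolding theta_topspace by blast
  finally show "theta_add t (theta_of_int x) n mod int m = theta_add t (theta_of_int x) m"
    using mn by (simp add: theta_add_apply)
qed

lemma theta_eqI:
  assumes "s \<in> topspace theta_topology" "t \<in> topspace theta_topology" "\<And>m. m \<ge> 1 \<Longrightarrow> s m = t m"
  shows "s = t"
  by (rule extensionalityI[of s "{1..}"]) (use assms in \<open>auto simp: theta_topspace\<close>)

lemma theta_add_theta_of_int: "theta_add (theta_of_int x) (theta_of_int y) = theta_of_int (x + y)"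
  by (rule theta_eqI) (auto intro: theta_add_in theta_of_int_in simp: theta_add_apply theta_of_int_apply mod_add_left_eq)

lemma theta_add_cancel:
  assumes "t \<in> topspace theta_topology"
  shows "theta_add (theta_add t (theta_of_int x)) (theta_of_int (- x)) = t"
proof (rule theta_eqI)
  fix m :: nat assume m: "m \<ge> 1"
  have "((t m + x) mod int m + - x) mod int m = (t m + x + - x) mod int m" by (rule mod_add_left_eq)
  also have "\<dots> = t m" using assms m unfolding theta_topspace by simp
  finally show "theta_add (theta_add t (theta_of_int x)) (theta_of_int (- x)) m = t m" using m by (simp add: theta_add_apply)
qed (auto intro: theta_add_in assms)

lemma gaps_ordered:
  assumes "j \<in> D_gaps" "j' \<in> D_gaps" "j \<noteq> j'"
  shows "Sup j \<le> Inf j' \<or> Sup j' \<le> Inf j"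
proof (rule ccontr)
  assume n: "\<not> ?thesis"
  define x where "x = (max (Inf j) (Inf j') + min (Sup j) (Sup j')) / 2"
  have "max (Inf j) (Inf j') < min (Sup j) (Sup j')"
    using n gap_interval(1)[OF assms(1)] gap_interval(1)[OF assms(2)] by auto
  then have "max (Inf j) (Inf j') < x" "x < min (Sup j) (Sup j')" unfolding x_def by argo+
  then have "Inf j < x" "x < Sup j" "Inf j' < x" "x < Sup j'" by simp_all
  then have "x \<in> j" "x \<in> j'" using gap_iff assms by simp_all
  then show False using D_gaps_disjoint[OF assms(1,2)] assms(3) by blast
qed

section \<open>The space Z(D,C) and its homeomorphism\<close>

locale gap_model =
  fixes q :: "real set \<Rightarrow> int \<Rightarrow> real"
  assumes gap_seq: "gap_sequences q"
begin

lemma q_less: "j \<in> D_gaps \<Longrightarrow> q j x < q j y \<longleftrightarrow> x < y"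
  using gap_seq by (simp add: gap_sequences_def strict_mono_less)

lemma q_in: "j \<in> D_gaps \<Longrightarrow> q j x \<in> j"
  using gap_seq by (auto simp: gap_sequences_def)

lemma q_bounds: "j \<in> D_gaps \<Longrightarrow> Inf j < q j x" "j \<in> D_gaps \<Longrightarrow> q j x < Sup j"
  using q_in gap_iff by blast+

lemma q_notin_C: "j \<in> D_gaps \<Longrightarrow> q j x \<notin> cantor_set"
  using q_in gap_facts(3) by blast

lemma q_eq:
  assumes "j \<in> D_gaps" "j' \<in> D_gaps" "q j x = q j' x'"
  shows "j = j' \<and> x = x'"
proof -
  have j: "j = j'" using D_gaps_disjoint[OF assms(1,2) q_in[OF assms(1), of x]] q_in[OF assms(2), of x'] assms(3) by simp
  have "\<not> x < x'" "\<not> x' < x" using q_less[OF assms(1)] assms(3) j by (metis less_irrefl)+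
  then show ?thesis using j by simp
qed

lemma q_limits:
  assumes j: "j \<in> D_gaps" and d: "d > 0"
  obtains N where "\<And>x. x \<ge> N \<Longrightarrow> Sup j - d < q j x" "\<And>x. x \<le> - N \<Longrightarrow> q j x < Inf j + d"
proof -
  have l: "(q j \<longlongrightarrow> Sup j) at_top" "(q j \<longlongrightarrow> Inf j) at_bot" using gap_seq j by (auto simp: gap_sequences_def)
  have "\<forall>\<^sub>F x in at_top. Sup j - d < q j x" by (rule order_tendstoD(1)[OF l(1)]) (use d in simp)
  then obtain A where A: "\<And>x. x \<ge> A \<Longrightarrow> Sup j - d < q j x" unfolding eventually_at_top_linorder by blast
  have "\<forall>\<^sub>F x in at_bot. q j x < Inf j + d" by (rule order_tendstoD(2)[OF l(2)]) (use d in simp)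
  then obtain B where B: "\<And>x. x \<le> B \<Longrightarrow> q j x < Inf j + d" unfolding eventually_at_bot_linorder by blast
  show ?thesis by (rule that[of "max A (- B)"]) (use A B in auto)
qed

lemma q_position:
  assumes j: "j \<in> D_gaps" and a: "a \<in> j"
  obtains x where "q j x \<le> a" "a < q j (x + 1)"
proof -
  have i: "Inf j < a" "a < Sup j" using gap_iff[OF j] a by auto
  define d where "d = min (a - Inf j) (Sup j - a)"
  have d: "d > 0" "d \<le> a - Inf j" "d \<le> Sup j - a" using i by (simp_all add: d_def)
  from d(1) obtain N where N: "\<And>x. x \<ge> N \<Longrightarrow> Sup j - d < q j x" "\<And>x. x \<le> - N \<Longrightarrow> q j x < Inf j + d"
    using q_limits[OF j] by blast
  have hi: "a < q j \<bar>N\<bar>" using N(1)[OF abs_ge_self] d(3) by linarith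
  have lo: "q j (- \<bar>N\<bar>) < a" using N(2)[of "- \<bar>N\<bar>"] d(2) by linarith
  define X where "X = {x \<in> {- \<bar>N\<bar>..\<bar>N\<bar>}. q j x \<le> a}"
  have "X \<subseteq> {- \<bar>N\<bar>..\<bar>N\<bar>}" by (auto simp: X_def)
  then have "finite X" by (rule finite_subset) simp
  moreover have "- \<bar>N\<bar> \<in> X" using lo by (simp add: X_def)
  ultimately have X: "finite X" "- \<bar>N\<bar> \<in> X" by blast+
  have m: "Max X \<in> X" using X by (intro Max_in) auto
  have "a < q j (Max X + 1)"
  proof (rule ccontr)
    assume n: "\<not> a < q j (Max X + 1)"
    have "Max X \<noteq> \<bar>N\<bar>" using m hi by (auto simp: X_def)
    then have "Max X + 1 \<in> X" using m n by (auto simp: X_def)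
    then show False using Max_ge[OF X(1), of "Max X + 1"] by simp
  qed
  then show ?thesis using that m by (auto simp: X_def)
qed

text \<open>These are the first coordinates of the points of Z. Any real outside them splits Z into
  clopen halves, but only a real outside \<open>D_set\<close> is sure to give halves invariant under
  \<open>tau\<close>.\<close>

definition coords :: "real set" where
  "coords = cantor_set \<union> {q j x | j x. j \<in> D_gaps}"

lemma coords_D: "coords \<subseteq> D_set"
  unfolding coords_def using cantor_sub_D gap_facts(4) q_in by blast

lemma between_q_notin_coords:
  assumes j: "j \<in> D_gaps" and e: "q j x < e" "e < q j (x + 1)"
  shows "e \<notin> coords" "e \<in> j"
proof -
  show ej: "e \<in> j" using e q_bounds[OF j, of x] q_bounds[OF j, of "x + 1"] gap_iff[OF j] by simp
  show "e \<notin> coords"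
  proof
    assume "e \<in> coords"
    moreover have "e \<notin> cantor_set" using ej gap_facts(3)[OF j] by blast
    ultimately obtain j' y where y: "j' \<in> D_gaps" "e = q j' y" unfolding coords_def by blast
    have "j = j'" using D_gaps_disjoint[OF j y(1) ej] q_in[OF y(1)] y(2) by blast
    then show False using e q_less[OF j, of x y] q_less[OF j, of y "x + 1"] y(2) by simp
  qed
qed

text \<open>The Cantor set has no interior, so a subinterval avoids it, and only countably many
  points of the gap sequences remain to be avoided there.\<close>

lemma coords_no_interval:
  assumes "x < y" obtains e where "e \<notin> coords" "x < e" "e < y"
proof -
  have "countable (\<Union>n. middle_third n ` cantor_left n)"
  proof (intro countable_UN countable_image)
    have "finite (cantor_left n)" for n by (induction n) auto
    then show "countable (cantor_left n)" for n by (rule countable_finite)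
  qed simp
  moreover have "D_gaps \<subseteq> (\<Union>n. middle_third n ` cantor_left n)" unfolding D_gaps_eq by blast
  ultimately have cg: "countable D_gaps" by (rule countable_subset[rotated])
  have "{q j x | j x. j \<in> D_gaps} = (\<lambda>(j, x). q j x) ` (D_gaps \<times> UNIV)" by auto
  then have cq: "countable {q j x | j x. j \<in> D_gaps}" using cg by simp
  have "\<exists>u v. u < v \<and> x \<le> u \<and> v \<le> y \<and> {u<..<v} \<inter> cantor_set = {}"
  proof (cases "(x + y) / 2 \<in> cantor_set")
    case True
    obtain j where j: "j \<in> D_gaps" "(x + y) / 2 - (y - x) / 2 < Inf j" "Sup j < (x + y) / 2 + (y - x) / 2"
      using gap_near[OF True, of "(y - x) / 2"] assms by auto
    have "{Inf j<..<Sup j} \<inter> cantor_set = {}" using gap_facts(3)[OF j(1)] gap_interval(2)[OF j(1)] by simp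
    moreover have "x \<le> Inf j" "Sup j \<le> y" using j by (simp_all add: field_simps)
    ultimately show ?thesis using gap_interval(1)[OF j(1)] by blast
  next
    case False
    have "open (- cantor_set)" using cantor_set_basic(1) by (simp add: open_Compl)
    then obtain d where d: "d > 0" "ball ((x + y) / 2) d \<subseteq> - cantor_set"
      using False openE[of "- cantor_set" "(x + y) / 2"] by blast
    define d' where "d' = min d ((y - x) / 2)"
    have d': "d' > 0" "d' \<le> d" using d(1) assms by (simp_all add: d'_def)
    have d'': "d' \<le> (y - x) / 2" unfolding d'_def by (rule min.cobounded2)
    have "{(x + y) / 2 - d'<..<(x + y) / 2 + d'} \<subseteq> ball ((x + y) / 2) d"
      using d' by (auto simp: ball_def dist_real_def)
    then have "{(x + y) / 2 - d'<..<(x + y) / 2 + d'} \<inter> cantor_set = {}" using d(2) by blast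
    then show ?thesis using d' d'' by (intro exI[of _ "(x + y) / 2 - d'"] exI[of _ "(x + y) / 2 + d'"]) (simp add: field_simps)
  qed
  then obtain u v where uv: "u < v" "x \<le> u" "v \<le> y" "{u<..<v} \<inter> cantor_set = {}" by blast
  have "uncountable {u<..<v}" using uv(1) by (simp add: uncountable_open_interval)
  then have "\<not> {u<..<v} \<subseteq> {q j x | j x. j \<in> D_gaps}" using cq countable_subset by blast
  then obtain e where "e \<in> {u<..<v}" "e \<notin> {q j x | j x. j \<in> D_gaps}" by blast
  then have "e \<notin> coords" "u < e" "e < v" using uv(4) unfolding coords_def by auto
  then show ?thesis using that uv(2,3) by simp
qed

abbreviation Z where "Z \<equiv> Z_topology q"

lemma Z_cases:
  assumes "z \<in> Z_set q"
  obtains (C) a t where "z = (a, t)" "a \<in> cantor_set" "t \<in> topspace theta_topology"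
  | (gap) j x where "z = (q j x, theta_of_int x)" "j \<in> D_gaps"
  using assms unfolding Z_set_def by blast

lemma Z_set_C: "a \<in> cantor_set \<Longrightarrow> t \<in> topspace theta_topology \<Longrightarrow> (a, t) \<in> Z_set q"
  by (simp add: Z_set_def)

lemma Z_set_gap: "j \<in> D_gaps \<Longrightarrow> (q j x, theta_of_int x) \<in> Z_set q"
  by (auto simp: Z_set_def)

lemma Z_set_fst: "z \<in> Z_set q \<Longrightarrow> fst z \<in> coords"
  by (erule Z_cases) (auto simp: coords_def)

lemma Z_set_snd: "z \<in> Z_set q \<Longrightarrow> snd z \<in> topspace theta_topology"
  by (erule Z_cases) (auto simp: theta_of_int_in)

lemma Z_set_sub: "Z_set q \<subseteq> {0..1} \<times> topspace theta_topology"
proof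
  fix z assume z: "z \<in> Z_set q"
  have "fst z \<in> {0..1}" using Z_set_fst[OF z] coords_D D_set_bounds by blast
  then show "z \<in> {0..1} \<times> topspace theta_topology" using Z_set_snd[OF z] by (simp add: mem_Times_iff)
qed

lemma topspace_Z: "topspace Z = Z_set q"
  using Z_set_sub by (auto simp: Z_topology_def)

lemma continuous_fst_Z: "continuous_map Z euclideanreal fst"
proof -
  have "continuous_map Z (top_of_set {0..1}) fst"
    unfolding Z_topology_def by (rule continuous_map_from_subtopology[OF continuous_map_fst])
  then show ?thesis by (simp add: continuous_map_in_subtopology)
qed

lemma continuous_snd_Z: "continuous_map Z theta_topology snd"
  unfolding Z_topology_def by (rule continuous_map_from_subtopology[OF continuous_map_snd])

lemma lconst_fst_Z: "e \<notin> coords \<Longrightarrow> lconst Z (\<lambda>z. fst z < e)"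
  by (rule lconst_less_cut[OF continuous_fst_Z]) (use Z_set_fst topspace_Z in blast)

lemma lconst_snd_Z: "m \<ge> 1 \<Longrightarrow> lconst Z (\<lambda>z. snd z m)"
  by (rule lconst_continuous[OF continuous_snd_Z theta_lconst])

text \<open>Z is closed in the compact product. A point off Z has its first coordinate outside
  \<open>D_set\<close> or in a retained gap, since the full fibre over the Cantor set belongs to Z.
  In a gap the sequence is discrete, so either the first coordinate or a residue isolates the point
  from Z.\<close>

lemma compact_Z: "compact_space Z"
proof -
  define B where "B = prod_topology (top_of_set {0..1::real}) theta_topology"
  have topB: "topspace B = {0..1} \<times> topspace theta_topology" by (simp add: B_def)
  have cB: "compact_space B"
    unfolding B_def compact_space_prod_topology using theta_compact
    by (simp add: compact_space_subtopology)
  have "openin B (topspace B - Z_set q)"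
  proof (subst openin_subopen, intro ballI)
    fix w assume w: "w \<in> topspace B - Z_set q"
    obtain a t where at: "w = (a, t)" by (cases w)
    have a: "a \<in> {0..1}" and t: "t \<in> topspace theta_topology" and nZ: "(a, t) \<notin> Z_set q"
      using w unfolding at topB by auto
    have box: "\<exists>T. openin B T \<and> w \<in> T \<and> T \<subseteq> topspace B - Z_set q"
      if V: "open V" "a \<in> V" and W: "openin theta_topology W" "t \<in> W"
        and dis: "\<And>b s. (b, s) \<in> Z_set q \<Longrightarrow> b \<in> V \<Longrightarrow> s \<notin> W" for V W
    proof (intro exI conjI)
      show "openin B (({0..1} \<inter> V) \<times> W)"
        unfolding B_def openin_prod_Times_iff using V W openin_open_Int by blast
      show "w \<in> ({0..1} \<inter> V) \<times> W" using at a V W by simp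
      show "({0..1} \<inter> V) \<times> W \<subseteq> topspace B - Z_set q"
        using dis openin_subset[OF W(1)] unfolding topB by auto
    qed
    have Th: "openin theta_topology (topspace theta_topology)" by simp
    show "\<exists>T. openin B T \<and> w \<in> T \<and> T \<subseteq> topspace B - Z_set q"
    proof (cases "a \<in> D_set")
      case False
      show ?thesis
      proof (rule box[OF _ _ Th t])
        show "open (- D_set)" using closed_D_set by (simp add: open_Compl)
        show "s \<notin> topspace theta_topology" if "(b, s) \<in> Z_set q" "b \<in> - D_set" for b s
          using Z_set_fst[OF that(1)] that(2) coords_D by auto
      qed (use False in simp)
    next
      case True
      have "a \<notin> cantor_set" using nZ t Z_set_C by blast
      with True obtain j where j: "j \<in> D_gaps" "a \<in> j" by (rule D_set_cases)
      obtain x where x: "q j x \<le> a" "a < q j (x + 1)" using q_position[OF j] .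
      show ?thesis
      proof (cases "q j x = a")
        case False
        show ?thesis
        proof (rule box[OF _ _ Th t])
          show "open {q j x<..<q j (x + 1)}" by simp
          show "s \<notin> topspace theta_topology" if "(b, s) \<in> Z_set q" "b \<in> {q j x<..<q j (x + 1)}" for b s
            using Z_set_fst[OF that(1)] between_q_notin_coords(1)[OF j(1), of x b] that(2) by auto
        qed (use x False in simp)
      next
        case True
        have "t \<noteq> theta_of_int x" using nZ Z_set_gap[OF j(1), of x] True by auto
        then obtain m where m: "m \<ge> 1" "t m \<noteq> theta_of_int x m" using theta_eqI[OF t theta_of_int_in] by blast
        show ?thesis
        proof (rule box)
          show "open {q j (x - 1)<..<q j (x + 1)}" by simp
          show "a \<in> {q j (x - 1)<..<q j (x + 1)}" using True q_less[OF j(1)] by auto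
          show "openin theta_topology {s \<in> topspace theta_topology. s m = t m}" by (rule lconstD[OF theta_lconst[OF m(1)]])
          show "t \<in> {s \<in> topspace theta_topology. s m = t m}" using t by simp
          fix b s assume bs: "(b, s) \<in> Z_set q" "b \<in> {q j (x - 1)<..<q j (x + 1)}"
          have bj: "b \<in> j" using bs(2) q_bounds[OF j(1), of "x - 1"] q_bounds[OF j(1), of "x + 1"] gap_iff[OF j(1)] by auto
          from bs(1) show "s \<notin> {s \<in> topspace theta_topology. s m = t m}"
          proof (cases rule: Z_cases)
            case (C a' t') then show ?thesis using bj gap_facts(3)[OF j(1)] by blast
          next
            case (gap j' y)
            then have "j' = j" using D_gaps_disjoint[OF gap(2) j(1), of b] q_in bj by auto
            then have "x - 1 < y" "y < x + 1" using bs(2) gap q_less[OF j(1)] by auto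
            then have "y = x" by simp
            then show ?thesis using gap m(2) by auto
          qed
        qed
      qed
    qed
  qed
  then have "closedin B (Z_set q)" unfolding closedin_def using Z_set_sub topB by simp
  then have "compactin B (Z_set q)" by (rule closedin_compact_space[OF cB])
  then show ?thesis unfolding Z_topology_def B_def[symmetric] by (rule compact_space_subtopology)
qed

text \<open>One admissible cut for each rational interval: a countable family that separates all
  first coordinates.\<close>

definition cut_at :: "rat \<times> rat \<Rightarrow> real" where
  "cut_at rs = (SOME e. e \<notin> coords \<and> (fst rs < snd rs \<longrightarrow> of_rat (fst rs) < e \<and> e < of_rat (snd rs)))"

lemma cut_at: "cut_at rs \<notin> coords" "fst rs < snd rs \<Longrightarrow> of_rat (fst rs) < cut_at rs \<and> cut_at rs < of_rat (snd rs)"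
proof -
  have "\<exists>e. e \<notin> coords \<and> (fst rs < snd rs \<longrightarrow> of_rat (fst rs) < e \<and> e < (of_rat (snd rs) :: real))"
  proof (cases "fst rs < snd rs")
    case True
    then have "of_rat (fst rs) < (of_rat (snd rs) :: real)" by (simp add: of_rat_less)
    then show ?thesis using coords_no_interval by metis
  next
    case False
    then show ?thesis using coords_no_interval[of 0 1] by auto
  qed
  from someI_ex[OF this] show "cut_at rs \<notin> coords"
      "fst rs < snd rs \<Longrightarrow> of_rat (fst rs) < cut_at rs \<and> cut_at rs < of_rat (snd rs)"
    unfolding cut_at_def by blast+
qed

lemma cut_at_between:
  fixes x y :: real
  assumes "x < y" shows "\<exists>rs. x < cut_at rs \<and> cut_at rs < y"
proof -
  obtain r where r: "x < of_rat r" "of_rat r < y" using of_rat_dense[OF assms] by blast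
  obtain s where s: "of_rat r < (of_rat s :: real)" "of_rat s < y" using of_rat_dense[OF r(2)] by blast
  have "fst (r, s) < snd (r, s)" using s(1) by (simp add: of_rat_less)
  from cut_at(2)[OF this] show ?thesis using r s by (intro exI[of _ "(r, s)"]) simp
qed

text \<open>Cuts separate first coordinates and residues separate second ones; \<open>Suc m\<close>
  appears because moduli start at 1.\<close>

definition Z_sep :: "(rat \<times> rat) + nat \<Rightarrow> real \<times> (nat \<Rightarrow> int) \<Rightarrow> int" where
  "Z_sep i z = (case i of Inl rs \<Rightarrow> of_bool (fst z < cut_at rs) | Inr m \<Rightarrow> snd z (Suc m))"

lemma Z_sep_separates:
  assumes "z \<in> topspace Z" "z' \<in> topspace Z" "z \<noteq> z'"
  shows "\<exists>i. Z_sep i z \<noteq> Z_sep i z'"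
proof (cases "fst z = fst z'")
  case True
  then have "snd z \<noteq> snd z'" using assms(3) by (simp add: prod_eq_iff)
  then obtain m where m: "m \<ge> 1" "snd z m \<noteq> snd z' m"
    using theta_eqI[of "snd z" "snd z'"] Z_set_snd assms(1,2) topspace_Z by blast
  then have "Z_sep (Inr (m - 1)) z \<noteq> Z_sep (Inr (m - 1)) z'" by (simp add: Z_sep_def)
  then show ?thesis by blast
next
  case False
  then consider "fst z < fst z'" | "fst z' < fst z" by linarith
  then show ?thesis
  proof cases
    case 1
    then obtain rs where "fst z < cut_at rs" "cut_at rs < fst z'" using cut_at_between by blast
    then have "Z_sep (Inl rs) z \<noteq> Z_sep (Inl rs) z'" by (simp add: Z_sep_def)
    then show ?thesis by blast
  next
    case 2
    then obtain rs where "fst z' < cut_at rs" "cut_at rs < fst z" using cut_at_between by blast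
    then have "Z_sep (Inl rs) z \<noteq> Z_sep (Inl rs) z'" by (simp add: Z_sep_def)
    then show ?thesis by blast
  qed
qed

lemma lconst_Z_sep: "lconst Z (Z_sep i)"
proof (cases i)
  case (Inl rs)
  have "lconst Z (\<lambda>z. of_bool (fst z < cut_at rs) :: int)"
    by (rule lconst_comp[OF lconst_fst_Z[OF cut_at(1)]])
  then show ?thesis using Inl by (simp add: Z_sep_def[abs_def])
next
  case (Inr m)
  then show ?thesis using lconst_snd_Z[of "Suc m"] by (simp add: Z_sep_def[abs_def])
qed

lemma zdc_Z: "zdc Z"
  by (rule zdcI[OF compact_Z lconst_Z_sep Z_sep_separates])

abbreviation tau where "tau \<equiv> tau_DC q"

lemma tau_C: "a \<in> cantor_set \<Longrightarrow> tau (a, t) = (a, theta_add t (theta_of_int 1))"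
  by (simp add: tau_DC_def)

lemma tau_gap:
  assumes j: "j \<in> D_gaps"
  shows "tau (q j x, t) = (q j (x + 1), theta_of_int (x + 1))"
proof -
  have "(THE p. \<exists>j'\<in>D_gaps. \<exists>x'. q j x = q j' x' \<and> p = (q j' (x' + 1), theta_of_int (x' + 1))) =
      (q j (x + 1), theta_of_int (x + 1))"
  proof (rule the_equality)
    show "\<exists>j'\<in>D_gaps. \<exists>x'. q j x = q j' x' \<and>
        (q j (x + 1), theta_of_int (x + 1)) = (q j' (x' + 1), theta_of_int (x' + 1))" using j by blast
    show "p = (q j (x + 1), theta_of_int (x + 1))"
      if "\<exists>j'\<in>D_gaps. \<exists>x'. q j x = q j' x' \<and> p = (q j' (x' + 1), theta_of_int (x' + 1))" for p
      using that q_eq[OF j] by blast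
  qed
  then show ?thesis using q_notin_C[OF j] by (simp add: tau_DC_def)
qed

lemma tau_in: "z \<in> Z_set q \<Longrightarrow> tau z \<in> Z_set q"
  by (erule Z_cases) (auto simp: tau_C tau_gap intro: Z_set_C Z_set_gap theta_add_in)

lemma snd_tau: "z \<in> Z_set q \<Longrightarrow> snd (tau z) = theta_add (snd z) (theta_of_int 1)"
  by (erule Z_cases) (simp_all add: tau_C tau_gap theta_add_theta_of_int)

lemma snd_tau_apply: "z \<in> Z_set q \<Longrightarrow> m \<ge> 1 \<Longrightarrow> snd (tau z) m = (snd z m + 1) mod int m"
  by (simp add: snd_tau theta_add_apply)

lemma fst_tau_side:
  assumes z: "z \<in> Z_set q" and j: "j \<in> D_gaps"
  shows "fst z \<le> Inf j \<Longrightarrow> fst (tau z) \<le> Inf j" "Sup j \<le> fst z \<Longrightarrow> Sup j \<le> fst (tau z)"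
proof -
  have "(fst z \<le> Inf j \<longrightarrow> fst (tau z) \<le> Inf j) \<and> (Sup j \<le> fst z \<longrightarrow> Sup j \<le> fst (tau z))"
    using z
  proof (cases rule: Z_cases)
    case (C a t) then show ?thesis by (simp add: tau_C)
  next
    case (gap j' x)
    note b = q_bounds[OF gap(2), of x] q_bounds[OF gap(2), of "x + 1"] q_bounds[OF j, of x]
    show ?thesis
    proof (cases "j = j'")
      case True
      then show ?thesis using b gap by simp
    next
      case False
      then show ?thesis using b gaps_ordered[OF j gap(2)] gap by (auto simp: tau_gap)
    qed
  qed
  then show "fst z \<le> Inf j \<Longrightarrow> fst (tau z) \<le> Inf j" "Sup j \<le> fst z \<Longrightarrow> Sup j \<le> fst (tau z)" by blast+
qed

lemma Z_side:
  assumes z: "z \<in> Z_set q" and j: "j \<in> D_gaps"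
  shows "fst z \<le> Inf j \<or> Sup j \<le> fst z \<or> (\<exists>x. z = (q j x, theta_of_int x))"
  using z
proof (cases rule: Z_cases)
  case (C a t)
  then have "\<not> (Inf j < a \<and> a < Sup j)" using gap_iff[OF j, of a] gap_facts(3)[OF j] by blast
  then show ?thesis using C by auto
next
  case (gap j' x)
  then show ?thesis
    using gaps_ordered[OF j gap(2)] q_bounds[OF gap(2), of x] by (cases "j = j'") auto
qed

text \<open>A cut outside \<open>D_set\<close> is unchanged under pullback by \<open>tau\<close>. A
  cut in a gap between the terms \<open>x\<close> and \<open>x + 1\<close> pulls back to one between
  \<open>x - 1\<close> and \<open>x\<close>. Continuity of \<open>tau\<close> in the first
  coordinate follows.\<close>

lemma fst_tau_cut:
  assumes e: "e \<notin> coords"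
  shows "\<exists>e'. e' \<notin> coords \<and> (\<forall>z\<in>Z_set q. fst (tau z) < e \<longleftrightarrow> fst z < e')"
proof (cases "e \<in> D_set")
  case False
  have "fst (tau z) < e \<longleftrightarrow> fst z < e" if "z \<in> Z_set q" for z
    using that
  proof (cases rule: Z_cases)
    case (gap j x)
    have "\<not> (Inf j < e \<and> e < Sup j)" using gap_iff[OF gap(2), of e] gap_facts(4)[OF gap(2)] False by blast
    then show ?thesis using gap q_bounds[OF gap(2), of x] q_bounds[OF gap(2), of "x + 1"] by (auto simp: tau_gap)
  qed (simp add: tau_C)
  then show ?thesis using e by blast
next
  case True
  then obtain j where j: "j \<in> D_gaps" "e \<in> j" using e D_set_cases unfolding coords_def by blast
  obtain x where x: "q j x \<le> e" "e < q j (x + 1)" using q_position[OF j] .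
  have "q j x \<noteq> e" using e j(1) unfolding coords_def by blast
  then have x': "q j x < e" using x(1) by simp
  have lt: "q j (x - 1) < q j x" using q_less[OF j(1)] by simp
  define e' where "e' = (q j (x - 1) + q j x) / 2"
  have e': "q j (x - 1) < e'" "e' < q j (x - 1 + 1)" using lt by (simp_all add: e'_def)
  note ne' = between_q_notin_coords[OF j(1) e']
  have ej: "Inf j < e" "e < Sup j" "Inf j < e'" "e' < Sup j" using gap_iff[OF j(1)] j(2) ne'(2) by auto
  have "fst (tau z) < e \<longleftrightarrow> fst z < e'" if z: "z \<in> Z_set q" for z
  proof -
    consider "fst z \<le> Inf j" | "Sup j \<le> fst z" | y where "z = (q j y, theta_of_int y)" using Z_side[OF z j(1)] by blast
    then show ?thesis
    proof cases
      case 1 then show ?thesis using fst_tau_side(1)[OF z j(1)] ej by auto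
    next
      case 2 then show ?thesis using fst_tau_side(2)[OF z j(1)] ej by auto
    next
      case 3
      have "q j (y + 1) < e \<longleftrightarrow> y + 1 \<le> x"
        using q_less[OF j(1), of "x" "y + 1"] q_less[OF j(1), of "y + 1" x] x x' q_less[OF j(1), of "y + 1" "x + 1"]
        by (smt (verit))
      moreover have "q j y < e' \<longleftrightarrow> y \<le> x - 1"
        using q_less[OF j(1), of "x - 1" y] q_less[OF j(1), of y "x - 1"] e' q_less[OF j(1), of y x]
        by (smt (verit))
      ultimately show ?thesis using 3 by (simp add: tau_gap[OF j(1)] add1_zle_eq)
    qed
  qed
  then show ?thesis using ne'(1) by blast
qed

lemma tau_homeomorphic: "homeomorphic_map Z Z tau"
proof (rule continuous_imp_homeomorphic_map[OF _ compact_Z zdc_Hausdorff[OF zdc_Z]])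
  show "continuous_map Z Z tau"
  proof (rule continuous_map_separating[OF compact_Z lconst_Z_sep Z_sep_separates])
    show "tau ` topspace Z \<subseteq> topspace Z" using tau_in topspace_Z by blast
    show "lconst Z (\<lambda>z. Z_sep i (tau z))" for i
    proof (cases i)
      case (Inl rs)
      obtain e' where e': "e' \<notin> coords" "\<And>z. z \<in> Z_set q \<Longrightarrow> fst (tau z) < cut_at rs \<longleftrightarrow> fst z < e'"
        using fst_tau_cut[OF cut_at(1)] by blast
      have "lconst Z (\<lambda>z. Z_sep i (tau z)) \<longleftrightarrow> lconst Z (\<lambda>z. of_bool (fst z < e') :: int)"
        by (rule lconst_cong) (use e'(2) Inl in \<open>simp add: Z_sep_def topspace_Z\<close>)
      then show ?thesis using lconst_comp[OF lconst_fst_Z[OF e'(1)], of "\<lambda>b. of_bool b :: int"] by simp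
    next
      case (Inr m)
      have "lconst Z (\<lambda>z. Z_sep i (tau z)) \<longleftrightarrow> lconst Z (\<lambda>z. (snd z (Suc m) + 1) mod int (Suc m))"
        by (rule lconst_cong) (use snd_tau_apply[of _ "Suc m"] Inr in \<open>simp add: Z_sep_def topspace_Z\<close>)
      then show ?thesis using lconst_comp[OF lconst_snd_Z[of "Suc m"], of "\<lambda>v. (v + 1) mod int (Suc m)"] by simp
    qed
  qed
  show "tau ` topspace Z = topspace Z"
    unfolding topspace_Z
  proof (intro equalityI subsetI)
    fix z assume "z \<in> Z_set q"
    then show "z \<in> tau ` Z_set q"
    proof (cases rule: Z_cases)
      case (C a t)
      have "theta_add (theta_add t (theta_of_int (-1))) (theta_of_int 1) = t"
        using theta_add_cancel[OF C(3), of "-1"] by simp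
      then have "z = tau (a, theta_add t (theta_of_int (-1)))" using C by (simp add: tau_C)
      then show ?thesis using Z_set_C[OF C(2) theta_add_in[OF C(3)]] by blast
    next
      case (gap j x)
      then have "z = tau (q j (x - 1), theta_of_int (x - 1))" by (simp add: tau_gap)
      then show ?thesis using Z_set_gap[OF gap(2)] by blast
    qed
  qed (use tau_in in blast)
  show "inj_on tau (topspace Z)"
  proof (rule inj_onI, unfold topspace_Z)
    fix z z' assume z: "z \<in> Z_set q" "z' \<in> Z_set q" "tau z = tau z'"
    have "theta_add (snd z) (theta_of_int 1) = theta_add (snd z') (theta_of_int 1)"
      using z snd_tau by metis
    then have s: "snd z = snd z'" using theta_add_cancel[of _ 1] Z_set_snd z(1,2) by metis
    have "fst z = fst z'"
      using z(1)
    proof (cases rule: Z_cases)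
      case (C a t)
      note C1 = C
      from z(2) show ?thesis
      proof (cases rule: Z_cases)
        case (C a' t') then show ?thesis using C1 z(3) by (simp add: tau_C)
      next
        case (gap j x) then show ?thesis using C1 z(3) q_notin_C[OF gap(2), of "x + 1"] by (simp add: tau_C tau_gap)
      qed
    next
      case (gap j x)
      note g1 = gap
      from z(2) show ?thesis
      proof (cases rule: Z_cases)
        case (C a' t') then show ?thesis using g1 z(3) q_notin_C[OF g1(2), of "x + 1"] by (simp add: tau_C tau_gap)
      next
        case (gap j' x')
        then have "q j (x + 1) = q j' (x' + 1)" using g1 z(3) by (simp add: tau_gap)
        from q_eq[OF g1(2) gap(2) this] show ?thesis using g1 gap by simp
      qed
    qed
    then show "z = z'" using s by (simp add: prod_eq_iff)
  qed
qed

end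

section \<open>Universality of the model\<close>


text \<open>Since \<open>C\<close> is perfect and the map acts on it trivially, each cell of
  \<open>C\<close> splits into \<open>m\<close> invariant clopen parts. These are the
  \<open>m\<close> copies of every dumbbell of \<open>Z\<close>.\<close>

lemma universal_times:
  assumes Z: "compact_space Z" "zdc Z" and C: "zdc C" "perfect C"
    and nice1: "\<And>(F :: 'a \<Rightarrow> nat) n. lconst Z F \<Longrightarrow> n > 0 \<Longrightarrow> \<exists>L \<iota> \<kappa> p \<phi>. nice Z \<tau> F n 1 L \<iota> \<kappa> p \<phi>"
  shows "universal (prod_topology Z (C :: 'c topology)) (map_prod \<tau> id)"
  unfolding universal_def
proof (intro allI impI)
  fix f :: "'a \<times> 'c \<Rightarrow> nat" and n :: int and m :: nat
  assume f: "lconst (prod_topology Z C) f" and n: "n > 0" and m: "m > 0"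
  obtain eZ where eZ: "sepseq Z eZ" using Z(2) by (auto simp: zdc_def)
  obtain eC where eC: "sepseq C eC" and cC: "compact_space C" using C(1) by (auto simp: zdc_def)
  have fstc: "lconst (prod_topology Z C) (\<lambda>w. g (fst w))" if "lconst Z g" for g :: "'a \<Rightarrow> 'x"
    by (rule lconst_continuous[OF continuous_map_fst that])
  have sndc: "lconst (prod_topology Z C) (\<lambda>w. g (snd w))" if "lconst C g" for g :: "'c \<Rightarrow> 'x"
    by (rule lconst_continuous[OF continuous_map_snd that])
  define e where "e k w = to_nat (eZ k (fst w), eC k (snd w))" for k w
  have e: "sepseq (prod_topology Z C) e"
    unfolding sepseq_def
  proof (intro conjI allI ballI impI)
    fix k
    show "lconst (prod_topology Z C) (e k)"
      unfolding e_def[abs_def]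
      by (rule lconst_comp[OF lconst_Pair[OF fstc[OF sepseqD(1)[OF eZ]] sndc[OF sepseqD(1)[OF eC]]], where h=to_nat])
    fix x y assume xy: "x \<in> topspace (prod_topology Z C)" "y \<in> topspace (prod_topology Z C)" "e (Suc k) x = e (Suc k) y"
    then have "eZ (Suc k) (fst x) = eZ (Suc k) (fst y)" "eC (Suc k) (snd x) = eC (Suc k) (snd y)" by (simp_all add: e_def)
    from sepseq_mono[OF eZ _ _ this(1), of k] sepseq_mono[OF eC _ _ this(2), of k] xy(1,2)
    show "e k x = e k y" by (simp add: e_def mem_Times_iff)
  next
    fix x y assume xy: "x \<in> topspace (prod_topology Z C)" "y \<in> topspace (prod_topology Z C)" "x \<noteq> y"
    show "\<exists>k. e k x \<noteq> e k y"
    proof (rule ccontr)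
      assume "\<nexists>k. e k x \<noteq> e k y"
      then have eq: "eZ k (fst x) = eZ k (fst y)" "eC k (snd x) = eC k (snd y)" for k by (simp_all add: e_def)
      have "fst x = fst y" by (rule sepseqD(2)[OF eZ _ _ eq(1)]) (use xy in auto)
      moreover have "snd x = snd y" by (rule sepseqD(2)[OF eC _ _ eq(2)]) (use xy in auto)
      ultimately show False using xy(3) by (simp add: prod_eq_iff)
    qed
  qed
  have cP: "compact_space (prod_topology Z C)" using Z(1) cC by (simp add: compact_space_prod_topology)
  \<comment> \<open>Products of partitions of the two factors are cofinal among the partitions of
    the product, so \<open>f\<close> may be replaced by such a product.\<close>
  obtain k0 \<pi> where k0: "\<And>w. w \<in> topspace (prod_topology Z C) \<Longrightarrow> f w = \<pi> (e k0 w)"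
    using lconst_countable_code[OF cP e f] by blast
  define g where "g = eC k0"
  have lg: "lconst C g" unfolding g_def by (rule sepseqD(1)[OF eC])
  obtain L \<iota> \<kappa> p \<phi> where N: "nice Z \<tau> (eZ k0) n 1 L \<iota> \<kappa> p \<phi>" using nice1[OF sepseqD(1)[OF eZ] n] by blast
  have "\<forall>v. \<exists>k. lconst C k \<and> (v \<in> g ` topspace C \<longrightarrow> k ` {c \<in> topspace C. g c = v} = {..<m})"
  proof
    fix v
    show "\<exists>k. lconst C k \<and> (v \<in> g ` topspace C \<longrightarrow> k ` {c \<in> topspace C. g c = v} = {..<m})"
    proof (cases "v \<in> g ` topspace C")
      case True
      then have ne: "{c \<in> topspace C. g c = v} \<noteq> {}" by blast
      have fm: "finite {..<m}" "{..<m} \<noteq> {}" using m by auto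
      from perfect_split[OF C lconstD[OF lg] ne fm]
      obtain k where "lconst C k \<and> k ` {c \<in> topspace C. g c = v} = {..<m}" by (rule exE)
      then show ?thesis by (intro exI[of _ k]) simp
    next
      case False
      then show ?thesis by (intro exI[of _ "\<lambda>_. 0"]) (simp add: lconst_const)
    qed
  qed
  from choice[OF this] obtain s where s0: "\<forall>v. lconst C (s v) \<and> (v \<in> g ` topspace C \<longrightarrow> s v ` {c \<in> topspace C. g c = v} = {..<m})" ..
  have s: "lconst C (s v)" "v \<in> g ` topspace C \<Longrightarrow> s v ` {c \<in> topspace C. g c = v} = {..<m}" for v
    using s0[THEN spec, of v] by simp_all
  define \<iota>' where "\<iota>' w = to_nat (\<iota> (fst w), g (snd w))" for w
  define \<kappa>' where "\<kappa>' w = s (g (snd w)) (snd w)" for w :: "'a \<times> 'c"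
  define p' where "p' w = p (fst w)" for w :: "'a \<times> 'c"
  define \<phi>' where "\<phi>' i x = (case from_nat i :: nat \<times> nat of (i0, v) \<Rightarrow> \<pi> (to_nat (\<phi> i0 x, v)))" for i and x :: int
  have D: "L > 0" "lconst Z (\<lambda>x. (\<iota> x, \<kappa> x))" "lconst Z p"
    "\<And>x. x \<in> topspace Z \<Longrightarrow> (\<iota> (\<tau> x), \<kappa> (\<tau> x)) = (\<iota> x, \<kappa> x) \<and> dedge L (p x) (p (\<tau> x))"
    using niceD(1)[OF N] unfolding dmap_def by blast+
  have l\<iota>: "lconst Z \<iota>" using lconst_comp[OF D(2), of fst] by simp
  have img: "\<iota>' ` topspace (prod_topology Z C) = to_nat ` (\<iota> ` topspace Z \<times> g ` topspace C)"
    unfolding \<iota>'_def by force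
  have "nice (prod_topology Z C) (map_prod \<tau> id) f n m L \<iota>' \<kappa>' p' \<phi>'"
    unfolding nice_def
  proof (intro conjI ballI allI impI)
    show "dmap (prod_topology Z C) (map_prod \<tau> id) L (\<lambda>x. (\<iota>' x, \<kappa>' x)) p'"
      unfolding dmap_def
    proof (intro conjI ballI)
      have "lconst (prod_topology Z C) \<iota>'" unfolding \<iota>'_def[abs_def]
        by (rule lconst_comp[OF lconst_Pair[OF fstc[OF l\<iota>] sndc[OF lg]], where h=to_nat])
      moreover have "lconst C (\<lambda>c. s (g c) c)" by (rule lconst_dep[where h=s, OF lg s(1)])
      then have "lconst (prod_topology Z C) \<kappa>'" unfolding \<kappa>'_def[abs_def] by (rule sndc)
      ultimately show "lconst (prod_topology Z C) (\<lambda>x. (\<iota>' x, \<kappa>' x))" by (rule lconst_Pair)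
      show "lconst (prod_topology Z C) p'" unfolding p'_def[abs_def] by (rule fstc[OF D(3)])
      fix w assume w: "w \<in> topspace (prod_topology Z C)"
      then have "fst w \<in> topspace Z" by auto
      from D(4)[OF this] show "(\<iota>' (map_prod \<tau> id w), \<kappa>' (map_prod \<tau> id w)) = (\<iota>' w, \<kappa>' w)"
          "dedge L (p' w) (p' (map_prod \<tau> id w))" by (simp_all add: \<iota>'_def \<kappa>'_def p'_def)
    qed (rule D(1))
    show "n dvd L" by (rule niceD(2)[OF N])
    show "\<kappa>' w < m" if "w \<in> topspace (prod_topology Z C)" for w
    proof -
      have c: "snd w \<in> topspace C" using that by auto
      then have "s (g (snd w)) (snd w) \<in> {..<m}" using s(2)[of "g (snd w)"] by blast
      then show ?thesis by (simp add: \<kappa>'_def)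
    qed
    show "f w = \<phi>' (\<iota>' w) (p' w)" if "w \<in> topspace (prod_topology Z C)" for w
    proof -
      have "fst w \<in> topspace Z" using that by auto
      from niceD(5)[OF N this] k0[OF that] show ?thesis by (simp add: \<phi>'_def \<iota>'_def p'_def e_def g_def)
    qed
    fix i assume "i \<in> \<iota>' ` topspace (prod_topology Z C)"
    then obtain i0 v where i: "i = to_nat (i0, v)" "i0 \<in> \<iota> ` topspace Z" "v \<in> g ` topspace C" unfolding img by auto
    show "\<exists>w\<in>topspace (prod_topology Z C). \<iota>' w = i \<and> \<kappa>' w = a \<and> p' w = 0" if a: "a < m" for a
    proof -
      obtain z where z: "z \<in> topspace Z" "\<iota> z = i0" "p z = 0" using niceD(6)[OF N i(2), of 0] by auto
      have "a \<in> s v ` {c \<in> topspace C. g c = v}" using s(2)[OF i(3)] a by simp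
      then obtain c where c: "c \<in> topspace C" "g c = v" "s v c = a" by blast
      show ?thesis using z c i(1) by (intro bexI[of _ "(z, c)"]) (simp_all add: \<iota>'_def \<kappa>'_def p'_def)
    qed
    show "\<exists>j\<in>\<iota>' ` topspace (prod_topology Z C). \<forall>x. - 2 * L \<le> x \<and> x < 2 * L \<longrightarrow> \<phi>' j x = \<phi>' i (x mod L - 2 * L)"
    proof -
      obtain j where j: "j \<in> \<iota> ` topspace Z" "\<And>x. - 2 * L \<le> x \<and> x < 2 * L \<Longrightarrow> \<phi> j x = \<phi> i0 (x mod L - 2 * L)"
        using niceD(7)[OF N i(2)] by blast
      have "to_nat (j, v) \<in> \<iota>' ` topspace (prod_topology Z C)" unfolding img using j(1) i(3) by blast
      then show ?thesis by (rule bexI[rotated]) (simp add: \<phi>'_def i(1) j(2))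
    qed
    show "\<exists>j\<in>\<iota>' ` topspace (prod_topology Z C). \<forall>x. - 2 * L \<le> x \<and> x < 2 * L \<longrightarrow> \<phi>' j x = \<phi>' i (x mod L + L)"
    proof -
      obtain j where j: "j \<in> \<iota> ` topspace Z" "\<And>x. - 2 * L \<le> x \<and> x < 2 * L \<Longrightarrow> \<phi> j x = \<phi> i0 (x mod L + L)"
        using niceD(8)[OF N i(2)] by blast
      have "to_nat (j, v) \<in> \<iota>' ` topspace (prod_topology Z C)" unfolding img using j(1) i(3) by blast
      then show ?thesis by (rule bexI[rotated]) (simp add: \<phi>'_def i(1) j(2))
    qed
  qed
  then show "\<exists>L \<iota> \<kappa> p \<phi>. nice (prod_topology Z C) (map_prod \<tau> id) f n m L \<iota> \<kappa> p \<phi>" by blast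
qed

lemma lconst_piece:
  fixes h :: "'a \<Rightarrow> real"
  assumes "finite E" "\<And>e. e \<in> E \<Longrightarrow> lconst X (\<lambda>x. h x < e)" "\<And>e x. e \<in> E \<Longrightarrow> x \<in> topspace X \<Longrightarrow> h x \<noteq> e"
  shows "lconst X (\<lambda>x. piece E (h x))"
proof -
  have "lconst X (\<lambda>x. {e \<in> E. \<not> h x < e})"
    using assms(1,2)
  proof (induction E rule: finite_induct)
    case (insert e E)
    have "lconst X (\<lambda>x. (\<lambda>(b, S). if b then S else insert e S) (h x < e, {e \<in> E. \<not> h x < e}))"
      by (rule lconst_comp[OF lconst_Pair]) (use insert in auto)
    moreover have "(\<lambda>(b, S). if b then S else insert e S) (h x < e, {e \<in> E. \<not> h x < e}) = {e' \<in> insert e E. \<not> h x < e'}" for x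
      by auto
    ultimately show ?case by simp
  qed (simp add: lconst_const)
  from lconst_comp[OF this, of card]
  have "lconst X (\<lambda>x. card {e \<in> E. \<not> h x < e})" .
  moreover have "piece E (h x) = card {e \<in> E. \<not> h x < e}" if "x \<in> topspace X" for x
  proof -
    have "{e \<in> E. e < h x} = {e \<in> E. \<not> h x < e}" using assms(3)[OF _ that] by (auto simp: not_less le_less)
    then show ?thesis by (simp add: piece_def)
  qed
  ultimately show ?thesis using lconst_cong[of X "\<lambda>x. piece E (h x)" "\<lambda>x. card {e \<in> E. \<not> h x < e}"] by blast
qed

context gap_model
begin

lemma snd_mod:
  assumes "z \<in> Z_set q" "m \<ge> 1" "n \<ge> 1" "m dvd n"
  shows "snd z n mod int m = snd z m"
  using Z_set_snd[OF assms(1)] assms(2-) unfolding theta_topspace by blast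

text \<open>Uniform continuity on the compact space Z, by nested closed sets of counterexamples in
  its square. Factorials are used as moduli because they form a divisibility chain cofinal among the
  positive integers: agreement modulo all of them forces equality in the adding machine.\<close>

lemma Z_uniform:
  assumes F: "lconst Z F"
  obtains \<delta> :: real and M :: nat where "\<delta> > 0" "M \<ge> 1"
    "\<And>z z'. z \<in> Z_set q \<Longrightarrow> z' \<in> Z_set q \<Longrightarrow> \<bar>fst z - fst z'\<bar> < \<delta> \<Longrightarrow> snd z M = snd z' M \<Longrightarrow> F z = F z'"
proof (rule ccontr)
  assume neg: "\<not> thesis"
  define C where "C k = {w \<in> topspace (prod_topology Z Z). F (fst w) \<noteq> F (snd w) \<and>
      \<bar>fst (fst w) - fst (snd w)\<bar> \<le> 1 / real (Suc k) \<and> snd (fst w) (fact k) = snd (snd w) (fact k)}" for k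
  have cont: "continuous_map (prod_topology Z Z) euclideanreal (\<lambda>w. \<bar>fst (fst w) - fst (snd w)\<bar>)"
    by (intro continuous_intros continuous_map_compose[OF continuous_map_fst continuous_fst_Z, unfolded comp_def]
        continuous_map_compose[OF continuous_map_snd continuous_fst_Z, unfolded comp_def])
  have "(\<Inter>k. C k) \<noteq> {}"
  proof (rule compact_space_imp_nest)
    show "compact_space (prod_topology Z Z)" using compact_Z by (simp add: compact_space_prod_topology)
    fix k
    have f1: "(1::nat) \<le> fact k" by (simp add: fact_ge_1)
    have 1: "closedin (prod_topology Z Z) {w \<in> topspace (prod_topology Z Z). (\<lambda>(u, v). u \<noteq> v) (F (fst w), F (snd w))}"
      by (rule lconst_closed_vimage[OF lconst_Pair[OF lconst_continuous[OF continuous_map_fst F] lconst_continuous[OF continuous_map_snd F]]])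
    have 2: "closedin (prod_topology Z Z) {w \<in> topspace (prod_topology Z Z). \<bar>fst (fst w) - fst (snd w)\<bar> \<in> {..1 / real (Suc k)}}"
      by (rule closedin_continuous_map_preimage[OF cont]) simp
    have 3: "closedin (prod_topology Z Z) {w \<in> topspace (prod_topology Z Z). (\<lambda>(u, v). u = v) (snd (fst w) (fact k), snd (snd w) (fact k))}"
      by (rule lconst_closed_vimage[OF lconst_Pair[OF lconst_continuous[OF continuous_map_fst lconst_snd_Z[OF f1]]
            lconst_continuous[OF continuous_map_snd lconst_snd_Z[OF f1]]]])
    have "C k = {w \<in> topspace (prod_topology Z Z). (\<lambda>(u, v). u \<noteq> v) (F (fst w), F (snd w))} \<inter>
        {w \<in> topspace (prod_topology Z Z). \<bar>fst (fst w) - fst (snd w)\<bar> \<in> {..1 / real (Suc k)}} \<inter>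
        {w \<in> topspace (prod_topology Z Z). (\<lambda>(u, v). u = v) (snd (fst w) (fact k), snd (snd w) (fact k))}"
      unfolding C_def by auto
    then show "closedin (prod_topology Z Z) (C k)" using closedin_Int[OF closedin_Int[OF 1 2] 3] by simp
    show "C k \<noteq> {}"
    proof
      assume emp: "C k = {}"
      have "F z = F z'" if "z \<in> Z_set q" "z' \<in> Z_set q" "\<bar>fst z - fst z'\<bar> < 1 / real (Suc k)"
          "snd z (fact k) = snd z' (fact k)" for z z'
      proof (rule ccontr)
        assume "F z \<noteq> F z'"
        then have "(z, z') \<in> C k" using that by (simp add: C_def topspace_Z)
        then show False using emp by blast
      qed
      moreover have "0 < 1 / real (Suc k)" by simp
      ultimately show False using neg that[of "1 / real (Suc k)" "fact k"] f1 by blast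
    qed
  next
    show "decseq C"
    proof (intro decseq_SucI subsetI)
      fix k w assume w: "w \<in> C (Suc k)"
      have "1 / real (Suc (Suc k)) \<le> 1 / real (Suc k)" by (simp add: frac_le)
      moreover have "snd z (fact k) = snd z (fact (Suc k)) mod int (fact k)" if "z \<in> Z_set q" for z
        by (rule snd_mod[OF that fact_ge_1 fact_ge_1 fact_dvd, symmetric]) simp
      moreover have "fst w \<in> Z_set q" "snd w \<in> Z_set q" using w by (auto simp: C_def topspace_Z)
      ultimately show "w \<in> C k" using w unfolding C_def by (auto intro: order_trans)
    qed
  qed
  then obtain w where w: "\<And>k. w \<in> C k" by blast
  have wZ: "fst w \<in> Z_set q" "snd w \<in> Z_set q" using w[of 0] by (auto simp: C_def topspace_Z)
  have "\<bar>fst (fst w) - fst (snd w)\<bar> \<le> 0"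
  proof (rule ccontr)
    assume "\<not> \<bar>fst (fst w) - fst (snd w)\<bar> \<le> 0"
    then obtain k where "1 / real (Suc k) < \<bar>fst (fst w) - fst (snd w)\<bar>"
      using nat_approx_posE[of "\<bar>fst (fst w) - fst (snd w)\<bar>"] by auto
    then show False using w[of k] by (simp add: C_def)
  qed
  moreover have "snd (fst w) = snd (snd w)"
  proof (rule theta_eqI[OF Z_set_snd[OF wZ(1)] Z_set_snd[OF wZ(2)]])
    fix m :: nat assume m: "m \<ge> 1"
    then have "m dvd fact m" by (simp add: dvd_fact)
    then show "snd (fst w) m = snd (snd w) m"
      using snd_mod[OF wZ(1) m, of "fact m"] snd_mod[OF wZ(2) m, of "fact m"] w[of m] by (simp add: C_def fact_ge_1)
  qed
  ultimately have "fst w = snd w" by (simp add: prod_eq_iff)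
  then show False using w[of 0] by (simp add: C_def)
qed

text \<open>Each piece of a fine cutting becomes one dumbbell. Its bar is a central segment of the
  gap sequence; the ends of that sequence join the adding machines near them in the loops, where the
  vertex is the residue modulo \<open>L\<close>.\<close>

lemma Z_nice:
  fixes F :: "real \<times> (nat \<Rightarrow> int) \<Rightarrow> nat"
  assumes F: "lconst Z F" and n: "n > 0"
  shows "\<exists>L \<iota> \<kappa> p \<phi>. nice Z tau F n 1 L \<iota> \<kappa> p \<phi>"
proof -
  obtain \<delta> :: real and M :: nat where \<delta>: "\<delta> > 0" and M: "M \<ge> 1" and
    uc: "\<And>z z'. z \<in> Z_set q \<Longrightarrow> z' \<in> Z_set q \<Longrightarrow> \<bar>fst z - fst z'\<bar> < \<delta> \<Longrightarrow> snd z M = snd z' M \<Longrightarrow> F z = F z'"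
    by (rule Z_uniform[OF F]) (rule that; assumption)
  \<comment> \<open>Two points within \<open>\<delta> / 2\<close> of the same end of a gap are
    within \<open>\<delta>\<close> of each other.\<close>
  have d2: "\<delta> / 2 > 0" using \<delta> by simp
  define Q where "Q E i j \<longleftrightarrow> bar_of E (\<delta> / 2) i j \<and>
      (\<exists>c\<in>D_set. \<forall>b\<in>D_set. piece E b = piece E c \<longrightarrow> \<bar>b - Inf j\<bar> < \<delta> / 2) \<and>
      (\<exists>c\<in>D_set. \<forall>b\<in>D_set. piece E b = piece E c \<longrightarrow> \<bar>b - Sup j\<bar> < \<delta> / 2)" for E i j
  have "\<exists>E. finite E \<and> E \<inter> D_set = {} \<and> (\<forall>a\<in>D_set. \<exists>j. Q E (piece E a) j)"
  proof (rule cuts_with_neighbours[OF d2], goal_cases)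
    case (1 E)
    have "\<exists>j. Q E (piece E a) j" if "a \<in> D_set" for a unfolding Q_def by (rule 1(3)[OF that])
    then show ?case using 1(1,2) by blast
  qed
  then obtain E where E: "finite E" "E \<inter> D_set = {}" "\<And>a. a \<in> D_set \<Longrightarrow> \<exists>j. Q E (piece E a) j" by blast
  define J where "J i = (SOME j. Q E i j)" for i
  have J: "Q E (piece E a) (J (piece E a))" if "a \<in> D_set" for a
    unfolding J_def using E(3)[OF that] by (rule someI_ex)
  define I where "I = piece E ` D_set"
  have finI: "finite I"
  proof -
    have "I \<subseteq> {..card E}" unfolding I_def piece_def using E(1) by (auto intro!: card_mono)
    then show ?thesis using finite_subset by blast
  qed
  have JI: "J i \<in> D_gaps" "piece E (Inf (J i)) = i"
    "\<And>b. b \<in> D_set \<Longrightarrow> piece E b = i \<Longrightarrow> b \<le> Inf (J i) \<Longrightarrow> Inf (J i) - b < \<delta> / 2"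
    "\<And>b. b \<in> D_set \<Longrightarrow> piece E b = i \<Longrightarrow> Sup (J i) \<le> b \<Longrightarrow> b - Sup (J i) < \<delta> / 2"
    "\<exists>c\<in>D_set. \<forall>b\<in>D_set. piece E b = piece E c \<longrightarrow> \<bar>b - Inf (J i)\<bar> < \<delta> / 2"
    "\<exists>c\<in>D_set. \<forall>b\<in>D_set. piece E b = piece E c \<longrightarrow> \<bar>b - Sup (J i)\<bar> < \<delta> / 2" if "i \<in> I" for i
  proof -
    have "Q E i (J i)" using J that unfolding I_def by blast
    then show "J i \<in> D_gaps" "piece E (Inf (J i)) = i"
      "\<And>b. b \<in> D_set \<Longrightarrow> piece E b = i \<Longrightarrow> b \<le> Inf (J i) \<Longrightarrow> Inf (J i) - b < \<delta> / 2"
      "\<And>b. b \<in> D_set \<Longrightarrow> piece E b = i \<Longrightarrow> Sup (J i) \<le> b \<Longrightarrow> b - Sup (J i) < \<delta> / 2"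
      "\<exists>c\<in>D_set. \<forall>b\<in>D_set. piece E b = piece E c \<longrightarrow> \<bar>b - Inf (J i)\<bar> < \<delta> / 2"
      "\<exists>c\<in>D_set. \<forall>b\<in>D_set. piece E b = piece E c \<longrightarrow> \<bar>b - Sup (J i)\<bar> < \<delta> / 2"
      unfolding Q_def bar_of_def by blast+
  qed
  have ZD: "fst z \<in> D_set" if "z \<in> Z_set q" for z using Z_set_fst[OF that] coords_D by blast
  have ZI: "piece E (fst z) \<in> I" if "z \<in> Z_set q" for z using ZD[OF that] by (simp add: I_def)
  have "\<forall>i\<in>I. \<exists>N. (\<forall>x\<ge>N. Sup (J i) - \<delta> / 2 < q (J i) x) \<and> (\<forall>x\<le>- N. q (J i) x < Inf (J i) + \<delta> / 2)"
  proof
    fix i assume i: "i \<in> I"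
    obtain N where "\<And>x. x \<ge> N \<Longrightarrow> Sup (J i) - \<delta> / 2 < q (J i) x" "\<And>x. x \<le> - N \<Longrightarrow> q (J i) x < Inf (J i) + \<delta> / 2"
      by (rule q_limits[OF JI(1)[OF i] d2]) (rule that; assumption)
    then show "\<exists>N. (\<forall>x\<ge>N. Sup (J i) - \<delta> / 2 < q (J i) x) \<and> (\<forall>x\<le>- N. q (J i) x < Inf (J i) + \<delta> / 2)" by blast
  qed
  from bchoice[OF this] obtain N where N: "\<And>i x. i \<in> I \<Longrightarrow> x \<ge> N i \<Longrightarrow> Sup (J i) - \<delta> / 2 < q (J i) x"
      "\<And>i x. i \<in> I \<Longrightarrow> x \<le> - N i \<Longrightarrow> q (J i) x < Inf (J i) + \<delta> / 2" by blast
  \<comment> \<open>The sum bounds all thresholds \<open>N i\<close> at once, so beyond time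
    \<open>L\<close> every gap sequence is close to its ends.\<close>
  define K where "K = (\<Sum>i\<in>I. \<bar>N i\<bar>)"
  have NK: "N i \<le> K" if "i \<in> I" for i
  proof -
    have "\<bar>N i\<bar> \<le> K" unfolding K_def using finI that by (intro member_le_sum) auto
    then show ?thesis by linarith
  qed
  have K0: "K \<ge> 0" by (simp add: K_def sum_nonneg)
  \<comment> \<open>Divisibility by \<open>n\<close> is demanded by \<open>nice\<close>,
    divisibility by \<open>M\<close> makes positions in a loop determine residues modulo
    \<open>M\<close>, and the last factor puts \<open>L\<close> above \<open>K\<close>.\<close>
  define L where "L = n * int M * (K + 1)"
  have L: "L > 0" "n dvd L" "int M dvd L" using n M K0 by (simp_all add: L_def)
  have LK: "K < L"
  proof -
    have "1 \<le> n * int M" using n M by (simp add: int_one_le_iff_zero_less)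
    then have "1 * (K + 1) \<le> n * int M * (K + 1)" using K0 by (intro mult_right_mono) auto
    then show ?thesis by (simp add: L_def)
  qed
  define l where "l = nat L"
  have l: "int l = L" "l \<ge> 1" "2 * l \<ge> 1" using L by (simp_all add: l_def)
  have Ml: "M dvd l" using L(3) l(1) by (metis int_dvd_int_iff)
  \<comment> \<open>The two cuts inside the gap isolate exactly the times from \<open>- L\<close> to
    \<open>L - 1\<close>, which form the bar.\<close>
  define eL where "eL i = (q (J i) (- L - 1) + q (J i) (- L)) / 2" for i
  define eR where "eR i = (q (J i) (L - 1) + q (J i) L) / 2" for i
  have eL: "q (J i) (- L - 1) < eL i" "eL i < q (J i) (- L)" if "i \<in> I" for i
    using q_less[OF JI(1)[OF that], of "- L - 1" "- L"] by (simp_all add: eL_def)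
  have eR: "q (J i) (L - 1) < eR i" "eR i < q (J i) L" if "i \<in> I" for i
    using q_less[OF JI(1)[OF that], of "L - 1" L] by (simp_all add: eR_def)
  \<comment> \<open>In the loops the residue modulo \<open>L\<close> gives the vertex. The bar has
    \<open>2 * L\<close> vertices, so there the residue modulo \<open>2 * L\<close>, recentred
    around \<open>0\<close>, recovers the time.\<close>
  define h where "h = (\<lambda>((a, b), (s, t)). if a then s - 2 * L else if \<not> b then s + L else if t < L then t else t - 2 * L)"
  define \<iota> where "\<iota> z = piece E (fst z)" for z :: "real \<times> (nat \<Rightarrow> int)"
  define P where "P i z = (if i \<in> I then h ((fst z < eL i, fst z < eR i), (snd z l, snd z (2 * l))) else 0)"
    for i and z :: "real \<times> (nat \<Rightarrow> int)"
  define p where "p z = P (\<iota> z) z" for z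
  have l\<iota>: "lconst Z \<iota>" unfolding \<iota>_def[abs_def]
  proof (rule lconst_piece[OF E(1)])
    show "lconst Z (\<lambda>z. fst z < e)" if "e \<in> E" for e
      by (rule lconst_fst_Z) (use that E(2) coords_D in blast)
    show "fst z \<noteq> e" if "e \<in> E" "z \<in> topspace Z" for e z
      using that ZD[of z] E(2) unfolding topspace_Z by blast
  qed
  have lP: "lconst Z (P i)" for i
  proof (cases "i \<in> I")
    case True
    have nL: "eL i \<notin> coords" using between_q_notin_coords(1)[OF JI(1)[OF True], of "- L - 1"] eL[OF True] by simp
    have nR: "eR i \<notin> coords" using between_q_notin_coords(1)[OF JI(1)[OF True], of "L - 1"] eR[OF True] by simp
    have "lconst Z (\<lambda>z. h ((fst z < eL i, fst z < eR i), (snd z l, snd z (2 * l))))"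
      by (rule lconst_comp[OF lconst_Pair[OF lconst_Pair[OF lconst_fst_Z[OF nL] lconst_fst_Z[OF nR]]
            lconst_Pair[OF lconst_snd_Z[OF l(2)] lconst_snd_Z[OF l(3)]]], where h=h])
    then show ?thesis using True by (simp add: P_def[abs_def])
  next
    case False
    then show ?thesis by (simp add: P_def[abs_def] lconst_const)
  qed
  have lp: "lconst Z p" unfolding p_def[abs_def] by (rule lconst_dep[where h=P, OF l\<iota> lP])
  have p_left: "p z = snd z l - 2 * L" if z: "z \<in> Z_set q" and s: "fst z \<le> Inf (J (\<iota> z))" for z
  proof -
    have i: "\<iota> z \<in> I" using ZI[OF z] by (simp add: \<iota>_def)
    have "fst z < eL (\<iota> z)" using s eL(1)[OF i] q_bounds(1)[OF JI(1)[OF i], of "- L - 1"] by linarith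
    then show ?thesis using i by (simp add: p_def P_def h_def)
  qed
  have p_right: "p z = snd z l + L" if z: "z \<in> Z_set q" and s: "Sup (J (\<iota> z)) \<le> fst z" for z
  proof -
    have i: "\<iota> z \<in> I" using ZI[OF z] by (simp add: \<iota>_def)
    have "\<not> fst z < eR (\<iota> z)" using s eR(2)[OF i] q_bounds(2)[OF JI(1)[OF i], of L] by linarith
    moreover have "q (J (\<iota> z)) (- L) < q (J (\<iota> z)) L" using q_less[OF JI(1)[OF i]] L by simp
    then have "\<not> fst z < eL (\<iota> z)" using s eL(2)[OF i] q_bounds(2)[OF JI(1)[OF i], of L] by linarith
    ultimately show ?thesis using i by (simp add: p_def P_def h_def)
  qed
  have \<iota>_gap: "\<iota> (q (J i) x, t) = i" if "i \<in> I" for i x t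
    using piece_gap[OF E(2) JI(1)[OF that], of "q (J i) x"] q_bounds[OF JI(1)[OF that], of x] JI(2)[OF that]
    by (simp add: \<iota>_def)
  have p_gap: "p (q (J i) x, theta_of_int x) = cw L x" if i: "i \<in> I" for i x
  proof -
    note ql = q_less[OF JI(1)[OF i]]
    have a: "q (J i) x < eL i \<longleftrightarrow> x < - L"
      using eL[OF i] ql[of x "- L"] ql[of "- L - 1" x] ql[of "- L" x] ql[of x "- L - 1"] by (smt (verit))
    have b: "q (J i) x < eR i \<longleftrightarrow> x < L"
      using eR[OF i] ql[of x L] ql[of "L - 1" x] ql[of L x] ql[of x "L - 1"] by (smt (verit))
    have t: "theta_of_int x l = x mod L" "theta_of_int x (2 * l) = x mod (2 * L)"
      using theta_of_int_apply[OF l(2)] theta_of_int_apply[OF l(3)] l(1) by simp_all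
    have "x mod (2 * L) = (if x \<ge> 0 then x else x + 2 * L)" if "- L \<le> x" "x < L"
      using mod_eqI_shift[of x 0 "2 * L"] mod_eqI_shift[of x 1 "2 * L"] that L(1) by auto
    then show ?thesis using i \<iota>_gap[OF i] a b t L(1) by (auto simp: p_def P_def h_def cw_def)
  qed
  have side: "fst z \<le> Inf (J (\<iota> z)) \<or> Sup (J (\<iota> z)) \<le> fst z \<or> (\<exists>x. z = (q (J (\<iota> z)) x, theta_of_int x))"
    if z: "z \<in> Z_set q" for z
    by (rule Z_side[OF z JI(1)]) (use ZI[OF z] in \<open>simp add: \<iota>_def\<close>)
  have \<iota>_tau: "\<iota> (tau z) = \<iota> z" if z: "z \<in> Z_set q" for z
    using z
  proof (cases rule: Z_cases)
    case (C a t) then show ?thesis by (simp add: tau_C \<iota>_def)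
  next
    case (gap j x)
    have "piece E (q j y) = piece E (Inf j)" for y
      using piece_gap[OF E(2) gap(2), of "q j y"] q_bounds[OF gap(2), of y] by simp
    from this[of x] this[of "x + 1"] show ?thesis using gap by (simp add: tau_gap \<iota>_def)
  qed
  have snd_l: "snd (tau z) l = (if snd z l = L - 1 then 0 else snd z l + 1)" "0 \<le> snd z l" "snd z l < L" if z: "z \<in> Z_set q" for z
  proof -
    have b: "0 \<le> snd z l \<and> snd z l < int l" using Z_set_snd[OF z] l(2) unfolding theta_topspace by blast
    then show "0 \<le> snd z l" "snd z l < L" using l(1) by simp_all
    have "snd z l mod L = snd z l" using b l(1) by simp
    then show "snd (tau z) l = (if snd z l = L - 1 then 0 else snd z l + 1)"
      using snd_tau_apply[OF z l(2)] mod_add_one[OF L(1), of "snd z l"] l(1) by simp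
  qed
  have edge: "dedge L (p z) (p (tau z))" if z: "z \<in> Z_set q" for z
  proof -
    note tz = tau_in[OF z]
    have j: "J (\<iota> z) \<in> D_gaps" using JI(1) ZI[OF z] by (simp add: \<iota>_def)
    consider "fst z \<le> Inf (J (\<iota> z))" | "Sup (J (\<iota> z)) \<le> fst z" | x where "z = (q (J (\<iota> z)) x, theta_of_int x)" using side[OF z] by blast
    then show ?thesis
    proof cases
      case 1
      have "p (tau z) = snd (tau z) l - 2 * L" using p_left[OF tz] fst_tau_side(1)[OF z j 1] \<iota>_tau[OF z] by simp
      then show ?thesis using p_left[OF z 1] snd_l[OF z] L(1) by (auto simp: dedge_def)
    next
      case 2
      have "p (tau z) = snd (tau z) l + L" using p_right[OF tz] fst_tau_side(2)[OF z j 2] \<iota>_tau[OF z] by simp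
      then show ?thesis using p_right[OF z 2] snd_l[OF z] L(1) by (auto simp: dedge_def)
    next
      case 3
      have i: "\<iota> z \<in> I" using ZI[OF z] by (simp add: \<iota>_def)
      have "p z = cw L x" using p_gap[OF i, of x] 3 by simp
      moreover have "tau z = (q (J (\<iota> z)) (x + 1), theta_of_int (x + 1))" using tau_gap[OF j] 3 by metis
      then have "p (tau z) = cw L (x + 1)" using p_gap[OF i, of "x + 1"] by simp
      ultimately show ?thesis using cw_edge[OF L(1), of x] by simp
    qed
  qed
  \<comment> \<open>The left loop consists of points of the piece left of the gap, close to it by
    the choice of the bar, and of gap points before time \<open>- L\<close>, close to the end by the
    choice of \<open>K\<close>.\<close>
  have near_left: "\<bar>fst z - Inf (J (\<iota> z))\<bar> < \<delta> / 2 \<and> snd z l = p z + 2 * L" if z: "z \<in> Z_set q" and pz: "p z < - L" for z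
  proof -
    have i: "\<iota> z \<in> I" using ZI[OF z] by (simp add: \<iota>_def)
    consider "fst z \<le> Inf (J (\<iota> z))" | "Sup (J (\<iota> z)) \<le> fst z" | x where "z = (q (J (\<iota> z)) x, theta_of_int x)" using side[OF z] by blast
    then show ?thesis
    proof cases
      case 1
      then show ?thesis using p_left[OF z 1] JI(3)[OF i ZD[OF z]] by (simp add: \<iota>_def)
    next
      case 2
      then show ?thesis using p_right[OF z 2] snd_l(2)[OF z] pz L(1) by simp
    next
      case 3
      have px: "p z = cw L x" using p_gap[OF i, of x] 3 by simp
      obtain r where "x mod L = r" "0 \<le> r" "r < L" using mod_obtain[OF L(1)] .
      then have x: "x < - L" using pz L(1) unfolding px cw_def by (auto split: if_splits)
      have "x \<le> - N (\<iota> z)" using x NK[OF i] LK by linarith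
      then have "q (J (\<iota> z)) x < Inf (J (\<iota> z)) + \<delta> / 2" by (rule N(2)[OF i])
      moreover have "Inf (J (\<iota> z)) < q (J (\<iota> z)) x" by (rule q_bounds(1)[OF JI(1)[OF i]])
      moreover have "fst z = q (J (\<iota> z)) x" "snd z = theta_of_int x" using 3 by (metis fst_conv, metis snd_conv)
      moreover have "theta_of_int x l = x mod L" using theta_of_int_apply[OF l(2)] l(1) by simp
      ultimately show ?thesis using px x by (simp add: cw_def)
    qed
  qed
  have near_right: "\<bar>fst z - Sup (J (\<iota> z))\<bar> < \<delta> / 2 \<and> snd z l = p z - L" if z: "z \<in> Z_set q" and pz: "L \<le> p z" for z
  proof -
    have i: "\<iota> z \<in> I" using ZI[OF z] by (simp add: \<iota>_def)
    consider "fst z \<le> Inf (J (\<iota> z))" | "Sup (J (\<iota> z)) \<le> fst z" | x where "z = (q (J (\<iota> z)) x, theta_of_int x)" using side[OF z] by blast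
    then show ?thesis
    proof cases
      case 1
      then show ?thesis using p_left[OF z 1] snd_l(3)[OF z] pz L(1) by simp
    next
      case 2
      then show ?thesis using p_right[OF z 2] JI(4)[OF i ZD[OF z]] by (simp add: \<iota>_def)
    next
      case 3
      have px: "p z = cw L x" using p_gap[OF i, of x] 3 by simp
      obtain r where "x mod L = r" "0 \<le> r" "r < L" using mod_obtain[OF L(1)] .
      then have x: "L \<le> x" using pz L(1) unfolding px cw_def by (auto split: if_splits)
      have "N (\<iota> z) \<le> x" using x NK[OF i] LK by linarith
      then have "Sup (J (\<iota> z)) - \<delta> / 2 < q (J (\<iota> z)) x" by (rule N(1)[OF i])
      moreover have "q (J (\<iota> z)) x < Sup (J (\<iota> z))" by (rule q_bounds(2)[OF JI(1)[OF i]])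
      moreover have "fst z = q (J (\<iota> z)) x" "snd z = theta_of_int x" using 3 by (metis fst_conv, metis snd_conv)
      moreover have "theta_of_int x l = x mod L" using theta_of_int_apply[OF l(2)] l(1) by simp
      ultimately show ?thesis using px x L(1) by (simp add: cw_def)
    qed
  qed
  have middle: "z = (q (J (\<iota> z)) (p z), theta_of_int (p z))" if z: "z \<in> Z_set q" and pz: "- L \<le> p z" "p z < L" for z
  proof -
    have i: "\<iota> z \<in> I" using ZI[OF z] by (simp add: \<iota>_def)
    consider "fst z \<le> Inf (J (\<iota> z))" | "Sup (J (\<iota> z)) \<le> fst z" | x where "z = (q (J (\<iota> z)) x, theta_of_int x)" using side[OF z] by blast
    then show ?thesis
    proof cases
      case 1
      then show ?thesis using p_left[OF z 1] snd_l(3)[OF z] pz L(1) by simp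
    next
      case 2
      then show ?thesis using p_right[OF z 2] snd_l(2)[OF z] pz L(1) by simp
    next
      case 3
      have px: "p z = cw L x" using p_gap[OF i, of x] 3 by simp
      obtain r where "x mod L = r" "0 \<le> r" "r < L" using mod_obtain[OF L(1)] .
      then have "p z = x" using pz unfolding px cw_def by (auto split: if_splits)
      then show ?thesis using 3 by simp
    qed
  qed
  have snd_M: "snd z M = snd z l mod int M" if "z \<in> Z_set q" for z using snd_mod[OF that M l(2) Ml] by simp
  \<comment> \<open>A bar cell is a single point. In a loop cell the points are
    \<open>\<delta>\<close>-close and agree modulo \<open>M\<close>, so \<open>F\<close> cannot tell
    them apart.\<close>
  have "\<forall>z\<in>Z_set q. \<forall>z'\<in>Z_set q. (\<iota> z, p z) = (\<iota> z', p z') \<longrightarrow> F z = F z'"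
  proof (intro ballI impI)
    fix z z' assume z: "z \<in> Z_set q" "z' \<in> Z_set q" and "(\<iota> z, p z) = (\<iota> z', p z')"
    then have eq: "\<iota> z = \<iota> z'" "p z = p z'" by simp_all
    consider "p z < - L" | "L \<le> p z" | "- L \<le> p z" "p z < L" by linarith
    then show "F z = F z'"
    proof cases
      case 1
      have a: "\<bar>fst z - Inf (J (\<iota> z))\<bar> < \<delta> / 2 \<and> snd z l = snd z' l"
          "\<bar>fst z' - Inf (J (\<iota> z))\<bar> < \<delta> / 2"
        using near_left[OF z(1) 1] near_left[OF z(2)] 1 unfolding eq by auto
      then have "\<bar>fst z - fst z'\<bar> < \<delta>" by linarith
      moreover have "snd z l = snd z' l" using a(1) by blast
      ultimately show ?thesis using uc[OF z] snd_M[OF z(1)] snd_M[OF z(2)] by simp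
    next
      case 2
      have a: "\<bar>fst z - Sup (J (\<iota> z))\<bar> < \<delta> / 2 \<and> snd z l = snd z' l"
          "\<bar>fst z' - Sup (J (\<iota> z))\<bar> < \<delta> / 2"
        using near_right[OF z(1) 2] near_right[OF z(2)] 2 unfolding eq by auto
      then have "\<bar>fst z - fst z'\<bar> < \<delta>" by linarith
      moreover have "snd z l = snd z' l" using a(1) by blast
      ultimately show ?thesis using uc[OF z] snd_M[OF z(1)] snd_M[OF z(2)] by simp
    next
      case 3
      then have "z = z'" using middle[OF z(1) 3] middle[OF z(2)] eq by metis
      then show ?thesis by simp
    qed
  qed
  from factor_through[OF this] obtain \<Phi> where \<Phi>: "\<And>z. z \<in> Z_set q \<Longrightarrow> F z = \<Phi> (\<iota> z, p z)" by blast
  have img: "\<iota> ` topspace Z = I"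
  proof (intro equalityI subsetI)
    fix i assume "i \<in> \<iota> ` topspace Z"
    then show "i \<in> I" using ZI unfolding topspace_Z \<iota>_def by blast
  next
    fix i assume i: "i \<in> I"
    have "\<iota> (q (J i) 0, theta_of_int 0) = i" by (rule \<iota>_gap[OF i])
    then show "i \<in> \<iota> ` topspace Z" using Z_set_gap[OF JI(1)[OF i], of 0] unfolding topspace_Z by force
  qed
  \<comment> \<open>In this range \<open>cw L x = x\<close>, so vertex \<open>x\<close> is occupied
    by the gap point of time \<open>x\<close>, and the label can be computed there.\<close>
  have \<Phi>_gap: "\<Phi> (i, x) = F (q (J i) x, theta_of_int x)" if i: "i \<in> I" and x: "- 2 * L \<le> x" "x < 2 * L" for i x
    using \<Phi>[OF Z_set_gap[OF JI(1)[OF i], of x]] \<iota>_gap[OF i] p_gap[OF i] cw_id[OF x] by simp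
  have gapZ: "(q (J i) x, theta_of_int x) \<in> Z_set q" if "i \<in> I" for i x by (rule Z_set_gap[OF JI(1)[OF that]])
  have modM: "(x mod L + k * L) mod int M = x mod int M" for x k
  proof -
    have "(x mod L + k * L) mod int M = (x mod L) mod int M"
      using L(3) by (metis dvd_mult mod_add_right_eq dvd_imp_mod_0 add.right_neutral)
    then show ?thesis using L(3) by (simp add: mod_mod_cancel)
  qed
  have "nice Z tau F n 1 L \<iota> (\<lambda>_. 0) p (\<lambda>i x. \<Phi> (i, x))"
    unfolding nice_def img
  proof (intro conjI ballI allI impI)
    show "dmap Z tau L (\<lambda>x. (\<iota> x, 0 :: nat)) p"
      unfolding dmap_def topspace_Z using L(1) lconst_Pair[OF l\<iota> lconst_const] lp \<iota>_tau edge by simp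
    show "F z = \<Phi> (\<iota> z, p z)" if "z \<in> topspace Z" for z using \<Phi> that unfolding topspace_Z .
    fix i assume i: "i \<in> I"
    show "\<exists>x\<in>topspace Z. \<iota> x = i \<and> 0 = a \<and> p x = 0" if "a < 1" for a :: nat
      using that gapZ[OF i, of 0] \<iota>_gap[OF i, of 0] p_gap[OF i, of 0] L(1) unfolding topspace_Z
      by (intro bexI[of _ "(q (J i) 0, theta_of_int 0)"]) (simp_all add: cw_def)
    \<comment> \<open>The neighbouring piece at the left end of the bar supplies \<open>j\<close>:
      its whole gap sequence stays near that end, as the left loop of \<open>i\<close> does, and
      folding by \<open>L\<close> preserves residues modulo \<open>M\<close>.\<close>
    show "\<exists>j\<in>I. \<forall>x. - 2 * L \<le> x \<and> x < 2 * L \<longrightarrow> \<Phi> (j, x) = \<Phi> (i, x mod L - 2 * L)"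
    proof -
      obtain c where c: "c \<in> D_set" "\<And>b. b \<in> D_set \<Longrightarrow> piece E b = piece E c \<Longrightarrow> \<bar>b - Inf (J i)\<bar> < \<delta> / 2"
        using JI(5)[OF i] by blast
      define j where "j = piece E c"
      have j: "j \<in> I" using c(1) by (simp add: j_def I_def)
      have "\<Phi> (j, x) = \<Phi> (i, x mod L - 2 * L)" if x: "- 2 * L \<le> x" "x < 2 * L" for x
      proof -
        define y where "y = x mod L - 2 * L"
        have y: "- 2 * L \<le> y" "y < - L" "y < 2 * L"
          using pos_mod_sign[OF L(1), of x] pos_mod_bound[OF L(1), of x] L(1) unfolding y_def by linarith+
        have "\<bar>q (J j) x - Inf (J i)\<bar> < \<delta> / 2"
        proof (rule c(2))
          show "q (J j) x \<in> D_set" using ZD[OF gapZ[OF j]] by simp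
          show "piece E (q (J j) x) = piece E c" using \<iota>_gap[OF j, of x] by (simp add: \<iota>_def j_def)
        qed
        moreover have "\<bar>q (J i) y - Inf (J i)\<bar> < \<delta> / 2"
          using near_left[OF gapZ[OF i, of y]] p_gap[OF i, of y] \<iota>_gap[OF i] cw_id[OF y(1,3)] y(2) by simp
        moreover have "theta_of_int x M = theta_of_int y M"
          using modM[of x "- 2"] by (simp add: theta_of_int_apply[OF M] y_def)
        ultimately have "\<bar>q (J j) x - q (J i) y\<bar> < \<delta>" "theta_of_int x M = theta_of_int y M" by linarith+
        then have "F (q (J j) x, theta_of_int x) = F (q (J i) y, theta_of_int y)"
          using uc[OF gapZ[OF j] gapZ[OF i], of x y] by simp
        then show ?thesis using \<Phi>_gap[OF j x] \<Phi>_gap[OF i y(1,3)] by (simp add: y_def)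
      qed
      then show ?thesis using j by blast
    qed
    show "\<exists>j\<in>I. \<forall>x. - 2 * L \<le> x \<and> x < 2 * L \<longrightarrow> \<Phi> (j, x) = \<Phi> (i, x mod L + L)"
    proof -
      obtain c where c: "c \<in> D_set" "\<And>b. b \<in> D_set \<Longrightarrow> piece E b = piece E c \<Longrightarrow> \<bar>b - Sup (J i)\<bar> < \<delta> / 2"
        using JI(6)[OF i] by blast
      define j where "j = piece E c"
      have j: "j \<in> I" using c(1) by (simp add: j_def I_def)
      have "\<Phi> (j, x) = \<Phi> (i, x mod L + L)" if x: "- 2 * L \<le> x" "x < 2 * L" for x
      proof -
        define y where "y = x mod L + L"
        have y: "- 2 * L \<le> y" "L \<le> y" "y < 2 * L"
          using pos_mod_sign[OF L(1), of x] pos_mod_bound[OF L(1), of x] L(1) unfolding y_def by linarith+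
        have "\<bar>q (J j) x - Sup (J i)\<bar> < \<delta> / 2"
        proof (rule c(2))
          show "q (J j) x \<in> D_set" using ZD[OF gapZ[OF j]] by simp
          show "piece E (q (J j) x) = piece E c" using \<iota>_gap[OF j, of x] by (simp add: \<iota>_def j_def)
        qed
        moreover have "\<bar>q (J i) y - Sup (J i)\<bar> < \<delta> / 2"
          using near_right[OF gapZ[OF i, of y]] p_gap[OF i, of y] \<iota>_gap[OF i] cw_id[OF y(1,3)] y(2) by simp
        moreover have "theta_of_int x M = theta_of_int y M"
          using modM[of x 1] by (simp add: theta_of_int_apply[OF M] y_def)
        ultimately have "\<bar>q (J j) x - q (J i) y\<bar> < \<delta>" "theta_of_int x M = theta_of_int y M" by linarith+
        then have "F (q (J j) x, theta_of_int x) = F (q (J i) y, theta_of_int y)"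
          using uc[OF gapZ[OF j] gapZ[OF i], of x y] by simp
        then show ?thesis using \<Phi>_gap[OF j x] \<Phi>_gap[OF i y(1,3)] by (simp add: y_def)
      qed
      then show ?thesis using j by blast
    qed
  qed (use L(2) in simp_all)
  then show ?thesis by blast
qed

section \<open>The Cantor factor and the product system\<close>

lemma cantor_set_zdc: "zdc (top_of_set cantor_set)" and cantor_set_perfect: "perfect (top_of_set cantor_set)"
proof -
  have c: "compact_space (top_of_set cantor_set)" using compact_cantor_set by (simp add: compact_space_subtopology)
  have cont: "continuous_map (top_of_set cantor_set) euclideanreal (\<lambda>x. x)"
    by (rule continuous_map_from_subtopology) simp
  show "zdc (top_of_set cantor_set)"
  proof (rule zdcI[OF c, of "\<lambda>rs x. x < cut_at rs"])
    show "lconst (top_of_set cantor_set) (\<lambda>x. x < cut_at rs)" for rs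
      by (rule lconst_less_cut[OF cont]) (use cut_at(1)[of rs] in \<open>auto simp: coords_def\<close>)
    fix x y :: real assume "x \<noteq> y"
    then consider "x < y" | "y < x" by linarith
    then show "\<exists>rs. (x < cut_at rs) \<noteq> (y < cut_at rs)"
    proof cases
      case 1 then show ?thesis using cut_at_between[of x y] by force
    next
      case 2 then show ?thesis using cut_at_between[of y x] by force
    qed
  qed
  show "perfect (top_of_set cantor_set)"
    unfolding perfect_def
  proof (intro ballI notI)
    fix x assume x: "x \<in> topspace (top_of_set cantor_set)" and o: "openin (top_of_set cantor_set) {x}"
    have xC: "x \<in> cantor_set" using x by simp
    obtain T where T: "open T" "{x} = cantor_set \<inter> T" using o by (auto simp: openin_open)
    then obtain d where d: "d > 0" "ball x d \<subseteq> T" using openE[of T x] by blast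
    \<comment> \<open>A retained gap inside the ball has two distinct ends, both in the Cantor set,
      so \<open>x\<close> is not isolated.\<close>
    obtain j where j: "j \<in> D_gaps" "x - d < Inf j" "Sup j < x + d" using gap_near[OF xC d(1)] .
    have "Inf j < Sup j" by (rule gap_interval(1)[OF j(1)])
    then have "Inf j \<in> ball x d" "Sup j \<in> ball x d" using j(2,3) by (auto simp: dist_real_def)
    then have "Inf j \<in> {x}" "Sup j \<in> {x}" using d(2) gap_facts(1,2)[OF j(1)] unfolding T(2) by blast+
    then show False using \<open>Inf j < Sup j\<close> by simp
  qed
qed

lemma zdc_X_DC: "zdc (X_DC q)"
  unfolding X_DC_def by (rule zdc_prod[OF zdc_Z cantor_set_zdc])

lemma universal_X_DC: "universal (X_DC q) (T_DC q)"
  unfolding X_DC_def T_DC_def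
  by (rule universal_times[OF compact_Z zdc_Z cantor_set_zdc cantor_set_perfect Z_nice])

lemma homeomorphic_T_DC: "homeomorphic_map (X_DC q) (X_DC q) (T_DC q)"
proof -
  obtain g where g: "homeomorphic_maps Z Z tau g" using tau_homeomorphic homeomorphic_map_maps by blast
  have "homeomorphic_maps (X_DC q) (X_DC q) (\<lambda>(x, y). (tau x, id y)) (\<lambda>(x, y). (g x, id y))"
    unfolding X_DC_def homeomorphic_maps_prod using g by (simp add: homeomorphic_maps_def)
  moreover have "T_DC q = (\<lambda>(x, y). (tau x, id y))" by (auto simp: T_DC_def)
  ultimately show ?thesis using homeomorphic_map_maps by metis
qed

lemma perfect_X_DC: "perfect (X_DC q)"
  unfolding perfect_def
proof (intro ballI notI)
  fix w assume w: "w \<in> topspace (X_DC q)" and o: "openin (X_DC q) {w}"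
  have "openin (prod_topology Z (top_of_set cantor_set)) ({fst w} \<times> {snd w})" using o by (simp add: X_DC_def)
  then have "openin (top_of_set cantor_set) {snd w}" unfolding openin_prod_Times_iff by blast
  moreover have "snd w \<in> topspace (top_of_set cantor_set)" using w by (auto simp: X_DC_def)
  ultimately show False using cantor_set_perfect unfolding perfect_def by blast
qed

lemma nonempty_X_DC: "topspace (X_DC q) \<noteq> {}"
proof -
  have "((0, theta_of_int 0), 0) \<in> topspace (X_DC q)"
    using Z_set_C[OF cantor_set_basic(3) theta_of_int_in] cantor_set_basic(3) by (simp add: X_DC_def topspace_Z)
  then show ?thesis by blast
qed

end

lemma perfect_homeomorphic:
  assumes "homeomorphic_map X Y f" "perfect Y"
  shows "perfect X"
  unfolding perfect_def
proof (intro ballI notI)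
  fix x assume x: "x \<in> topspace X" and o: "openin X {x}"
  have "openin Y (f ` {x})" using homeomorphic_map_openness[OF assms(1), of "{x}"] o x by simp
  moreover have "f x \<in> topspace Y" using assms(1) x by (auto simp: homeomorphic_eq_everything_map)
  ultimately show False using assms(2) unfolding perfect_def by simp
qed

theorem theorem3p3:
  fixes X :: "'a topology" and m :: "'a metric" and q :: "real set \<Rightarrow> int \<Rightarrow> real"
  assumes "cantor_space X"
    and "mtopology_of m = X"
    and "gap_sequences q"
  shows "(\<exists>T\<in>homeos X. special_homeos q X = conj_class X T) \<and>
    gdelta_in (homeo_topology m) (special_homeos q X) \<and>
    homeo_topology m closure_of special_homeos q X = homeos X \<and>
    special_homeos q X \<subseteq> dense_type_homeos m \<and>
    \<Union>{conj_class X T | T. T \<in> homeos X \<and> conj_class X T \<noteq> special_homeos q X} =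
      homeos X - special_homeos q X \<and>
    first_category_in (homeo_topology m) (homeos X - special_homeos q X)"
proof -
  interpret gap_model q by unfold_locales (rule assms(3))
  obtain G where G: "homeomorphic_map X (top_of_set cantor_set) G"
    using assms(1) by (auto simp: cantor_space_def homeomorphic_space)
  have zX: "zdc X" by (rule zdc_homeomorphic[OF G cantor_set_zdc])
  have pX: "perfect X" by (rule perfect_homeomorphic[OF G cantor_set_perfect])
  have "G ` topspace X = cantor_set" using G by (simp add: homeomorphic_eq_everything_map)
  then have neX: "topspace X \<noteq> {}" using cantor_set_basic(3) by force
  interpret compact_metric m X
    by unfold_locales (use assms(2) zX neX in \<open>simp_all add: zdc_def\<close>)
  define U where "U = {T \<in> homeos X. universal X T}"
  \<comment> \<open>Universality characterizes the model up to isomorphism, which removes the model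
    and the choice of \<open>q\<close> from all remaining claims.\<close>
  have special: "special_homeos q X = U"
  proof (intro equalityI subsetI)
    fix T assume "T \<in> special_homeos q X"
    then obtain F where T: "T \<in> homeos X" and F: "homeomorphic_map X (X_DC q) F"
      "\<And>x. x \<in> topspace X \<Longrightarrow> F (T x) = T_DC q (F x)"
      unfolding special_homeos_def isomorphic_systems_def by blast
    have "universal X T" by (rule universal_iso[OF F universal_X_DC])
    then show "T \<in> U" using T by (simp add: U_def)
  next
    fix T assume "T \<in> U"
    then have T: "T \<in> homeos X" "universal X T" by (simp_all add: U_def)
    from universal_unique[OF zX homeosD(1)[OF T(1)] T(2) neX zdc_X_DC homeomorphic_T_DC universal_X_DC nonempty_X_DC]
    show "T \<in> special_homeos q X" unfolding special_homeos_def isomorphic_systems_def using T(1) by blast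
  qed
  \<comment> \<open>Constant partitions of nonempty spaces have equal images, so matching them
    yields a homeomorphism along which the model map is carried to \<open>X\<close>.\<close>
  have "(\<lambda>_. 0 :: nat) ` topspace X = (\<lambda>_. 0) ` topspace (X_DC q)"
    using neX nonempty_X_DC by (simp only: image_constant_conv if_False)
  from perfect_zdc_homeomorphism[OF zX pX zdc_X_DC perfect_X_DC lconst_const lconst_const this]
  obtain H where H: "homeomorphic_map X (X_DC q) H" by blast
  define T0 where "T0 = restrict (inv_into (topspace X) H \<circ> T_DC q \<circ> H) (topspace X)"
  have T0: "T0 \<in> homeos X" unfolding T0_def by (rule pullback_homeo(1)[OF H homeomorphic_T_DC])
  have HT0: "H (T0 x) = T_DC q (H x)" if "x \<in> topspace X" for x
    unfolding T0_def by (rule pullback_homeo(2)[OF H homeomorphic_T_DC that])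
  have uT0: "universal X T0" by (rule universal_iso[OF H HT0 universal_X_DC])
  have cls: "conj_class X T = U" if "T \<in> U" for T
    unfolding U_def by (rule conj_class_universal[OF zX neX]) (use that in \<open>simp_all add: U_def\<close>)
  have dense: "homeo_topology m closure_of U = homeos X"
    unfolding U_def by (rule universal_dense[OF zX pX homeosD(1)[OF T0] uT0])
  have UH: "U \<subseteq> homeos X" by (auto simp: U_def)
  have self: "T \<in> conj_class X T" if "T \<in> homeos X" for T
    unfolding conj_class_alt[OF that] using that homeomorphic_map_id[of X X]
    by (intro conjI exI[of _ id]) simp_all
  have mem: "T \<in> U" if T: "T \<in> homeos X" and T': "T' \<in> conj_class X T" "T' \<in> U" for T T'
  proof -
    obtain F where F: "homeomorphic_map X X F" "\<And>x. x \<in> topspace X \<Longrightarrow> F (T x) = T' (F x)"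
      using T'(1) unfolding conj_class_alt[OF T] by blast
    have "universal X T'" using T'(2) by (simp add: U_def)
    from universal_iso[OF F this] show ?thesis using T by (simp add: U_def)
  qed
  have rest: "\<Union>{conj_class X T | T. T \<in> homeos X \<and> conj_class X T \<noteq> U} = homeos X - U"
  proof (intro equalityI subsetI)
    fix S assume "S \<in> \<Union>{conj_class X T | T. T \<in> homeos X \<and> conj_class X T \<noteq> U}"
    then obtain T where T: "T \<in> homeos X" "conj_class X T \<noteq> U" "S \<in> conj_class X T" by blast
    have "S \<in> homeos X" using T(3) unfolding conj_class_alt[OF T(1)] by blast
    moreover have "S \<notin> U" using mem[OF T(1,3)] cls T(2) by blast
    ultimately show "S \<in> homeos X - U" by blast
  next
    fix S assume S: "S \<in> homeos X - U"
    then have "S \<in> conj_class X S" "conj_class X S \<noteq> U" using self by blast+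
    then show "S \<in> \<Union>{conj_class X T | T. T \<in> homeos X \<and> conj_class X T \<noteq> U}" using S by blast
  qed
  show ?thesis
    unfolding special
  proof (intro conjI)
    show "\<exists>T\<in>homeos X. U = conj_class X T" using T0 cls[of T0] uT0 by (auto simp: U_def)
    show "gdelta_in (homeo_topology m) U" unfolding U_def by (rule universal_gdelta[OF zX])
    show "homeo_topology m closure_of U = homeos X" by (rule dense)
    show "U \<subseteq> dense_type_homeos m"
      unfolding dense_type_homeos_def assms(2) using cls dense UH by auto
    show "first_category_in (homeo_topology m) (homeos X - U)"
      unfolding U_def by (rule first_category_complement[OF zX dense[unfolded U_def]])
  qed (rule rest)
qed

end
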